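(* Let $K$ be a field of characteristic zero and let $X$ be an affine scheme of finite type over $K$. If $\sigma \in \mathrm{Aut}_K(X)$ and $Y$ and $Z$ are closed subschemes of $X$, then the set $$S = S(Z,Y) := \{n\in\mathbb{Z} : \sigma^n(Z)\subseteq Y\}$$ has the two-sided SML property.
   Context: $\mathrm{Aut}_K(X)$ is the group of automorphisms of $X$ as a $K$-scheme. The closed subschemes are not assumed reduced; $\sigma^n(Z)$ is the image closed subscheme of $Z$ under the automorphism $\sigma^n$, and $\sigma^n(Z)\subseteq Y$ means inclusion of closed subschemes (i.e. the ideal of $\sigma^n(Z)$ in the coordinate ring of $X$ contains the ideal of $Y$). A set $S\subseteq \mathbb{Z}$ has the two-sided SML property if it is a finite union of complete (doubly infinite) arithmetic progressions $\{an+b : n\in\mathbb{Z}\}$ with $a,b \in \mathbb{Z}$, augmented by a finite (possibly empty) set. *)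

theory Defs
  imports "HOL-Algebra.Generated_Rings" "HOL-Algebra.Module" "HOL-Algebra.Ideal"
    "HOL-Analysis.Abstract_Topology"
begin

section \<open>Algebras over a ring\<close>

text \<open>Commutative algebras are those of \<^locale>\<open>algebra\<close>, carried by the record
  \<^type>\<open>module\<close>.\<close>

definition char_zero :: "('k, 'm) ring_scheme \<Rightarrow> bool" where
  "char_zero K \<longleftrightarrow> (\<forall>n::nat. n > 0 \<longrightarrow> [n] \<cdot>\<^bsub>K\<^esub> \<one>\<^bsub>K\<^esub> \<noteq> \<zero>\<^bsub>K\<^esub>)"

definition alg_hom :: "('k, 'm) ring_scheme \<Rightarrow> ('k, 'a) module \<Rightarrow> ('k, 'b) module \<Rightarrow> ('a \<Rightarrow> 'b) set" where
  "alg_hom K A B =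
     {h \<in> ring_hom A B. \<forall>c\<in>carrier K. \<forall>a\<in>carrier A. h (c \<odot>\<^bsub>A\<^esub> a) = c \<odot>\<^bsub>B\<^esub> h a}"

text \<open>The subalgebra generated by \<open>S\<close> is the subring generated by \<open>S\<close> and the scalars.\<close>

definition fin_gen_algebra :: "('k, 'm) ring_scheme \<Rightarrow> ('k, 'a) module \<Rightarrow> bool" where
  "fin_gen_algebra K A \<longleftrightarrow> algebra K A \<and>
     (\<exists>S. finite S \<and> S \<subseteq> carrier A \<and>
        generate_ring A ((\<lambda>c. c \<odot>\<^bsub>A\<^esub> \<one>\<^bsub>A\<^esub>) ` carrier K \<union> S) = carrier A)"


section \<open>Locally ringed spaces over a field\<close>

text \<open>A space over \<open>K\<close> carries a sheaf of commutative \<open>K\<close>-algebras (equivalently, for schemes,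
  a structure morphism to the spectrum of \<open>K\<close>). \<open>sections X U\<close> is the algebra of sections over
  the open set \<open>U\<close>, and \<open>restr X U V\<close> restricts from \<open>U\<close> to \<open>V\<close>; both are meaningful only on
  open sets \<open>V \<subseteq> U\<close>.\<close>

record ('k, 'p, 's) algebraic_space =
  top_of :: "'p topology"
  sections :: "'p set \<Rightarrow> ('k, 's) module"
  restr :: "'p set \<Rightarrow> 'p set \<Rightarrow> 's \<Rightarrow> 's"

abbreviation points :: "('k, 'p, 's) algebraic_space \<Rightarrow> 'p set" where
  "points X \<equiv> topspace (top_of X)"

abbreviation open_of :: "('k, 'p, 's) algebraic_space \<Rightarrow> 'p set \<Rightarrow> bool" where
  "open_of X U \<equiv> openin (top_of X) U"

abbreviation global_sections :: "('k, 'p, 's) algebraic_space \<Rightarrow> ('k, 's) module" where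
  "global_sections X \<equiv> sections X (points X)"

definition is_presheaf :: "('k, 'm) ring_scheme \<Rightarrow> ('k, 'p, 's) algebraic_space \<Rightarrow> bool" where
  "is_presheaf K X \<longleftrightarrow>
     (\<forall>U. open_of X U \<longrightarrow> algebra K (sections X U)) \<and>
     (\<forall>U V. open_of X U \<longrightarrow> open_of X V \<longrightarrow> V \<subseteq> U \<longrightarrow>
        restr X U V \<in> alg_hom K (sections X U) (sections X V)) \<and>
     (\<forall>U. open_of X U \<longrightarrow> (\<forall>s\<in>carrier (sections X U). restr X U U s = s)) \<and>
     (\<forall>U V W. open_of X U \<longrightarrow> open_of X V \<longrightarrow> open_of X W \<longrightarrow> W \<subseteq> V \<longrightarrow> V \<subseteq> U \<longrightarrow>
        (\<forall>s\<in>carrier (sections X U). restr X V W (restr X U V s) = restr X U W s))"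

definition is_sheaf :: "('k, 'm) ring_scheme \<Rightarrow> ('k, 'p, 's) algebraic_space \<Rightarrow> bool" where
  "is_sheaf K X \<longleftrightarrow> is_presheaf K X \<and>
     (\<forall>\<U>. (\<forall>V\<in>\<U>. open_of X V) \<longrightarrow>
        (\<forall>s\<in>carrier (sections X (\<Union>\<U>)). \<forall>t\<in>carrier (sections X (\<Union>\<U>)).
           (\<forall>V\<in>\<U>. restr X (\<Union>\<U>) V s = restr X (\<Union>\<U>) V t) \<longrightarrow> s = t) \<and>
        (\<forall>g. (\<forall>V\<in>\<U>. g V \<in> carrier (sections X V)) \<longrightarrow>
           (\<forall>V\<in>\<U>. \<forall>W\<in>\<U>. restr X V (V \<inter> W) (g V) = restr X W (V \<inter> W) (g W)) \<longrightarrow>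
           (\<exists>s\<in>carrier (sections X (\<Union>\<U>)). \<forall>V\<in>\<U>. restr X (\<Union>\<U>) V s = g V)))"

text \<open>\<open>germ_unit X U s x\<close>: the germ at \<open>x\<close> of the section \<open>s\<close> over \<open>U\<close> is a unit of the stalk
  at \<open>x\<close>. A germ is invertible iff it is represented by an invertible section.\<close>

definition germ_unit :: "('k, 'p, 's) algebraic_space \<Rightarrow> 'p set \<Rightarrow> 's \<Rightarrow> 'p \<Rightarrow> bool" where
  "germ_unit X U s x \<longleftrightarrow>
     (\<exists>V. open_of X V \<and> x \<in> V \<and> V \<subseteq> U \<and> restr X U V s \<in> Units (sections X V))"

text \<open>A ring is local iff \<open>0\<close> is a non-unit and the sum of two non-units is a non-unit; two germs
  at \<open>x\<close> always have representatives over a common neighbourhood of \<open>x\<close>.\<close>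

definition local_stalk :: "('k, 'p, 's) algebraic_space \<Rightarrow> 'p \<Rightarrow> bool" where
  "local_stalk X x \<longleftrightarrow>
     (\<forall>U. open_of X U \<longrightarrow> x \<in> U \<longrightarrow>
        \<not> germ_unit X U \<zero>\<^bsub>sections X U\<^esub> x \<and>
        (\<forall>s\<in>carrier (sections X U). \<forall>t\<in>carrier (sections X U).
           germ_unit X U (s \<oplus>\<^bsub>sections X U\<^esub> t) x \<longrightarrow> germ_unit X U s x \<or> germ_unit X U t x))"

definition locally_ringed_space :: "('k, 'm) ring_scheme \<Rightarrow> ('k, 'p, 's) algebraic_space \<Rightarrow> bool" where
  "locally_ringed_space K X \<longleftrightarrow> is_sheaf K X \<and> (\<forall>x\<in>points X. local_stalk X x)"

definition open_subspace :: "('k, 'p, 's) algebraic_space \<Rightarrow> 'p set \<Rightarrow> ('k, 'p, 's) algebraic_space" where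
  "open_subspace X U =
     \<lparr>top_of = subtopology (top_of X) U, sections = sections X, restr = restr X\<rparr>"


section \<open>Morphisms\<close>

text \<open>All components are normalised to \<^term>\<open>undefined\<close> outside their domains, so that equality
  of records is equality of morphisms.\<close>

record ('p, 's, 'q, 't) space_map =
  base_map :: "'p \<Rightarrow> 'q"
  comorph :: "'q set \<Rightarrow> 't \<Rightarrow> 's"

definition inv_img ::
  "('k, 'p, 's) algebraic_space \<Rightarrow> ('p, 's, 'q, 't) space_map \<Rightarrow> 'q set \<Rightarrow> 'p set" where
  "inv_img X f V = {x \<in> points X. base_map f x \<in> V}"

definition mors :: "('k, 'm) ring_scheme \<Rightarrow> ('k, 'p, 's) algebraic_space
    \<Rightarrow> ('k, 'q, 't) algebraic_space \<Rightarrow> ('p, 's, 'q, 't) space_map set" where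
  "mors K X Y = {f.
     base_map f \<in> extensional (points X) \<and>
     comorph f \<in> extensional {V. open_of Y V} \<and>
     (\<forall>V. open_of Y V \<longrightarrow> comorph f V \<in> extensional (carrier (sections Y V))) \<and>
     continuous_map (top_of X) (top_of Y) (base_map f) \<and>
     (\<forall>V. open_of Y V \<longrightarrow>
        comorph f V \<in> alg_hom K (sections Y V) (sections X (inv_img X f V))) \<and>
     (\<forall>V W. open_of Y V \<longrightarrow> open_of Y W \<longrightarrow> W \<subseteq> V \<longrightarrow>
        (\<forall>t\<in>carrier (sections Y V).
           restr X (inv_img X f V) (inv_img X f W) (comorph f V t) = comorph f W (restr Y V W t))) \<and>
     \<comment> \<open>the maps on stalks are local, i.e. reflect units\<close>
     (\<forall>V. open_of Y V \<longrightarrow> (\<forall>t\<in>carrier (sections Y V). \<forall>x\<in>inv_img X f V.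
        germ_unit X (inv_img X f V) (comorph f V t) x \<longrightarrow> germ_unit Y V t (base_map f x)))}"

definition id_mor :: "('k, 'p, 's) algebraic_space \<Rightarrow> ('p, 's, 'p, 's) space_map" where
  "id_mor X =
     \<lparr>base_map = (\<lambda>x\<in>points X. x),
      comorph = (\<lambda>U\<in>{U. open_of X U}. \<lambda>s\<in>carrier (sections X U). s)\<rparr>"

text \<open>\<open>comp_mor X Y Z g f\<close> is the composite of \<open>f\<close> from \<open>X\<close> to \<open>Y\<close> and \<open>g\<close> from \<open>Y\<close> to \<open>Z\<close>.\<close>

definition comp_mor :: "('k, 'p, 's) algebraic_space \<Rightarrow> ('k, 'q, 't) algebraic_space
    \<Rightarrow> ('k, 'r, 'u) algebraic_space
    \<Rightarrow> ('q, 't, 'r, 'u) space_map \<Rightarrow> ('p, 's, 'q, 't) space_map \<Rightarrow> ('p, 's, 'r, 'u) space_map" where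
  "comp_mor X Y Z g f =
     \<lparr>base_map = compose (points X) (base_map g) (base_map f),
      comorph = (\<lambda>W\<in>{W. open_of Z W}.
        compose (carrier (sections Z W)) (comorph f (inv_img Y g W)) (comorph g W))\<rparr>"

definition isomorphic_spaces :: "('k, 'm) ring_scheme \<Rightarrow> ('k, 'p, 's) algebraic_space
    \<Rightarrow> ('k, 'q, 't) algebraic_space \<Rightarrow> bool" where
  "isomorphic_spaces K X Y \<longleftrightarrow>
     (\<exists>f\<in>mors K X Y. \<exists>g\<in>mors K Y X.
        comp_mor X Y X g f = id_mor X \<and> comp_mor Y X Y f g = id_mor Y)"

definition End_monoid :: "('k, 'm) ring_scheme \<Rightarrow> ('k, 'p, 's) algebraic_space
    \<Rightarrow> ('p, 's, 'p, 's) space_map monoid" where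
  "End_monoid K X =
     \<lparr>carrier = mors K X X, mult = comp_mor X X X, one = id_mor X\<rparr>"

definition Aut_group :: "('k, 'm) ring_scheme \<Rightarrow> ('k, 'p, 's) algebraic_space
    \<Rightarrow> ('p, 's, 'p, 's) space_map monoid" where
  "Aut_group K X = units_of (End_monoid K X)"


section \<open>Spectra and schemes\<close>

text \<open>Localisation of \<open>A\<close> at the complement of \<open>P\<close>; \<open>local_frac A P a s\<close> is the class of \<open>a / s\<close>.\<close>

definition local_frac :: "('k, 'a) module \<Rightarrow> 'a set \<Rightarrow> 'a \<Rightarrow> 'a \<Rightarrow> ('a \<times> 'a) set" where
  "local_frac A P a s = {(b, t). b \<in> carrier A \<and> t \<in> carrier A - P \<and>
     (\<exists>u\<in>carrier A - P. u \<otimes>\<^bsub>A\<^esub> (a \<otimes>\<^bsub>A\<^esub> t) = u \<otimes>\<^bsub>A\<^esub> (b \<otimes>\<^bsub>A\<^esub> s))}"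

definition local_alg :: "('k, 'a) module \<Rightarrow> 'a set \<Rightarrow> ('k, ('a \<times> 'a) set) module" where
  "local_alg A P =
     \<lparr>carrier = {local_frac A P a s | a s. a \<in> carrier A \<and> s \<in> carrier A - P},
      mult = (\<lambda>x y. \<Union>(a, s)\<in>x. \<Union>(b, t)\<in>y. local_frac A P (a \<otimes>\<^bsub>A\<^esub> b) (s \<otimes>\<^bsub>A\<^esub> t)),
      one = local_frac A P \<one>\<^bsub>A\<^esub> \<one>\<^bsub>A\<^esub>,
      zero = local_frac A P \<zero>\<^bsub>A\<^esub> \<one>\<^bsub>A\<^esub>,
      add = (\<lambda>x y. \<Union>(a, s)\<in>x. \<Union>(b, t)\<in>y.
        local_frac A P (a \<otimes>\<^bsub>A\<^esub> t \<oplus>\<^bsub>A\<^esub> b \<otimes>\<^bsub>A\<^esub> s) (s \<otimes>\<^bsub>A\<^esub> t)),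
      smult = (\<lambda>c x. \<Union>(a, s)\<in>x. local_frac A P (c \<odot>\<^bsub>A\<^esub> a) s)\<rparr>"

definition zariski :: "('k, 'a) module \<Rightarrow> 'a set topology" where
  "zariski A = topology_generated_by {{P. primeideal P A \<and> a \<notin> P} | a. a \<in> carrier A}"

text \<open>Sections of the structure sheaf over \<open>U\<close> are the families of elements of the local rings
  that are locally given by a single fraction.\<close>

definition spec_carrier :: "('k, 'a) module \<Rightarrow> 'a set set \<Rightarrow> ('a set \<Rightarrow> ('a \<times> 'a) set) set" where
  "spec_carrier A U = {s \<in> (\<Pi>\<^sub>E P\<in>U. carrier (local_alg A P)).
     \<forall>P\<in>U. \<exists>V a b. openin (zariski A) V \<and> P \<in> V \<and> V \<subseteq> U \<and> a \<in> carrier A \<and> b \<in> carrier A \<and>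
       (\<forall>Q\<in>V. b \<notin> Q \<and> s Q = local_frac A Q a b)}"

definition spec_sections ::
  "('k, 'a) module \<Rightarrow> 'a set set \<Rightarrow> ('k, 'a set \<Rightarrow> ('a \<times> 'a) set) module" where
  "spec_sections A U =
     \<lparr>carrier = spec_carrier A U,
      mult = (\<lambda>s t. \<lambda>P\<in>U. s P \<otimes>\<^bsub>local_alg A P\<^esub> t P),
      one = (\<lambda>P\<in>U. \<one>\<^bsub>local_alg A P\<^esub>),
      zero = (\<lambda>P\<in>U. \<zero>\<^bsub>local_alg A P\<^esub>),
      add = (\<lambda>s t. \<lambda>P\<in>U. s P \<oplus>\<^bsub>local_alg A P\<^esub> t P),
      smult = (\<lambda>c s. \<lambda>P\<in>U. c \<odot>\<^bsub>local_alg A P\<^esub> s P)\<rparr>"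

definition Spec ::
  "('k, 'a) module \<Rightarrow> ('k, 'a set, 'a set \<Rightarrow> ('a \<times> 'a) set) algebraic_space" where
  "Spec A =
     \<lparr>top_of = zariski A, sections = spec_sections A, restr = (\<lambda>U V s. restrict s V)\<rparr>"

text \<open>It is no restriction that \<open>A\<close> lives on the type of the sections of \<open>X\<close>: up to isomorphism
  \<open>A\<close> is the algebra of global sections of \<open>X\<close>.\<close>

definition affine_scheme :: "('k, 'm) ring_scheme \<Rightarrow> ('k, 'p, 's) algebraic_space \<Rightarrow> bool" where
  "affine_scheme K X \<longleftrightarrow> locally_ringed_space K X \<and>
     (\<exists>A :: ('k, 's) module. algebra K A \<and> isomorphic_spaces K X (Spec A))"

definition is_scheme :: "('k, 'm) ring_scheme \<Rightarrow> ('k, 'p, 's) algebraic_space \<Rightarrow> bool" where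
  "is_scheme K X \<longleftrightarrow> locally_ringed_space K X \<and>
     (\<forall>x\<in>points X. \<exists>U. open_of X U \<and> x \<in> U \<and> affine_scheme K (open_subspace X U))"

definition affine_scheme_of_finite_type ::
  "('k, 'm) ring_scheme \<Rightarrow> ('k, 'p, 's) algebraic_space \<Rightarrow> bool" where
  "affine_scheme_of_finite_type K X \<longleftrightarrow>
     affine_scheme K X \<and> fin_gen_algebra K (global_sections X)"


section \<open>Closed subschemes\<close>

text \<open>A closed subscheme of \<open>X\<close> is given by a scheme \<open>Z\<close> with a closed immersion \<open>i\<close> into \<open>X\<close>:
  a homeomorphism onto a closed subset such that the map from the structure sheaf of \<open>X\<close> to the
  direct image of that of \<open>Z\<close> is surjective, i.e. sections lift locally.\<close>

definition closed_subscheme :: "('k, 'm) ring_scheme \<Rightarrow> ('k, 'p, 's) algebraic_space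
    \<Rightarrow> ('k, 'q, 't) algebraic_space \<Rightarrow> ('q, 't, 'p, 's) space_map \<Rightarrow> bool" where
  "closed_subscheme K X Z i \<longleftrightarrow> is_scheme K Z \<and> i \<in> mors K Z X \<and>
     embedding_map (top_of Z) (top_of X) (base_map i) \<and>
     closedin (top_of X) (base_map i ` points Z) \<and>
     (\<forall>V. open_of X V \<longrightarrow> (\<forall>t\<in>carrier (sections Z (inv_img Z i V)). \<forall>x\<in>V.
        \<exists>W s. open_of X W \<and> x \<in> W \<and> W \<subseteq> V \<and> s \<in> carrier (sections X W) \<and>
          comorph i W s = restr Z (inv_img Z i V) (inv_img Z i W) t))"

text \<open>The ideal, in the coordinate ring of an affine scheme \<open>X\<close>, of the closed subscheme given by
  \<open>i\<close>. Note that \<^term>\<open>inv_img Z i (points X) = points Z\<close>.\<close>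

definition ideal_of :: "('k, 'p, 's) algebraic_space \<Rightarrow> ('k, 'q, 't) algebraic_space
    \<Rightarrow> ('q, 't, 'p, 's) space_map \<Rightarrow> 's set" where
  "ideal_of X Z i = a_kernel (global_sections X) (global_sections Z) (comorph i (points X))"

definition subscheme_le :: "('k, 'p, 's) algebraic_space
    \<Rightarrow> ('k, 'q, 't) algebraic_space \<Rightarrow> ('q, 't, 'p, 's) space_map
    \<Rightarrow> ('k, 'r, 'u) algebraic_space \<Rightarrow> ('r, 'u, 'p, 's) space_map \<Rightarrow> bool" where
  "subscheme_le X Z i Y j \<longleftrightarrow> ideal_of X Y j \<subseteq> ideal_of X Z i"

text \<open>The image of the closed subscheme \<open>i\<close> under an automorphism \<open>f\<close> of \<open>X\<close> is the same scheme
  \<open>Z\<close>, embedded by \<open>f \<circ> i\<close>.\<close>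

definition image_subscheme :: "('k, 'p, 's) algebraic_space \<Rightarrow> ('k, 'q, 't) algebraic_space
    \<Rightarrow> ('p, 's, 'p, 's) space_map \<Rightarrow> ('q, 't, 'p, 's) space_map \<Rightarrow> ('q, 't, 'p, 's) space_map" where
  "image_subscheme X Z f i = comp_mor Z X X f i"


section \<open>The two-sided SML property\<close>

text \<open>A progression with \<open>a = 0\<close> is a single point, so allowing it changes nothing.\<close>

definition two_sided_SML :: "int set \<Rightarrow> bool" where
  "two_sided_SML S \<longleftrightarrow>
     (\<exists>(P :: (int \<times> int) set) F. finite P \<and> finite F \<and>
        S = (\<Union>(a, b)\<in>P. {a * n + b | n. True}) \<union> F)"

end

theory Submission
  imports Defs "HOL-Computational_Algebra.Polynomial" "HOL-Computational_Algebra.Primes"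
    "HOL-Library.Poly_Mapping"
begin

text \<open>
  Write \<open>A\<close> for the algebra of global sections of the scheme, \<open>\<phi>\<^sub>n\<close> for the action of \<open>\<sigma>\<^sup>n\<close> on \<open>A\<close>, and
  \<open>I\<close>, \<open>J\<close> for the ideals of \<open>Z\<close> and \<open>Y\<close>. The condition on \<open>n\<close> says that \<open>\<phi>\<^sub>n\<close> maps \<open>J\<close> into \<open>I\<close>.
  As \<open>A\<close> is noetherian, \<open>J\<close> has finitely many generators, and sets that are finite or full on every
  residue class of some modulus are closed under intersection; so one may fix \<open>f \<in> A\<close> and study
  \<open>{n. \<phi>\<^sub>n f \<in> I}\<close>. Only finitely many scalars occur in \<open>f\<close> and in the images of the generators
  of \<open>A\<close> under \<open>\<phi>\<^sub>1\<close> and \<open>\<phi>\<^sub>-\<^sub>1\<close>. Hence \<open>A\<close> may be replaced by a finitely generated commutative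
  ring \<open>R\<close>, and \<open>I\<close> by an ideal of \<open>R\<close>; the quotient \<open>R/I\<close> is torsion-free as an abelian group
  because the field has characteristic zero.

  By noetherian induction \<open>I\<close> may be taken irreducible among the ideals with torsion-free quotient, and then
  every element of \<open>R/I\<close> is nilpotent or a non-zero-divisor (\<open>eventually_periodic_saturated\<close>).
  Such a quotient is, up to denominators, a free module of finite rank over a polynomial ring
  \<open>T = \<int>[t\<^sub>1,\<dots>,t\<^sub>e]\<close>. Evaluating \<open>T\<close> at an integral point where the denominators do not vanish
  modulo a prime \<open>p\<close>, and at all integral points congruent to it modulo \<open>p\<close>, turns the coordinates
  into additive functions \<open>l\<close> from \<open>R\<close> to the rational numbers with denominators prime to \<open>p\<close>.
  They vanish simultaneously exactly on \<open>I\<close>, and there is an ideal \<open>q\<close> of finite index in \<open>R\<close>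
  such that all of them map \<open>q\<^sup>j\<close> into the multiples of \<open>p\<^sup>j\<close> (\<open>ex_interpolation\<close>).

  Since \<open>R/q\<^sup>3\<close> is finite, some \<open>\<phi>\<^sub>k\<close> with \<open>k > 0\<close> induces the identity on it (\<open>ex_period\<close>), and then
  \<open>\<Delta> = \<phi>\<^sub>k - 1\<close> maps \<open>q\<^sup>j\<close> into \<open>q\<^sup>j\<^sup>+\<^sup>2\<close>. Newton's formula gives
  \<open>l (\<phi>\<^sub>k\<^sub>n x) = \<Sum>\<^sub>j (n choose j) l (\<Delta>\<^sup>j x)\<close> with coefficients divisible by \<open>p\<^sup>2\<^sup>j\<close>. By an argument of
  Hansel (\<open>Skolem_Hansel\<close>) such a sequence vanishes identically as soon as it has infinitely many
  zeros. So on each residue class modulo \<open>k\<close> the set of all \<open>n\<close> with \<open>\<phi>\<^sub>n f \<in> I\<close> is finite or full.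

  The commutative algebra takes place in a type of class \<open>comm_ring_1\<close>: the algebra \<open>A\<close> is the image
  of the polynomial ring over \<open>\<int>\<close> with one variable for each element, and every subring, ideal and
  endomorphism of \<open>A\<close> is represented upstairs, modulo the kernel \<open>N\<close> of the evaluation map.
\<close>

section \<open>Rational numbers divisible by powers of a prime\<close>

text \<open>The element \<open>x\<close> lies in \<open>p\<^sup>j\<close> times the localisation of the
  integers at the prime \<open>p\<close>.\<close>

definition pdiv :: "int \<Rightarrow> nat \<Rightarrow> rat \<Rightarrow> bool" where
  "pdiv p j x \<longleftrightarrow> (\<exists>a b. \<not> p dvd b \<and> of_int b * x = of_int (p ^ j * a))"

lemma pdivI: "\<not> p dvd b \<Longrightarrow> of_int b * x = of_int (p ^ j * a) \<Longrightarrow> pdiv p j x"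
  unfolding pdiv_def by blast

lemma pdiv_of_int: "prime p \<Longrightarrow> p ^ j dvd z \<Longrightarrow> pdiv p j (of_int z)"
  by (rule pdivI[of p 1 _ _ "z div p ^ j"]) (auto simp: not_prime_unit)

lemma pdiv_0: "prime p \<Longrightarrow> pdiv p j 0"
  using pdiv_of_int[of p j 0] by simp

lemma pdiv_add:
  assumes "prime p" "pdiv p j x" "pdiv p j y" shows "pdiv p j (x + y)"
proof -
  obtain a b c d where *: "\<not> p dvd b" "of_int b * x = of_int (p ^ j * a)"
    "\<not> p dvd d" "of_int d * y = of_int (p ^ j * c)"
    using assms(2,3) unfolding pdiv_def by blast
  have "of_int (b * d) * (x + y) = of_int d * (of_int b * x) + of_int b * (of_int d * y)"
    by (simp add: algebra_simps)
  also have "\<dots> = of_int (p ^ j * (a * d + c * b))"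
    unfolding * by (simp add: algebra_simps)
  finally show ?thesis
    by (rule pdivI[rotated]) (use * assms(1) prime_dvd_mult_iff in blast)
qed

lemma pdiv_mult:
  assumes "prime p" "pdiv p i x" "pdiv p j y" shows "pdiv p (i + j) (x * y)"
proof -
  obtain a b c d where *: "\<not> p dvd b" "of_int b * x = of_int (p ^ i * a)"
    "\<not> p dvd d" "of_int d * y = of_int (p ^ j * c)"
    using assms(2,3) unfolding pdiv_def by blast
  have "of_int (b * d) * (x * y) = (of_int b * x) * (of_int d * y)"
    by (simp add: algebra_simps)
  also have "\<dots> = of_int (p ^ (i + j) * (a * c))"
    unfolding * by (simp add: algebra_simps power_add)
  finally show ?thesis
    by (rule pdivI[rotated]) (use * assms(1) prime_dvd_mult_iff in blast)
qed

lemma pdiv_mult_int: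
  assumes "prime p" "pdiv p j x" shows "pdiv p j (of_int z * x)"
  using pdiv_mult[OF assms(1) pdiv_of_int[of p 0 z] assms(2)] assms(1) by simp

lemma pdiv_mono:
  assumes "pdiv p j x" "i \<le> j" shows "pdiv p i x"
proof -
  obtain a b where *: "\<not> p dvd b" "of_int b * x = of_int (p ^ j * a)"
    using assms(1) unfolding pdiv_def by blast
  have "p ^ j * a = p ^ i * (p ^ (j - i) * a)"
    using assms(2) by (simp flip: power_add mult.assoc)
  then show ?thesis using * pdivI by metis
qed

lemma pdiv_sum:
  assumes "prime p" "\<And>x. x \<in> A \<Longrightarrow> pdiv p j (f x)" shows "pdiv p j (sum f A)"
  using assms(2) by (induction A rule: infinite_finite_induct) (auto simp: assms(1) pdiv_0 pdiv_add)

lemma pdiv_all_imp_0: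
  assumes p: "prime p" and x: "\<And>j. pdiv p j x" shows "x = 0"
proof (rule ccontr)
  assume "x \<noteq> 0"
  obtain u v where uv: "x = of_int u / of_int v" "v > 0"
    by (metis quotient_of_div quotient_of_denom_pos surj_pair)
  have "p ^ j dvd u" for j
  proof -
    obtain a b where *: "\<not> p dvd b" "of_int b * x = of_int (p ^ j * a)"
      using x unfolding pdiv_def by blast
    have "of_int (b * u) = (of_int b * x) * of_int v" using uv by simp
    also have "\<dots> = of_int (p ^ j * a * v)" unfolding * by simp
    finally have "b * u = p ^ j * (a * v)" by (simp only: of_int_eq_iff mult.assoc)
    then have "p ^ j dvd b * u" by simp
    moreover have "coprime (p ^ j) b"
      using * p by (simp add: prime_imp_coprime)
    ultimately show ?thesis using coprime_dvd_mult_right_iff by blast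
  qed
  moreover have "u \<noteq> 0" using \<open>x \<noteq> 0\<close> uv by auto
  moreover have "is_unit p \<longleftrightarrow> False" using p not_prime_unit by blast
  ultimately show False
    by (metis multiplicity_geI not_less_eq_eq order_refl)
qed

text \<open>The multiples of \<open>p\<close> among \<open>1, \<dots>, n\<close> contribute the factor
  \<open>p ^ (n div p) * fact (n div p)\<close> to \<open>fact n\<close>. So the exponent
  \<open>v n\<close> of \<open>p\<close> satisfies \<open>v n = n div p + v (n div p)\<close>,
  and \<open>p \<ge> 2\<close> gives \<open>v n \<le> 2 * (n div p) \<le> n\<close>.\<close>

lemma fact_split:
  assumes "prime (p::nat)"
  shows "\<exists>m s. m \<le> n \<and> \<not> p dvd s \<and> (fact n :: nat) = p ^ m * s"
proof (induction n rule: less_induct)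
  case (less n)
  let ?c = "\<lambda>n. \<Prod>l | l \<in> {1..n} \<and> \<not> p dvd l. l"
  have p: "p > 1" using assms prime_gt_1_nat by blast
  have *: "fact n = p ^ (n div p) * fact (n div p) * ?c n" for n
  proof (induction n)
    case (Suc n)
    show ?case
    proof (cases "p dvd Suc n")
      case True
      have "{l \<in> {1..Suc n}. \<not> p dvd l} = {l \<in> {1..n}. \<not> p dvd l}"
        using True by (auto simp: le_Suc_eq)
      moreover have d: "Suc n div p = Suc (n div p)" using True p
        by (simp add: div_Suc mod_eq_0_iff_dvd)
      moreover have "fact (Suc n) = p ^ Suc (n div p) * (Suc (n div p) * fact (n div p)) * ?c n"
      proof -
        have n: "Suc n = p * Suc (n div p)" using True d by (metis dvd_mult_div_cancel)
        have "fact (Suc n) = Suc n * (p ^ (n div p) * fact (n div p) * ?c n)"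
          using Suc.IH by simp
        also have "\<dots> = p * Suc (n div p) * (p ^ (n div p) * fact (n div p) * ?c n)"
          using n by (rule arg_cong)
        finally show ?thesis by (simp only: power_Suc mult_ac)
      qed
      ultimately show ?thesis by simp
    next
      case False
      have "{l \<in> {1..Suc n}. \<not> p dvd l} = insert (Suc n) {l \<in> {1..n}. \<not> p dvd l}"
        using False by (auto simp: le_Suc_eq)
      moreover have "Suc n div p = n div p" using False p
        by (simp add: div_Suc mod_eq_0_iff_dvd)
      ultimately show ?thesis using Suc.IH
        by (simp add: fact_Suc algebra_simps)
    qed
  qed simp
  have c: "\<not> p dvd ?c n"
    using assms by (subst prime_dvd_prod_iff) auto
  show ?case
  proof (cases "n = 0")
    case True
    then show ?thesis using p by (intro exI[of _ 0] exI[of _ 1]) auto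
  next
    case False
    then have "n div p < n" using p by simp
    then obtain m s where ms: "m \<le> n div p" "\<not> p dvd s" "(fact (n div p) :: nat) = p ^ m * s"
      using less by blast
    have "n div p + m \<le> 2 * (n div p)" using ms by simp
    also have "\<dots> \<le> p * (n div p)" using p by (intro mult_right_mono) auto
    also have "\<dots> \<le> n" by simp
    finally have "n div p + m \<le> n" .
    moreover have "fact n = p ^ (n div p + m) * (s * ?c n)"
      using *[of n] ms(3) by (simp add: power_add mult_ac)
    moreover have "\<not> p dvd s * ?c n" using ms c assms by (simp add: prime_dvd_mult_iff)
    ultimately show ?thesis by blast
  qed
qed

text \<open>Half of the divisibility pays for the factorial in the denominator of a binomial
  coefficient.\<close>

lemma pdiv_div_fact:
  assumes p: "prime p" and x: "pdiv p (2 * n) x" shows "pdiv p n (x / fact n)"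
proof -
  have "p > 0" using p prime_gt_0_int by blast
  have "prime (nat p)" using p by simp
  then obtain m s where ms: "m \<le> n" "\<not> nat p dvd s" "(fact n :: nat) = nat p ^ m * s"
    using fact_split by blast
  have s: "\<not> p dvd int s" using ms(2) \<open>p > 0\<close> by (simp add: nat_dvd_iff)
  have f: "(fact n :: rat) = of_int (p ^ m * int s)"
    by (metis \<open>p > 0\<close> ms(3) int_nat_eq less_imp_le of_int_of_nat_eq of_nat_fact of_nat_mult of_nat_power)
  obtain a b where *: "\<not> p dvd b" "of_int b * x = of_int (p ^ (2 * n) * a)"
    using x unfolding pdiv_def by blast
  have nz: "(of_int p ^ m :: rat) \<noteq> 0" "(of_int (int s) :: rat) \<noteq> 0" using \<open>p > 0\<close> s by (auto intro!: Nat.gr0I)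
  have e: "p ^ (2 * n) = p ^ m * p ^ (n + (n - m))"
    using ms(1) by (simp add: mult_2 flip: power_add)
  have "of_int (b * int s) * (x / fact n) = of_int (int s) * (of_int b * x) / fact n" by simp
  also have "\<dots> = of_int (p ^ n * (p ^ (n - m) * a))"
    unfolding *(2) f e using nz \<open>p > 0\<close> by (simp add: power_add)
  finally show ?thesis
    by (rule pdivI[rotated]) (use * s p prime_dvd_mult_iff in blast)
qed

text \<open>Splitting off a root gains one power of \<open>p\<close> in every degree: with \<open>R = (X
  - t) Q\<close> one has \<open>Q\<^sub>k = R\<^sub>k\<^sub>+\<^sub>1 + t
  Q\<^sub>k\<^sub>+\<^sub>1\<close>, and the coefficients of \<open>R\<close> become more
  divisible as the degree grows.\<close>

lemma pdiv_coeff_linear_factor: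
  fixes Q :: "rat poly"
  assumes p: "prime p" and R: "\<And>k. pdiv p (k + m) (coeff ([:- of_int t, 1:] * Q) k)"
  shows "pdiv p (k + Suc m) (coeff Q k)"
proof (induction "Suc (degree Q) - k" arbitrary: k rule: less_induct)
  case less
  show ?case
  proof (cases "k > degree Q")
    case True
    then show ?thesis using pdiv_0[OF p] by (simp add: coeff_eq_0)
  next
    case False
    then have "pdiv p (Suc k + Suc m) (coeff Q (Suc k))" by (intro less) auto
    then have 1: "pdiv p (k + Suc m) (of_int t * coeff Q (Suc k))"
      by (intro pdiv_mult_int[OF p]) (rule pdiv_mono, auto)
    have 2: "pdiv p (k + Suc m) (coeff ([:- of_int t, 1:] * Q) (Suc k))"
      using R[of "Suc k"] by simp
    have "coeff Q k = coeff ([:- of_int t, 1:] * Q) (Suc k) + of_int t * coeff Q (Suc k)"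
      by simp
    then show ?thesis using pdiv_add[OF p 2 1] by simp
  qed
qed

text \<open>Each integral root that is split off guarantees one more factor \<open>p\<close> in all
  integral values.\<close>

lemma pdiv_roots:
  fixes R :: "rat poly"
  assumes p: "prime p" and "finite A" "\<And>k. pdiv p (k + m) (coeff R k)"
    "\<And>t. t \<in> A \<Longrightarrow> poly R (of_int t) = 0"
  shows "pdiv p (m + card A) (poly R (of_int n))"
  using assms(2-)
proof (induction A arbitrary: R m rule: finite_induct)
  case empty
  have "pdiv p m (coeff R i * of_int n ^ i)" for i
    using pdiv_mult_int[OF p pdiv_mono[OF empty(1)[of i]], of m "n ^ i"] by (simp add: mult.commute)
  then show ?case by (auto simp: poly_altdef intro!: pdiv_sum[OF p])
next
  case (insert t A)
  obtain Q where Q: "R = [:- of_int t, 1:] * Q"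
    using insert.prems(2)[of t] by (auto simp: poly_eq_0_iff_dvd)
  have 1: "pdiv p (k + Suc m) (coeff Q k)" for k
    using pdiv_coeff_linear_factor[OF p insert.prems(1)[unfolded Q]] .
  have 2: "poly Q (of_int s) = 0" if "s \<in> A" for s
    using insert.prems(2)[of s] that insert.hyps unfolding Q by auto
  have "pdiv p (Suc m + card A) (poly Q (of_int n))" by (rule insert.IH[OF 1 2])
  then have "pdiv p (Suc m + card A) (of_int (n - t) * poly Q (of_int n))"
    by (rule pdiv_mult_int[OF p])
  then show ?case using insert.hyps by (simp add: Q algebra_simps)
qed

lemma poly_ffact_int:
  "poly (\<Prod>l<i. [:- of_nat l, 1:]) x = fact i * ((x::rat) gchoose i)"
  by (simp add: poly_prod gbinomial_prod_rev atLeast0LessThan)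

text \<open>Hansel's form of Skolem's argument. On an initial segment of the natural numbers
  \<open>u\<close> agrees with a polynomial whose coefficient of degree \<open>k\<close> is
  divisible by \<open>p\<^sup>k\<close>, because \<open>n choose i\<close> has degree
  \<open>i\<close> in \<open>n\<close> and denominator \<open>fact i\<close>. If
  \<open>m\<close> of the values vanish, then all values are divisible by
  \<open>p\<^sup>m\<close>, and \<open>m\<close> is arbitrary.\<close>

theorem Skolem_Hansel:
  fixes u d :: "nat \<Rightarrow> rat"
  assumes p: "prime p" and d: "\<And>i. pdiv p (2 * i) (d i)"
    and u: "\<And>n. u n = (\<Sum>i\<le>n. of_nat (n choose i) * d i)"
    and inf: "infinite {n. u n = 0}"
  shows "u n = 0"
proof (rule pdiv_all_imp_0[OF p])
  fix m
  obtain A where A: "finite A" "card A = m" "A \<subseteq> {n. u n = 0}"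
    using infinite_arbitrarily_large[OF inf] by blast
  obtain M where M: "A \<subseteq> {..M}" using A(1) finite_nat_iff_bounded_le by blast
  \<comment> \<open>the polynomial has to agree with the sequence at all chosen zeros and at the point in
    question\<close>
  define N where "N = max M n"
  define R where "R = (\<Sum>i\<le>N. smult (d i / fact i) (\<Prod>l<i. [:- of_nat l, 1:]))"
  have val: "poly R (of_int (int k)) = u k" if "k \<le> N" for k
  proof -
    have "poly R (of_int (int k)) = (\<Sum>i\<le>N. of_nat (k choose i) * d i)"
      by (simp add: R_def poly_sum poly_ffact_int binomial_gbinomial[symmetric] mult_ac)
    also have "\<dots> = u k" unfolding u using that
      by (intro sum.mono_neutral_right) auto
    finally show ?thesis .
  qed
  have int_coeff: "coeff (\<Prod>l<i. [:- of_nat l, 1:] :: rat poly) k \<in> \<int>" for i k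
  proof (induction i arbitrary: k)
    case (Suc i)
    then show ?case by (auto simp: coeff_mult coeff_pCons intro!: Ints_sum Ints_mult split: nat.split)
  qed (simp add: coeff_1)
  have deg: "degree (\<Prod>l<i. [:- of_nat l, 1:] :: rat poly) \<le> i" for i
    by (rule order.trans[OF degree_prod_sum_le]) auto
  have "pdiv p (k + 0) (coeff R k)" for k
    unfolding R_def coeff_sum coeff_smult
  proof (rule pdiv_sum[OF p])
    fix i
    obtain z where z: "coeff (\<Prod>l<i. [:- of_nat l, 1:] :: rat poly) k = of_int z"
      using int_coeff[of i k] by (auto elim: Ints_cases)
    show "pdiv p (k + 0) (d i / fact i * coeff (\<Prod>l<i. [:- of_nat l, 1:]) k)"
    proof (cases "k \<le> i")
      case True
      then have "pdiv p k (d i / fact i)" by (rule pdiv_mono[OF pdiv_div_fact[OF p d]])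
      then show ?thesis using pdiv_mult_int[OF p, of k _ z] by (metis add.right_neutral mult.commute z)
    next
      case False
      then have "coeff (\<Prod>l<i. [:- of_nat l, 1:] :: rat poly) k = 0"
        using deg[of i] by (intro coeff_eq_0) linarith
      then show ?thesis by (simp add: pdiv_0[OF p])
    qed
  qed
  moreover have "poly R (of_int t) = 0" if t: "t \<in> int ` A" for t
  proof -
    obtain k where "k \<in> A" "t = int k" using t by blast
    moreover have "k \<le> N" "u k = 0" using calculation A M unfolding N_def by auto
    ultimately show ?thesis using val[of k] by simp
  qed
  ultimately have "pdiv p (0 + card (int ` A)) (poly R (of_int (int n)))"
    using A(1) by (intro pdiv_roots[OF p]) auto
  then show "pdiv p m (u n)" using A(2) val[of n] N_def by (simp add: card_image)
qed

section \<open>The Hilbert basis theorem relative to an ideal\<close>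

text \<open>All rings of the proof are subrings of one ambient commutative ring, and ideals are ideals
  of such a subring.\<close>

definition subring_set :: "'a::comm_ring_1 set \<Rightarrow> bool" where
  "subring_set R \<longleftrightarrow> 1 \<in> R \<and> (\<forall>x\<in>R. \<forall>y\<in>R. x - y \<in> R \<and> x * y \<in> R)"

definition ideal_in :: "'a::comm_ring_1 set \<Rightarrow> 'a set \<Rightarrow> bool" where
  "ideal_in R J \<longleftrightarrow> J \<subseteq> R \<and> 0 \<in> J \<and> (\<forall>x\<in>J. \<forall>y\<in>J. x + y \<in> J) \<and> (\<forall>r\<in>R. \<forall>x\<in>J. r * x \<in> J)"

lemma subring_set_closed:
  assumes "subring_set R"
  shows subring_1: "1 \<in> R" and subring_0: "0 \<in> R"
    and subring_diff: "x \<in> R \<Longrightarrow> y \<in> R \<Longrightarrow> x - y \<in> R"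
    and subring_mult: "x \<in> R \<Longrightarrow> y \<in> R \<Longrightarrow> x * y \<in> R"
    and subring_uminus: "x \<in> R \<Longrightarrow> - x \<in> R"
    and subring_add: "x \<in> R \<Longrightarrow> y \<in> R \<Longrightarrow> x + y \<in> R"
proof -
  show *: "1 \<in> R" "x \<in> R \<Longrightarrow> y \<in> R \<Longrightarrow> x - y \<in> R" "x \<in> R \<Longrightarrow> y \<in> R \<Longrightarrow> x * y \<in> R" for x y
    using assms unfolding subring_set_def by auto
  show "0 \<in> R" using *(2)[OF *(1) *(1)] by simp
  then show u: "x \<in> R \<Longrightarrow> - x \<in> R" for x using *(2)[of 0 x] by simp
  show "x \<in> R \<Longrightarrow> y \<in> R \<Longrightarrow> x + y \<in> R" using *(2)[of x "- y"] u[of y] by simp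
qed

lemma subring_sum:
  assumes "subring_set R" "\<And>i. i \<in> A \<Longrightarrow> f i \<in> R" shows "sum f A \<in> R"
  using assms(2) by (induction A rule: infinite_finite_induct) (auto simp: assms(1) subring_set_closed)

lemma subring_power: "subring_set R \<Longrightarrow> x \<in> R \<Longrightarrow> x ^ n \<in> R"
  by (induction n) (auto simp: subring_set_closed)

lemma subring_of_nat: "subring_set R \<Longrightarrow> of_nat n \<in> R"
  by (induction n) (auto simp: subring_set_closed)

lemma subring_of_int: "subring_set R \<Longrightarrow> of_int z \<in> R"
  by (cases z) (auto simp: subring_of_nat subring_set_closed)

lemma ideal_in_closed:
  assumes "ideal_in R J"
  shows ideal_sub: "x \<in> J \<Longrightarrow> x \<in> R" and ideal_0: "0 \<in> J"
    and ideal_add: "x \<in> J \<Longrightarrow> y \<in> J \<Longrightarrow> x + y \<in> J"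
    and ideal_mult: "r \<in> R \<Longrightarrow> x \<in> J \<Longrightarrow> r * x \<in> J"
    and ideal_mult2: "r \<in> R \<Longrightarrow> x \<in> J \<Longrightarrow> x * r \<in> J"
  using assms unfolding ideal_in_def by (auto simp: mult.commute)

lemma ideal_uminus: "subring_set R \<Longrightarrow> ideal_in R J \<Longrightarrow> x \<in> J \<Longrightarrow> - x \<in> J"
  using ideal_mult[of R J "- 1" x] by (simp add: subring_set_closed)

lemma ideal_diff: "subring_set R \<Longrightarrow> ideal_in R J \<Longrightarrow> x \<in> J \<Longrightarrow> y \<in> J \<Longrightarrow> x - y \<in> J"
  using ideal_add[of R J x "- y"] by (simp add: ideal_uminus)

lemma ideal_cong:
  "subring_set R \<Longrightarrow> ideal_in R J \<Longrightarrow> x - y \<in> J \<Longrightarrow> x \<in> J \<longleftrightarrow> y \<in> J"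
  using ideal_diff[of R J x "x - y"] ideal_add[of R J "x - y" y] by auto

lemma ideal_sum:
  assumes "ideal_in R J" "\<And>i. i \<in> A \<Longrightarrow> f i \<in> J" shows "sum f A \<in> J"
  using assms(2) by (induction A rule: infinite_finite_induct) (auto simp: ideal_0[OF assms(1)] intro: ideal_add[OF assms(1)])

lemma subring_UNIV: "subring_set UNIV"
  by (simp add: subring_set_def)

lemma ideal_in_subring: "ideal_in UNIV N \<Longrightarrow> N \<subseteq> R \<Longrightarrow> ideal_in R N"
  by (auto simp: ideal_in_def)

text \<open>For a finite set \<open>S\<close> this is \<open>N\<close> plus the \<open>R\<close>-span of
  \<open>S\<close>; in an infinite \<open>S\<close> the sum is zero, so that only
  \<open>N\<close> remains.\<close>

definition lincomb :: "'a::comm_ring_1 set \<Rightarrow> 'a set \<Rightarrow> 'a set \<Rightarrow> 'a set" where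
  "lincomb R N S = {x. \<exists>r. (\<forall>s\<in>S. r s \<in> R) \<and> x - (\<Sum>s\<in>S. r s * s) \<in> N}"

lemma lincombI: "\<forall>s\<in>S. r s \<in> R \<Longrightarrow> x - (\<Sum>s\<in>S. r s * s) \<in> N \<Longrightarrow> x \<in> lincomb R N S"
  unfolding lincomb_def by blast

lemma lincomb_add:
  assumes "subring_set R" "ideal_in B N" "x \<in> lincomb R N S" "y \<in> lincomb R N S"
  shows "x + y \<in> lincomb R N S"
proof -
  obtain r r' where *: "\<forall>s\<in>S. r s \<in> R" "x - (\<Sum>s\<in>S. r s * s) \<in> N"
    "\<forall>s\<in>S. r' s \<in> R" "y - (\<Sum>s\<in>S. r' s * s) \<in> N"
    using assms(3,4) unfolding lincomb_def by auto
  show ?thesis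
  proof (rule lincombI)
    show "\<forall>s\<in>S. r s + r' s \<in> R" using * assms(1) by (auto simp: subring_add)
    show "x + y - (\<Sum>s\<in>S. (r s + r' s) * s) \<in> N"
    proof -
      have "x - (\<Sum>s\<in>S. r s * s) + (y - (\<Sum>s\<in>S. r' s * s)) \<in> N" by (rule ideal_add[OF assms(2) *(2,4)])
      then show ?thesis by (simp add: sum.distrib distrib_right add_diff_add)
    qed
  qed
qed

lemma lincomb_mult:
  assumes "subring_set R" "ideal_in B N" "R \<subseteq> B" "x \<in> lincomb R N S" "a \<in> R"
  shows "a * x \<in> lincomb R N S"
proof -
  obtain r where *: "\<forall>s\<in>S. r s \<in> R" "x - (\<Sum>s\<in>S. r s * s) \<in> N"
    using assms(4) unfolding lincomb_def by auto
  show ?thesis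
  proof (rule lincombI)
    show "\<forall>s\<in>S. a * r s \<in> R" using * assms by (auto simp: subring_mult)
    show "a * x - (\<Sum>s\<in>S. (a * r s) * s) \<in> N"
    proof -
      have "a * (x - (\<Sum>s\<in>S. r s * s)) \<in> N" using ideal_mult[OF assms(2) _ *(2)] assms by blast
      then show ?thesis by (simp add: sum_distrib_left right_diff_distrib mult.assoc)
    qed
  qed
qed

lemma lincomb_base:
  assumes "subring_set R" "x \<in> N" shows "x \<in> lincomb R N S"
  by (rule lincombI[where r = "\<lambda>_. 0"]) (use assms in \<open>auto simp: subring_0\<close>)

lemma lincomb_gen:
  assumes "subring_set R" "ideal_in B N" "finite S" "x \<in> S" shows "x \<in> lincomb R N S"
proof (rule lincombI[where r = "\<lambda>s. if s = x then 1 else 0"])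
  have "(\<Sum>s\<in>S. (if s = x then 1 else 0) * s) = x"
    using assms(3,4) by (simp add: if_distrib[of "\<lambda>z. z * _"] cong: if_cong)
  then show "x - (\<Sum>s\<in>S. (if s = x then 1 else 0) * s) \<in> N"
    using ideal_0[OF assms(2)] by simp
qed (use assms in \<open>auto simp: subring_set_closed\<close>)

lemma lincomb_subset:
  assumes "subring_set R" "ideal_in R J" "N \<subseteq> J" "S \<subseteq> J" shows "lincomb R N S \<subseteq> J"
proof
  fix x assume "x \<in> lincomb R N S"
  then obtain r where *: "\<forall>s\<in>S. r s \<in> R" "x - (\<Sum>s\<in>S. r s * s) \<in> N"
    unfolding lincomb_def by auto
  have "(\<Sum>s\<in>S. r s * s) \<in> J"
    using * assms by (intro ideal_sum[OF assms(2)]) (auto intro: ideal_mult)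
  then show "x \<in> J" using ideal_cong[OF assms(1,2)] * assms(3) by blast
qed

lemma ideal_lincomb:
  assumes "subring_set R" "ideal_in R N" "S \<subseteq> R" shows "ideal_in R (lincomb R N S)"
proof -
  have "lincomb R N S \<subseteq> R"
    using assms by (intro lincomb_subset) (auto simp: ideal_in_def subring_set_closed)
  then show ?thesis
    unfolding ideal_in_def[of R "lincomb R N S"]
    by (intro conjI ballI lincomb_add[OF assms(1,2)] lincomb_mult[OF assms(1,2) order_refl]
      lincomb_base[OF assms(1) ideal_0[OF assms(2)]])
qed

text \<open>The quotient of \<open>R\<close> by \<open>N\<close> is noetherian, expressed by means of
  the ideals of \<open>R\<close> that contain \<open>N\<close>.\<close>

definition noeth :: "'a::comm_ring_1 set \<Rightarrow> 'a set \<Rightarrow> bool" where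
  "noeth R N \<longleftrightarrow> (\<forall>J. ideal_in R J \<longrightarrow> N \<subseteq> J \<longrightarrow> (\<exists>S. finite S \<and> S \<subseteq> J \<and> J \<subseteq> lincomb R N S))"

lemma noethE:
  assumes "noeth R N" "ideal_in R J" "N \<subseteq> J"
  obtains S where "finite S" "S \<subseteq> J" "J \<subseteq> lincomb R N S"
proof -
  have "\<exists>S. finite S \<and> S \<subseteq> J \<and> J \<subseteq> lincomb R N S"
    using assms(1)[unfolded noeth_def] assms(2,3) by (elim allE impE)
  then show ?thesis using that by (elim exE conjE)
qed

lemma noeth_field:
  assumes R: "subring_set R" and N: "ideal_in R N"
    and inv: "\<And>x. x \<in> R - N \<Longrightarrow> \<exists>y\<in>R. x * y - 1 \<in> N"
  shows "noeth R N"
  unfolding noeth_def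
proof (intro allI impI)
  fix J assume J: "ideal_in R J" "N \<subseteq> J"
  show "\<exists>S. finite S \<and> S \<subseteq> J \<and> J \<subseteq> lincomb R N S"
  proof (cases "J \<subseteq> N")
    case True
    then have "J \<subseteq> lincomb R N {}" using lincomb_base[OF R, of _ N "{}"] by blast
    then show ?thesis by (intro exI[of _ "{}"]) simp
  next
    case False
    then obtain x where x: "x \<in> J" "x \<notin> N" by blast
    then have "x \<in> R - N" using ideal_sub[OF J(1)] by simp
    with inv obtain y where "y \<in> R" "x * y - 1 \<in> N" by blast
    with x have xy: "x \<in> J" "y \<in> R" "x * y - 1 \<in> N" by auto
    have "J \<subseteq> lincomb R N {x}"
    proof
      fix z assume "z \<in> J"
      then have z: "z \<in> R" using ideal_sub[OF J(1)] by blast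
      show "z \<in> lincomb R N {x}"
      proof (rule lincombI)
        show "\<forall>s\<in>{x}. z * y \<in> R" using z xy R by (simp add: subring_mult)
        have "(- z) * (x * y - 1) \<in> N" by (rule ideal_mult[OF N subring_uminus[OF R z] xy(3)])
        then show "z - (\<Sum>s\<in>{x}. z * y * s) \<in> N" by (simp add: algebra_simps)
      qed
    qed
    then show ?thesis using xy by (intro exI[of _ "{x}"]) auto
  qed
qed

lemma ideal_int_principal:
  fixes I :: "int set"
  assumes "\<And>x y. x \<in> I \<Longrightarrow> y \<in> I \<Longrightarrow> x - y \<in> I" "\<And>r x. x \<in> I \<Longrightarrow> r * x \<in> I" "0 \<in> I"
  shows "\<exists>d\<in>I. \<forall>x\<in>I. d dvd x"
proof (cases "I \<subseteq> {0}")
  case True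
  then show ?thesis using assms(3) by (intro bexI[of _ 0]) auto
next
  case False
  then obtain x where "x \<in> I" "x \<noteq> 0" by auto
  then have "\<bar>x\<bar> \<in> I \<and> \<bar>x\<bar> > 0" using assms(2)[of x "-1"] by (auto simp: abs_if)
  then have ex: "\<exists>n::nat. n > 0 \<and> int n \<in> I" by (intro exI[of _ "nat \<bar>x\<bar>"]) auto
  define d where "d = (LEAST n::nat. n > 0 \<and> int n \<in> I)"
  have d: "d > 0" "int d \<in> I" using LeastI_ex[OF ex] unfolding d_def by auto
  have "int d dvd y" if "y \<in> I" for y
  proof (rule ccontr)
    assume "\<not> int d dvd y"
    then have nz: "y mod int d \<noteq> 0" using dvd_eq_mod_eq_0 by blast
    have "y - (y div int d) * int d \<in> I" by (rule assms(1)[OF that assms(2)[OF d(2)]])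
    then have "y mod int d \<in> I" by (simp add: minus_div_mult_eq_mod)
    moreover have "y mod int d > 0" "y mod int d < int d"
      using d(1) nz pos_mod_sign[of "int d" y] pos_mod_bound[of "int d" y] by linarith+
    ultimately have "nat (y mod int d) > 0 \<and> int (nat (y mod int d)) \<in> I" by simp
    then have "d \<le> nat (y mod int d)" unfolding d_def by (rule Least_le)
    then show False using \<open>y mod int d < int d\<close> \<open>y mod int d > 0\<close> by linarith
  qed
  then show ?thesis using d by blast
qed

text \<open>The preimage of the prime ring of the quotient by \<open>N\<close>.\<close>

definition int_ring :: "'a::comm_ring_1 set \<Rightarrow> 'a set" where
  "int_ring N = {x. \<exists>z. x - of_int z \<in> N}"

lemma subring_int_ring:
  assumes N: "ideal_in UNIV N" shows "subring_set (int_ring N)"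
proof -
  note NN = ideal_0[OF N] ideal_diff[OF subring_UNIV N] ideal_add[OF N] ideal_mult[OF N UNIV_I]
  have "x - y \<in> int_ring N \<and> x * y \<in> int_ring N" if xy: "x \<in> int_ring N" "y \<in> int_ring N" for x y
  proof -
    obtain a b where ab: "x - of_int a \<in> N" "y - of_int b \<in> N" using xy by (auto simp: int_ring_def)
    have "(x - y) - of_int (a - b) \<in> N" using NN(2)[OF ab] by (simp add: algebra_simps)
    moreover have "x * y - of_int (a * b) \<in> N"
      using NN(3)[OF NN(4)[of _ y, OF ab(1)] NN(4)[of _ "of_int a", OF ab(2)]] by (simp add: algebra_simps)
    ultimately show ?thesis unfolding int_ring_def mem_Collect_eq by (intro conjI exI)
  qed
  moreover have "1 - of_int 1 \<in> N" using NN(1) by simp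
  then have "1 \<in> int_ring N" unfolding int_ring_def mem_Collect_eq by (rule exI)
  ultimately show ?thesis unfolding subring_set_def by simp
qed

lemma int_ring_sub:
  assumes "ideal_in UNIV N" shows "N \<subseteq> int_ring N"
  unfolding int_ring_def by (auto intro!: exI[of _ 0])

lemma noeth_int_ring:
  assumes N: "ideal_in UNIV N" shows "noeth (int_ring N) N"
  unfolding noeth_def
proof (intro allI impI)
  let ?R = "int_ring N"
  note R = subring_int_ring[OF N]
  fix J assume J: "ideal_in ?R J" "N \<subseteq> J"
  have "\<exists>d\<in>{z. of_int z \<in> J}. \<forall>x\<in>{z. of_int z \<in> J}. d dvd x"
    by (rule ideal_int_principal)
      (simp_all add: ideal_diff[OF R J(1)] ideal_0[OF J(1)] ideal_mult[OF J(1)] subring_of_int[OF R])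
  then obtain d where d: "of_int d \<in> J" "\<And>z. of_int z \<in> J \<Longrightarrow> d dvd z" by blast
  have "J \<subseteq> lincomb ?R N {of_int d}"
  proof
    fix x assume x: "x \<in> J"
    then obtain z where z: "x - of_int z \<in> N" using ideal_sub[OF J(1)] by (auto simp: int_ring_def)
    then have "of_int z \<in> J" using x J ideal_cong[OF R J(1)] by blast
    then obtain w where w: "z = d * w" using d by blast
    show "x \<in> lincomb ?R N {of_int d}"
      by (rule lincombI[where r = "\<lambda>_. of_int w"]) (use z w R in \<open>auto simp: subring_of_int mult.commute\<close>)
  qed
  then show "\<exists>S. finite S \<and> S \<subseteq> J \<and> J \<subseteq> lincomb ?R N S" using d by (intro exI[of _ "{of_int d}"]) auto
qed

definition polys :: "'a::comm_ring_1 set \<Rightarrow> 'a poly set" where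
  "polys R = {P. \<forall>i. coeff P i \<in> R}"

definition adjoin :: "'a::comm_ring_1 set \<Rightarrow> 'a \<Rightarrow> 'a set" where
  "adjoin R x = (\<lambda>P. poly P x) ` polys R"

lemma polys_closed:
  assumes "subring_set R"
  shows polys_1: "1 \<in> polys R" and polys_diff: "P \<in> polys R \<Longrightarrow> Q \<in> polys R \<Longrightarrow> P - Q \<in> polys R"
    and polys_mult: "P \<in> polys R \<Longrightarrow> Q \<in> polys R \<Longrightarrow> P * Q \<in> polys R"
    and polys_monom: "r \<in> R \<Longrightarrow> monom r n \<in> polys R"
    and polys_pCons: "r \<in> R \<Longrightarrow> P \<in> polys R \<Longrightarrow> pCons r P \<in> polys R"
    and polys_0: "0 \<in> polys R"
  using assms by (auto simp: polys_def coeff_1 coeff_mult coeff_pCons subring_set_closed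
    intro!: subring_sum split: nat.split)

lemma subring_polys: "subring_set R \<Longrightarrow> subring_set (polys R)"
  by (simp add: subring_set_def[of "polys R"] polys_closed)

lemma subring_adjoin:
  assumes "subring_set R" shows "subring_set (adjoin R x)"
  unfolding subring_set_def
proof (intro conjI ballI)
  show "1 \<in> adjoin R x"
    unfolding adjoin_def using polys_1[OF assms] by (intro image_eqI[of _ _ 1]) auto
next
  fix a b assume "a \<in> adjoin R x" "b \<in> adjoin R x"
  then obtain P Q where *: "P \<in> polys R" "Q \<in> polys R" "a = poly P x" "b = poly Q x"
    unfolding adjoin_def by blast
  show "a - b \<in> adjoin R x" unfolding adjoin_def using * polys_diff[OF assms]
    by (intro image_eqI[of _ _ "P - Q"]) auto
  show "a * b \<in> adjoin R x" unfolding adjoin_def using * polys_mult[OF assms]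
    by (intro image_eqI[of _ _ "P * Q"]) auto
qed

lemma adjoin_base: "subring_set R \<Longrightarrow> r \<in> R \<Longrightarrow> r \<in> adjoin R x"
  unfolding adjoin_def by (rule image_eqI[of _ _ "[:r:]"]) (auto intro: polys_closed)

lemma adjoin_gen: "subring_set R \<Longrightarrow> x \<in> adjoin R x"
  unfolding adjoin_def by (rule image_eqI[of _ _ "[:0, 1:]"]) (auto intro!: polys_closed simp: subring_set_closed)

lemma adjoin_subset:
  assumes "subring_set B" "R \<subseteq> B" "x \<in> B" shows "adjoin R x \<subseteq> B"
  unfolding adjoin_def using assms
  by (auto simp: poly_altdef polys_def intro!: subring_sum subring_mult subring_power)

lemma finite_subset_of_chain:
  fixes L :: "nat \<Rightarrow> 'a set"
  assumes "finite S" "S \<subseteq> (\<Union>n. L n)" and mono: "\<And>n m. n \<le> m \<Longrightarrow> L n \<subseteq> L m"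
  shows "\<exists>m. S \<subseteq> L m"
  using assms(1,2)
proof (induction S rule: finite_induct)
  case (insert s S)
  then obtain m n where "S \<subseteq> L m" "s \<in> L n" by auto
  then have "insert s S \<subseteq> L (max m n)" using mono[of m "max m n"] mono[of n "max m n"] by auto
  then show ?case by blast
qed auto

lemma ideal_chain_Union:
  fixes L :: "nat \<Rightarrow> 'a::comm_ring_1 set"
  assumes L: "\<And>n. ideal_in R (L n)" and mono: "\<And>n m. n \<le> m \<Longrightarrow> L n \<subseteq> L m"
  shows "ideal_in R (\<Union>n. L n)"
  unfolding ideal_in_def
proof (intro conjI ballI)
  fix a b assume "a \<in> (\<Union>n. L n)" "b \<in> (\<Union>n. L n)"
  then obtain n m where "a \<in> L n" "b \<in> L m" by blast
  then have "a \<in> L (max n m)" "b \<in> L (max n m)" using mono[of n "max n m"] mono[of m "max n m"] by auto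
  then show "a + b \<in> (\<Union>n. L n)" using ideal_add[OF L] by blast
next
  fix r a assume "r \<in> R" "a \<in> (\<Union>n. L n)"
  then show "r * a \<in> (\<Union>n. L n)" using ideal_mult[OF L] by blast
qed (use ideal_sub[OF L] ideal_0[OF L] in blast)+

text \<open>Hilbert's basis theorem modulo \<open>N\<close>. Since \<open>x\<close> may satisfy
  relations, the argument uses polynomials over \<open>R\<close> whose value at
  \<open>x\<close> lies in \<open>J\<close>. Their leading coefficients in degree
  \<open>n\<close> form ideals \<open>L n\<close> of \<open>R\<close> that increase with
  \<open>n\<close>; the union is generated within one \<open>L D\<close>. Polynomials
  realising generators of \<open>L 0, \<dots>, L D\<close> allow one to lower the degree of
  any other polynomial.\<close>

theorem noeth_adjoin:
  assumes R: "subring_set R" and N: "ideal_in UNIV N" "N \<subseteq> R" and noeth: "noeth R N"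
  shows "noeth (adjoin R x) N"
  unfolding noeth_def
proof (intro allI impI)
  let ?A = "adjoin R x"
  note A = subring_adjoin[OF R, of x]
  have NR: "ideal_in R N" and NA: "ideal_in ?A N"
    using N adjoin_base[OF R] by (auto intro: ideal_in_subring)
  fix J assume J: "ideal_in ?A J" "N \<subseteq> J"
  define L where "L n = {coeff P n | P. P \<in> polys R \<and> poly P x \<in> J \<and> (\<forall>i>n. coeff P i = 0)}" for n
  have L_ideal: "ideal_in R (L n)" for n
    unfolding ideal_in_def
  proof (intro conjI ballI subsetI)
    show "0 \<in> L n" unfolding L_def using polys_0[OF R] ideal_0[OF J(1)] by force
  next
    fix a b assume "a \<in> L n" "b \<in> L n"
    then obtain P Q where "P \<in> polys R" "poly P x \<in> J" "\<forall>i>n. coeff P i = 0" "a = coeff P n"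
      "Q \<in> polys R" "poly Q x \<in> J" "\<forall>i>n. coeff Q i = 0" "b = coeff Q n"
      unfolding L_def by blast
    then show "a + b \<in> L n" unfolding L_def
      using subring_add[OF subring_polys[OF R]] ideal_add[OF J(1)]
      by (intro CollectI exI[of _ "P + Q"]) auto
  next
    fix r a assume r: "r \<in> R" "a \<in> L n"
    then obtain P where "P \<in> polys R" "poly P x \<in> J" "\<forall>i>n. coeff P i = 0" "a = coeff P n"
      unfolding L_def by blast
    then show "r * a \<in> L n" unfolding L_def
      using polys_mult[OF R, of "[:r:]" P] polys_pCons[OF R r(1) polys_0[OF R]] ideal_mult[OF J(1) adjoin_base[OF R r(1)]]
      by (intro CollectI exI[of _ "[:r:] * P"]) auto
  qed (auto simp: L_def polys_def)
  have L_mono: "L n \<subseteq> L (n + k)" for n k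
  proof
    fix a assume "a \<in> L n"
    then obtain P where P: "P \<in> polys R" "poly P x \<in> J" "\<forall>i>n. coeff P i = 0" "a = coeff P n"
      unfolding L_def by blast
    then show "a \<in> L (n + k)" unfolding L_def
      using polys_mult[OF R polys_monom[OF R subring_1[OF R], of k] P(1)]
        ideal_mult[OF J(1) subring_power[OF A adjoin_gen[OF R]], of "poly P x" k]
      by (intro CollectI exI[of _ "monom 1 k * P"]) (auto simp: coeff_monom_mult poly_monom)
  qed
  have NL: "N \<subseteq> L n" for n
  proof
    fix r assume "r \<in> N"
    then show "r \<in> L n" unfolding L_def using N J ideal_mult2[OF N(1)]
      by (intro CollectI exI[of _ "monom r n"]) (auto intro!: polys_monom[OF R] simp: poly_monom)
  qed
  have Lm: "L n \<subseteq> L m" if "n \<le> m" for n m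
    using L_mono[of n "m - n"] that by simp
  have "ideal_in R (\<Union>n. L n)" by (rule ideal_chain_Union[OF L_ideal Lm])
  moreover have "N \<subseteq> (\<Union>n. L n)" using NL by blast
  ultimately obtain S where S: "finite S" "S \<subseteq> (\<Union>n. L n)" "(\<Union>n. L n) \<subseteq> lincomb R N S"
    using noethE[OF noeth] by metis
  obtain D where D: "S \<subseteq> L D"
    using finite_subset_of_chain[OF S(1,2) Lm] by blast
  have "\<exists>T. finite T \<and> T \<subseteq> L n \<and> L n \<subseteq> lincomb R N T" for n
    using noethE[OF noeth L_ideal NL] by metis
  then obtain T where T: "\<And>n. finite (T n)" "\<And>n. T n \<subseteq> L n" "\<And>n. L n \<subseteq> lincomb R N (T n)"
    by metis
  define U where "U n = (if n < D then T n else S)" for n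
  define m where "m n = min n D" for n
  have U: "finite (U n)" "U n \<subseteq> L (m n)" "L n \<subseteq> lincomb R N (U n)" for n
  proof -
    have "L n \<subseteq> lincomb R N S" using S(3) by blast
    then show "finite (U n)" "U n \<subseteq> L (m n)" "L n \<subseteq> lincomb R N (U n)"
      using T S(1) D unfolding U_def m_def by (simp_all add: min_def)
  qed
  define w where "w n s = (SOME P. P \<in> polys R \<and> poly P x \<in> J \<and>
    (\<forall>i>m n. coeff P i = 0) \<and> s = coeff P (m n))" for n s
  have w_all: "w n s \<in> polys R \<and> poly (w n s) x \<in> J \<and>
    (\<forall>i>m n. coeff (w n s) i = 0) \<and> s = coeff (w n s) (m n)" if "s \<in> U n" for n s
    unfolding w_def by (rule someI_ex) (use U(2)[of n] that in \<open>auto simp: L_def\<close>)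
  then have w: "\<And>n s. s \<in> U n \<Longrightarrow> w n s \<in> polys R" "\<And>n s. s \<in> U n \<Longrightarrow> poly (w n s) x \<in> J"
    "\<And>n s i. s \<in> U n \<Longrightarrow> i > m n \<Longrightarrow> coeff (w n s) i = 0" "\<And>n s. s \<in> U n \<Longrightarrow> s = coeff (w n s) (m n)"
    by simp_all
  define W where "W = (\<Union>n\<le>D. (\<lambda>s. poly (w n s) x) ` U n)"
  have "finite W" "W \<subseteq> J" unfolding W_def using U(1) w(2) by auto
  define w' where w': "w' = (\<lambda>n. w (m n))"
  have Um: "U (m n) = U n" "m (m n) = m n" "m n \<le> D" "m n \<le> n" for n unfolding U_def m_def by auto
  have w'W: "poly (w' n s) x \<in> W" if "s \<in> U n" for n s
    unfolding W_def w' using that Um[of n] by auto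
  have w'p: "w' n s \<in> polys R" "i > m n \<Longrightarrow> coeff (w' n s) i = 0" "s = coeff (w' n s) (m n)"
    if "s \<in> U n" for n s i
    unfolding w' using that w[of s "m n"] Um[of n] by auto
  have WA: "W \<subseteq> ?A" using \<open>W \<subseteq> J\<close> ideal_sub[OF J(1)] by blast
  have K: "ideal_in ?A (lincomb ?A N W)" by (rule ideal_lincomb[OF A NA WA])
  have *: "poly P x \<in> lincomb ?A N W" if "P \<in> polys R" "poly P x \<in> J" "\<forall>i\<ge>n. coeff P i = 0" for n P
    using that
  proof (induction n arbitrary: P)
    case 0
    then have "P = 0" by (simp add: poly_eq_iff)
    then show ?case using ideal_0[OF K] by simp
  next
    case (Suc n)
    have "coeff P n \<in> L n" unfolding L_def using Suc.prems by auto
    then have "coeff P n \<in> lincomb R N (U n)" using U by blast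
    then obtain r where r: "\<And>s. s \<in> U n \<Longrightarrow> r s \<in> R" "coeff P n - (\<Sum>s\<in>U n. r s * s) \<in> N"
      unfolding lincomb_def by blast
    define c where "c = coeff P n - (\<Sum>s\<in>U n. r s * s)"
    define Q where "Q = monom c n + (\<Sum>s\<in>U n. monom (r s) (n - m n) * w' n s)"
    have c: "c \<in> N" "c \<in> R" using r N unfolding c_def by auto
    note pR = subring_polys[OF R]
    have Q: "Q \<in> polys R" unfolding Q_def using c r w'p(1)
      by (intro subring_add[OF pR] subring_sum[OF pR] subring_mult[OF pR] polys_monom[OF R]) auto
    have Qv: "poly Q x = c * x ^ n + (\<Sum>s\<in>U n. r s * x ^ (n - m n) * poly (w' n s) x)"
      unfolding Q_def by (simp add: poly_sum poly_monom)
    have rA: "r s * x ^ (n - m n) \<in> ?A" if "s \<in> U n" for s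
      using r(1)[OF that] by (intro subring_mult[OF A] adjoin_base[OF R] subring_power[OF A] adjoin_gen[OF R])
    have cN: "c * x ^ n \<in> N" using ideal_mult2[OF N(1)] c by blast
    have QK: "poly Q x \<in> lincomb ?A N W" unfolding Qv
      by (rule ideal_add[OF K lincomb_base[OF A cN] ideal_sum[OF K ideal_mult[OF K rA
            lincomb_gen[OF A NA \<open>finite W\<close> w'W]]]])
    have QJ: "poly Q x \<in> J" unfolding Qv
      by (rule ideal_add[OF J(1) subsetD[OF J(2) cN] ideal_sum[OF J(1) ideal_mult[OF J(1) rA
            subsetD[OF \<open>W \<subseteq> J\<close> w'W]]]])
    have Qn: "coeff Q n = coeff P n"
    proof -
      have "coeff Q n = c + (\<Sum>s\<in>U n. r s * s)"
        unfolding Q_def coeff_add coeff_sum coeff_monom_mult using Um(4)[of n] w'p(3)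
        by (auto intro!: sum.cong arg_cong[where f = "\<lambda>z. c + z"])
      then show ?thesis by (simp add: c_def)
    qed
    have Qi: "coeff Q i = 0" if "i > n" for i
      unfolding Q_def coeff_add coeff_sum coeff_monom_mult using that w'p(2) Um(4)[of n]
      by (auto intro!: sum.neutral)
    have "poly (P - Q) x \<in> lincomb ?A N W"
    proof (rule Suc.IH)
      show "P - Q \<in> polys R" using Suc.prems Q polys_diff[OF R] by blast
      show "poly (P - Q) x \<in> J" using Suc.prems QJ ideal_diff[OF A J(1)] by simp
      show "\<forall>i\<ge>n. coeff (P - Q) i = 0"
        using Suc.prems(3) Qn Qi by (metis Suc_leI coeff_diff diff_self le_neq_implies_less)
    qed
    from ideal_add[OF K this QK] show ?case by simp
  qed
  then have "J \<subseteq> lincomb ?A N W"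
  proof -
    have "y \<in> lincomb ?A N W" if y: "y \<in> J" for y
    proof -
      obtain P where P: "P \<in> polys R" "y = poly P x"
        using ideal_sub[OF J(1) y] unfolding adjoin_def by blast
      have "\<forall>i\<ge>Suc (degree P). coeff P i = 0"
        by (auto intro: coeff_eq_0)
      then show ?thesis using * P y by blast
    qed
    then show ?thesis by blast
  qed
  then show "\<exists>S. finite S \<and> S \<subseteq> J \<and> J \<subseteq> lincomb ?A N S"
    using \<open>finite W\<close> \<open>W \<subseteq> J\<close> by blast
qed

definition adjoins :: "'a::comm_ring_1 set \<Rightarrow> 'a list \<Rightarrow> 'a set" where
  "adjoins R xs = foldl adjoin R xs"

lemma adjoins_simps [simp]:
  "adjoins R [] = R" "adjoins R (x # xs) = adjoins (adjoin R x) xs"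
  by (auto simp: adjoins_def)

lemma adjoins_props:
  assumes "subring_set R"
  shows "subring_set (adjoins R xs) \<and> R \<subseteq> adjoins R xs \<and> set xs \<subseteq> adjoins R xs"
  using assms
proof (induction xs arbitrary: R)
  case (Cons x xs)
  note IH = Cons.IH[OF subring_adjoin[OF Cons.prems], of x]
  show ?case using IH adjoin_base[OF Cons.prems, of _ x] adjoin_gen[OF Cons.prems, of x] by auto
qed simp

lemma subring_adjoins: "subring_set R \<Longrightarrow> subring_set (adjoins R xs)"
  and adjoins_base: "subring_set R \<Longrightarrow> R \<subseteq> adjoins R xs"
  and adjoins_gen: "subring_set R \<Longrightarrow> set xs \<subseteq> adjoins R xs"
  using adjoins_props by auto

lemma adjoins_subset:
  assumes "subring_set B" "R \<subseteq> B" "set xs \<subseteq> B" shows "adjoins R xs \<subseteq> B"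
  using assms(2,3)
proof (induction xs arbitrary: R)
  case (Cons x xs)
  then show ?case using Cons.IH[OF adjoin_subset[OF assms(1), of R x]] by simp
qed simp

lemma noeth_adjoins:
  assumes "subring_set R" "ideal_in UNIV N" "N \<subseteq> R" "noeth R N"
  shows "noeth (adjoins R xs) N"
  using assms(1,3,4)
proof (induction xs arbitrary: R)
  case (Cons x xs)
  show ?case using Cons.IH[OF subring_adjoin[OF Cons.prems(1)], of x] adjoin_base[OF Cons.prems(1), of _ x] Cons.prems
    noeth_adjoin[OF _ assms(2)] by auto
qed simp

text \<open>The union of the chain is finitely generated, and the generators appear at a finite stage.\<close>

lemma noeth_ACC:
  assumes noeth: "noeth R N" and R: "subring_set R"
    and J: "\<And>n::nat. ideal_in R (J n)" "\<And>n. N \<subseteq> J n" "\<And>n. J n \<subseteq> J (Suc n)"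
  shows "\<exists>m. \<forall>n\<ge>m. J n = J m"
proof -
  have mono: "J n \<subseteq> J m" if "n \<le> m" for n m
    using J(3) that by (rule lift_Suc_mono_le)
  have "ideal_in R (\<Union>n. J n)" by (rule ideal_chain_Union[OF J(1) mono])
  moreover have "N \<subseteq> (\<Union>n. J n)" using J(2) by blast
  ultimately obtain S where S: "finite S" "S \<subseteq> (\<Union>n. J n)" "(\<Union>n. J n) \<subseteq> lincomb R N S"
    using noethE[OF noeth] by metis
  obtain m where m: "S \<subseteq> J m"
    using finite_subset_of_chain[OF S(1,2) mono] by blast
  have "J n = J m" if "n \<ge> m" for n
    using mono[OF that] S(3) lincomb_subset[OF R J(1) J(2) m] by blast
  then show ?thesis by blast
qed

section \<open>Integral evaluations of a subring\<close>

text \<open>The quotient of \<open>R\<close> by \<open>I\<close> is a nonzero torsion-free ring in which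
  every element is nilpotent or a non-zero-divisor.\<close>

locale coprimary =
  fixes R I :: "'a::comm_ring_1 set"
  assumes R: "subring_set R" and I: "ideal_in R I" and proper: "1 \<notin> I"
    and torsion_free: "\<And>m x. of_nat m * x \<in> I \<Longrightarrow> m > 0 \<Longrightarrow> x \<in> R \<Longrightarrow> x \<in> I"
    and primary: "\<And>b. b \<in> R \<Longrightarrow> (\<exists>n. b ^ n \<in> I) \<or> (\<forall>x\<in>R. b * x \<in> I \<longrightarrow> x \<in> I)"
begin

text \<open>A ring homomorphism from the image of \<open>T\<close> in the quotient by \<open>I\<close>
  to the integers.\<close>

definition eval_hom :: "'a set \<Rightarrow> ('a \<Rightarrow> int) \<Rightarrow> bool" where
  "eval_hom T e \<longleftrightarrow> e 1 = 1 \<and> (\<forall>x\<in>T. \<forall>y\<in>T. e (x - y) = e x - e y \<and> e (x * y) = e x * e y) \<and>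
     (\<forall>x\<in>T \<inter> I. e x = 0)"

text \<open>The image of \<open>b\<close> in the quotient by \<open>I\<close> is algebraic over the
  image of \<open>T\<close>.\<close>

definition alg_over :: "'a set \<Rightarrow> 'a \<Rightarrow> bool" where
  "alg_over T b \<longleftrightarrow> (\<exists>P\<in>polys T. poly P b \<in> I \<and> (\<exists>i. coeff P i \<notin> I))"

text \<open>What matters here about a polynomial ring over the integers: it has an integral point, and
  near any integral point, in the sense of congruence modulo any \<open>p\<close>, there are
  enough integral points to detect a given nonzero element.\<close>

definition evaluable :: "'a set \<Rightarrow> bool" where
  "evaluable T \<longleftrightarrow> subring_set T \<and> T \<subseteq> R \<and> (\<exists>e. eval_hom T e) \<and>
     (\<forall>e0 p g. eval_hom T e0 \<longrightarrow> p > 0 \<longrightarrow> g \<in> T - I \<longrightarrow>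
        (\<exists>e. eval_hom T e \<and> (\<forall>x\<in>T. p dvd e x - e0 x) \<and> e g \<noteq> 0))"

lemma eval_hom_closed:
  assumes "eval_hom T e"
  shows eval_1: "e 1 = 1" and eval_diff: "x \<in> T \<Longrightarrow> y \<in> T \<Longrightarrow> e (x - y) = e x - e y"
    and eval_mult: "x \<in> T \<Longrightarrow> y \<in> T \<Longrightarrow> e (x * y) = e x * e y"
    and eval_I: "x \<in> T \<Longrightarrow> x \<in> I \<Longrightarrow> e x = 0"
  using assms unfolding eval_hom_def by auto

lemma eval_0: "subring_set T \<Longrightarrow> eval_hom T e \<Longrightarrow> e 0 = 0"
  using eval_I[of T e 0] ideal_0[OF I] by (simp add: subring_0)

lemma eval_add:
  assumes "subring_set T" "eval_hom T e" "x \<in> T" "y \<in> T" shows "e (x + y) = e x + e y"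
proof -
  have "e (x - (0 - y)) = e x - (e 0 - e y)"
    using assms by (subst eval_diff[OF assms(2)] eval_diff[OF assms(2), symmetric]; simp add: subring_set_closed)+
  then show ?thesis using eval_0[OF assms(1,2)] by simp
qed

lemma eval_sum:
  assumes "subring_set T" "eval_hom T e" "\<And>i. i \<in> A \<Longrightarrow> f i \<in> T"
  shows "e (sum f A) = (\<Sum>i\<in>A. e (f i))"
  using assms(3)
proof (induction A rule: infinite_finite_induct)
  case (insert x F)
  have "e (f x + sum f F) = e (f x) + e (sum f F)"
    using insert.prems by (intro eval_add[OF assms(1,2)] subring_sum[OF assms(1)]) auto
  then show ?case using insert by simp
qed (simp_all add: eval_0[OF assms(1,2)])

lemma eval_power:
  assumes "subring_set T" "eval_hom T e" "x \<in> T" shows "e (x ^ n) = e x ^ n"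
  by (induction n) (simp_all add: eval_1[OF assms(2)] eval_mult[OF assms(2,3)] subring_power[OF assms(1,3)])

lemma of_int_in_I: "of_int z \<in> I \<Longrightarrow> z = 0"
proof (rule ccontr)
  assume z: "of_int z \<in> I" "z \<noteq> 0"
  have "of_int \<bar>z\<bar> \<in> I" using z(1) ideal_uminus[OF R I] by (auto simp: abs_if)
  then have "of_nat (nat \<bar>z\<bar>) * 1 \<in> I" by (simp add: of_nat_nat)
  then show False using torsion_free[of "nat \<bar>z\<bar>" 1] z(2) proper subring_1[OF R] by simp
qed

lemma evaluable_separates:
  assumes "evaluable T" "eval_hom T e0" "p > 0" "g \<in> T - I"
  shows "\<exists>e. eval_hom T e \<and> (\<forall>x\<in>T. p dvd e x - e0 x) \<and> e g \<noteq> 0"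
  using assms(1)[unfolded evaluable_def, THEN conjunct2, THEN conjunct2, THEN conjunct2, rule_format, OF assms(2-4)] .

text \<open>The integers have exactly one evaluation, and torsion-freeness makes it well defined.\<close>

lemma evaluable_int: "evaluable (range of_int)"
proof -
  have sub: "subring_set (range of_int :: 'a set)"
    unfolding subring_set_def
  proof (intro conjI ballI)
    show "1 \<in> range (of_int :: int \<Rightarrow> 'a)" by (rule image_eqI[of _ _ 1]) auto
  qed (auto simp flip: of_int_diff of_int_mult)
  have inj: "of_int z = (of_int w :: 'a) \<Longrightarrow> z = w" for z w
    using of_int_in_I[of "z - w"] ideal_0[OF I] by simp
  define e :: "'a \<Rightarrow> int" where "e x = (THE z. x = of_int z)" for x
  have e: "e (of_int z) = z" for z unfolding e_def by (rule the_equality) (auto dest: inj)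
  have e1: "e 1 = 1" using e[of 1] by simp
  have hom: "eval_hom (range of_int) e"
    unfolding eval_hom_def using e1 of_int_in_I by (auto simp: e simp flip: of_int_diff of_int_mult)
  have uniq: "e0 (of_int z) = z" if "eval_hom (range of_int) e0" for e0 z
  proof -
    have n: "e0 (of_nat n) = int n" for n
    proof (induction n)
      case (Suc n)
      have "e0 (of_int 1 + of_int (int n)) = e0 (of_int 1) + e0 (of_int (int n))"
        by (rule eval_add[OF sub that]) (rule rangeI)+
      then show ?case using Suc eval_1[OF that] by simp
    qed (simp add: eval_0[OF sub that])
    have "e0 (of_int (int a) - of_int (int b)) = e0 (of_int (int a)) - e0 (of_int (int b))" for a b
      by (rule eval_diff[OF that]) (rule rangeI)+
    then have "e0 (of_int (int a - int b)) = int a - int b" for a b using n by simp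
    then show ?thesis by (metis int_diff_cases)
  qed
  show ?thesis unfolding evaluable_def
  proof (intro conjI allI impI)
    fix e0 :: "'a \<Rightarrow> int" and p :: int and g :: 'a
    assume e0: "eval_hom (range of_int) e0" and "p > 0" and g: "g \<in> range of_int - I"
    then obtain z where z: "g = of_int z" by blast
    then have "z \<noteq> 0" using g ideal_0[OF I] by auto
    then have "e0 g \<noteq> 0" using uniq[OF e0] z by simp
    then show "\<exists>e. eval_hom (range of_int) e \<and> (\<forall>x\<in>range of_int. p dvd e x - e0 x) \<and> e g \<noteq> 0"
      using e0 by (intro exI[of _ e0]) simp
  qed (use sub hom R in \<open>auto intro: subring_of_int\<close>)
qed

lemma poly_in_I:
  assumes "T \<subseteq> R" "b \<in> R" "P \<in> polys T" "\<And>i. coeff P i \<in> I"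
  shows "poly P b \<in> I"
  unfolding poly_altdef using assms
  by (intro ideal_sum[OF I] ideal_mult2[OF I] subring_power[OF R]) auto

lemma polys_pCons_iff: "pCons a P \<in> polys T \<longleftrightarrow> a \<in> T \<and> P \<in> polys T"
  unfolding polys_def mem_Collect_eq by (metis coeff_pCons_0 coeff_pCons_Suc not0_implies_Suc)

lemma eval_poly:
  assumes S: "subring_set S" "T \<subseteq> S" "b \<in> S" and e: "eval_hom S e" and P: "P \<in> polys T"
  shows "e (poly P b) = poly (map_poly e P) (e b)"
proof -
  have "P \<in> polys T \<longrightarrow> poly P b \<in> S \<and> e (poly P b) = poly (map_poly e P) (e b)"
  proof (induction P)
    case 0
    then show ?case using eval_0[OF S(1) e] subring_0[OF S(1)] by simp
  next
    case (pCons a P)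
    show ?case
    proof
      assume "pCons a P \<in> polys T"
      then have a: "a \<in> S" and IH: "poly P b \<in> S" "e (poly P b) = poly (map_poly e P) (e b)"
        using pCons.IH S(2) unfolding polys_pCons_iff by auto
      have m: "b * poly P b \<in> S" by (rule subring_mult[OF S(1,3) IH(1)])
      show "poly (pCons a P) b \<in> S \<and> e (poly (pCons a P) b) = poly (map_poly e (pCons a P)) (e b)"
        using subring_add[OF S(1) a m] eval_add[OF S(1) e a m] eval_mult[OF e S(3) IH(1)] IH(2)
        by (simp add: map_poly_pCons eval_0[OF S(1) e])
    qed
  qed
  then show ?thesis using P by blast
qed

lemma eval_poly_dvd:
  fixes p :: int
  assumes T: "subring_set T" and e: "eval_hom T e" "eval_hom T e0" and P: "P \<in> polys T"
    and p: "\<And>x. x \<in> T \<Longrightarrow> p dvd e x - e0 x" and c: "p dvd c - c0"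
  shows "p dvd poly (map_poly e P) c - poly (map_poly e0 P) c0"
proof -
  have e0: "e 0 = 0" "e0 0 = 0" using e eval_0[OF T] by auto
  have "P \<in> polys T \<longrightarrow> p dvd poly (map_poly e P) c - poly (map_poly e0 P) c0"
  proof (induction P)
    case (pCons a P)
    show ?case
    proof
      assume *: "pCons a P \<in> polys T"
      have a: "a \<in> T" and P: "P \<in> polys T"
        using * by (auto simp: polys_pCons_iff)
      have "poly (map_poly e (pCons a P)) c - poly (map_poly e0 (pCons a P)) c0
        = (e a - e0 a) + (c * (poly (map_poly e P) c - poly (map_poly e0 P) c0) + (c - c0) * poly (map_poly e0 P) c0)"
        by (simp add: map_poly_pCons e0 algebra_simps)
      then show "p dvd poly (map_poly e (pCons a P)) c - poly (map_poly e0 (pCons a P)) c0"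
        using p[OF a] pCons.IH P c by simp
    qed
  qed simp
  then show ?thesis using P by blast
qed

text \<open>When \<open>b\<close> is transcendental, an evaluation of \<open>T\<close> extends to the
  adjunction of \<open>b\<close> with any prescribed integer as the value of \<open>b\<close>.
  To detect a polynomial in \<open>b\<close>, first detect one of its coefficients; what
  remains is a nonzero polynomial with integer coefficients, and among the infinitely many
  values allowed by the congruence only finitely many are roots.\<close>

lemma evaluable_adjoin:
  assumes T: "evaluable T" and b: "b \<in> R" and trans: "\<not> alg_over T b"
  shows "evaluable (adjoin T b)"
proof -
  have sT: "subring_set T" and TR: "T \<subseteq> R" using T by (auto simp: evaluable_def)
  note sA = subring_adjoin[OF sT, of b]
  have tr: "coeff P i \<in> I" if "P \<in> polys T" "poly P b \<in> I" for P i
    using that trans unfolding alg_over_def by blast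
  define ext where "ext e c y = poly (map_poly e (SOME P. P \<in> polys T \<and> poly P b = y)) c" for e :: "'a \<Rightarrow> int" and c y
  have ext: "ext e c (poly P b) = poly (map_poly e P) c" if e: "eval_hom T e" and P: "P \<in> polys T" for e c P
  proof -
    define Q where "Q = (SOME Q. Q \<in> polys T \<and> poly Q b = poly P b)"
    have Q: "Q \<in> polys T \<and> poly Q b = poly P b" unfolding Q_def by (rule someI[of _ P]) (use P in simp)
    then have PQ: "P - Q \<in> polys T" "poly (P - Q) b \<in> I" using polys_diff[OF sT] P ideal_0[OF I] by auto
    have "map_poly e Q = map_poly e P"
    proof (rule poly_eqI)
      fix i
      have c: "coeff P i \<in> T" "coeff Q i \<in> T" using P Q by (auto simp: polys_def)
      have "e (coeff (P - Q) i) = 0"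
        using PQ tr[OF PQ, of i] by (intro eval_I[OF e]) (auto simp: polys_def)
      then show "coeff (map_poly e Q) i = coeff (map_poly e P) i"
        using eval_diff[OF e c] eval_0[OF sT e] by (simp add: coeff_map_poly)
    qed
    then show ?thesis unfolding ext_def Q_def by simp
  qed
  have mp_diff: "map_poly e (P - Q) = map_poly e P - map_poly e Q"
    if "eval_hom T e" "P \<in> polys T" "Q \<in> polys T" for e P Q
    using that by (intro poly_eqI) (auto simp: coeff_map_poly eval_0[OF sT] eval_diff polys_def)
  have mp_mult: "map_poly e (P * Q) = map_poly e P * map_poly e Q"
    if e: "eval_hom T e" and P: "P \<in> polys T" "Q \<in> polys T" for e P Q
  proof (rule poly_eqI)
    fix n
    have "e (\<Sum>i\<le>n. coeff P i * coeff Q (n - i)) = (\<Sum>i\<le>n. e (coeff P i * coeff Q (n - i)))"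
      using P by (intro eval_sum[OF sT e] subring_mult[OF sT]) (auto simp: polys_def)
    also have "\<dots> = (\<Sum>i\<le>n. e (coeff P i) * e (coeff Q (n - i)))"
      using P by (intro sum.cong refl eval_mult[OF e]) (auto simp: polys_def)
    finally show "coeff (map_poly e (P * Q)) n = coeff (map_poly e P * map_poly e Q) n"
      by (simp add: coeff_map_poly eval_0[OF sT e] coeff_mult)
  qed
  have hom: "eval_hom (adjoin T b) (ext e c)" if e: "eval_hom T e" for e c
  proof -
    have "ext e c (poly P b - poly Q b) = ext e c (poly P b) - ext e c (poly Q b) \<and>
        ext e c (poly P b * poly Q b) = ext e c (poly P b) * ext e c (poly Q b)"
      if PQ: "P \<in> polys T" "Q \<in> polys T" for P Q
      using ext[OF e polys_diff[OF sT PQ], of c] ext[OF e polys_mult[OF sT PQ], of c] ext[OF e PQ(1), of c] ext[OF e PQ(2), of c]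
        mp_diff[OF e PQ] mp_mult[OF e PQ] by simp
    moreover have "ext e c 1 = 1"
      using ext[OF e polys_1[OF sT], of c] eval_1[OF e] by (simp add: map_poly_1')
    moreover have "ext e c (poly P b) = 0" if P: "P \<in> polys T" "poly P b \<in> I" for P
    proof -
      have "map_poly e P = 0"
      proof (rule poly_eqI)
        fix i
        show "coeff (map_poly e P) i = coeff 0 i"
          using eval_I[OF e, of "coeff P i"] tr[OF P, of i] P eval_0[OF sT e]
          by (simp add: coeff_map_poly polys_def)
      qed
      then show ?thesis using ext[OF e P(1), of c] by simp
    qed
    ultimately show ?thesis unfolding eval_hom_def adjoin_def by auto
  qed
  have TA: "T \<subseteq> adjoin T b" using adjoin_base[OF sT] by blast
  show ?thesis unfolding evaluable_def
  proof (intro conjI allI impI)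
    show "adjoin T b \<subseteq> R" by (rule adjoin_subset[OF R TR b])
    obtain e where "eval_hom T e" using T unfolding evaluable_def by (elim conjE exE)
    then show "\<exists>e. eval_hom (adjoin T b) e" using hom by (intro exI)
  next
    fix e0 :: "'a \<Rightarrow> int" and p :: int and g
    assume e0: "eval_hom (adjoin T b) e0" and p: "p > 0" and g: "g \<in> adjoin T b - I"
    have e0T: "eval_hom T e0" using e0 TA unfolding eval_hom_def by blast
    obtain P where P: "P \<in> polys T" "g = poly P b" using g unfolding adjoin_def by blast
    obtain i where i: "coeff P i \<notin> I" using poly_in_I[OF TR b P(1)] P g by blast
    have "coeff P i \<in> T - I" using i P by (simp add: polys_def)
    then obtain e where e: "eval_hom T e" "\<And>x. x \<in> T \<Longrightarrow> p dvd e x - e0 x" "e (coeff P i) \<noteq> 0"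
      using evaluable_separates[OF T e0T p] by blast
    have "map_poly e P \<noteq> 0"
      using e(3) eval_0[OF sT e(1)] by (metis coeff_0 coeff_map_poly)
    then have fin: "finite {c. poly (map_poly e P) c = 0}" by (rule poly_roots_finite)
    have "infinite (range (\<lambda>z. e0 b + p * z))"
    proof
      assume "finite (range (\<lambda>z. e0 b + p * z))"
      then have "finite (UNIV :: int set)" by (rule finite_imageD) (use p in \<open>simp add: inj_def\<close>)
      then show False by simp
    qed
    then obtain z where z: "poly (map_poly e P) (e0 b + p * z) \<noteq> 0"
      using finite_subset[OF _ fin, of "range (\<lambda>z. e0 b + p * z)"] by auto
    \<comment> \<open>the value of \<open>b\<close> at the new integral point\<close>
    define c where "c = e0 b + p * z"
    have "p dvd ext e c x - e0 x" if x: "x \<in> adjoin T b" for x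
    proof -
      obtain Q where Q: "Q \<in> polys T" "x = poly Q b" using x unfolding adjoin_def by blast
      have "p dvd poly (map_poly e Q) c - poly (map_poly e0 Q) (e0 b)"
        by (rule eval_poly_dvd[OF sT e(1) e0T Q(1) e(2)]) (auto simp: c_def)
      then show ?thesis
        using ext[OF e(1) Q(1), of c] eval_poly[OF sA TA adjoin_gen[OF sT] e0 Q(1)] Q(2) by simp
    qed
    moreover have "ext e c g \<noteq> 0" using ext[OF e(1) P(1), of c] z P(2) by (simp add: c_def)
    ultimately show "\<exists>e. eval_hom (adjoin T b) e \<and> (\<forall>x\<in>adjoin T b. p dvd e x - e0 x) \<and> e g \<noteq> 0"
      using hom[OF e(1)] by blast
  qed (rule sA)
qed

lemma alg_over_mono: "T \<subseteq> T' \<Longrightarrow> alg_over T b \<Longrightarrow> alg_over T' b"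
  unfolding alg_over_def polys_def by blast

text \<open>Adjoin to the integers, one after the other, those generators that are transcendental over
  what is already there.\<close>

lemma ex_evaluable_subring:
  assumes "set gs \<subseteq> R" shows "\<exists>T. evaluable T \<and> (\<forall>b\<in>set gs. alg_over T b)"
  using assms
proof (induction gs)
  case Nil
  then show ?case using evaluable_int by auto
next
  case (Cons g gs)
  then obtain T where T: "evaluable T" "\<forall>b\<in>set gs. alg_over T b" by auto
  then have sT: "subring_set T" by (simp add: evaluable_def)
  show ?case
  proof (cases "alg_over T g")
    case True
    then show ?thesis using T by auto
  next
    case False
    note sA = subring_adjoin[OF sT, of g]
    have "alg_over (adjoin T g) g"
      unfolding alg_over_def
    proof (intro bexI conjI exI)
      show "poly [:- g, 1:] g \<in> I" using ideal_0[OF I] by simp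
      show "coeff [:- g, 1:] 1 \<notin> I" using proper by simp
      show "[:- g, 1:] \<in> polys (adjoin T g)"
        by (intro polys_pCons[OF sA] polys_0[OF sA] subring_uminus[OF sA] subring_1[OF sA] adjoin_gen[OF sT])
    qed
    moreover have "T \<subseteq> adjoin T g" using adjoin_base[OF sT] by blast
    ultimately show ?thesis using T evaluable_adjoin[OF T(1) _ False] Cons.prems alg_over_mono
      by (intro exI[of _ "adjoin T g"]) auto
  qed
qed

end

section \<open>Linear algebra over an evaluable subring\<close>

context coprimary
begin

text \<open>The elements of \<open>R\<close> that lie in the span of \<open>U\<close> over the fraction
  field of \<open>T\<close>, modulo \<open>I\<close>.\<close>

definition fracspan :: "'a set \<Rightarrow> 'a set \<Rightarrow> 'a set" where
  "fracspan T U = {b \<in> R. \<exists>t\<in>T - I. t * b \<in> lincomb T I U}"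

lemma evaluable_closed:
  assumes "evaluable T"
  shows evaluable_subring: "subring_set T" and evaluable_subset: "T \<subseteq> R"
  using assms by (simp_all add: evaluable_def)

text \<open>An element of \<open>T\<close> outside \<open>I\<close> has a nonzero value at some integral
  point, so that it is not nilpotent modulo \<open>I\<close>. As the ring is coprimary, it is
  a non-zero-divisor.\<close>

lemma evaluable_regular:
  assumes T: "evaluable T" and t: "t \<in> T - I" and x: "x \<in> R" "t * x \<in> I"
  shows "x \<in> I"
proof -
  have tR: "t \<in> R" using t evaluable_subset[OF T] by blast
  have "t ^ n \<notin> I" for n
  proof
    assume n: "t ^ n \<in> I"
    obtain e0 where "eval_hom T e0" using T unfolding evaluable_def by (elim conjE exE)
    then obtain e where e: "eval_hom T e" "e t \<noteq> 0"
      using evaluable_separates[OF T _ _ t, of e0 1] by auto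
    have "e (t ^ n) = 0"
      using t n by (intro eval_I[OF e(1)] subring_power[OF evaluable_subring[OF T]]) auto
    then show False using eval_power[OF evaluable_subring[OF T] e(1), of t n] t e(2) by simp
  qed
  then show ?thesis using primary[OF tR] x by blast
qed

lemma evaluable_mult:
  assumes T: "evaluable T" and "s \<in> T - I" "t \<in> T - I" shows "s * t \<in> T - I"
  using evaluable_regular[OF T assms(2), of t] assms subring_mult[OF evaluable_subring[OF T], of s t] evaluable_subset[OF T]
  by auto

lemma evaluable_prod:
  assumes T: "evaluable T" and "finite A" "\<And>i. i \<in> A \<Longrightarrow> f i \<in> T - I" shows "prod f A \<in> T - I"
  using assms(2,3)
proof (induction A rule: finite_induct)
  case empty
  then show ?case using subring_1[OF evaluable_subring[OF T]] proper by simp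
next
  case (insert x F)
  then show ?case using evaluable_mult[OF T, of "f x" "prod f F"] by simp
qed

lemma evaluable_power:
  assumes T: "evaluable T" and "t \<in> T - I" shows "t ^ n \<in> T - I"
  using evaluable_prod[OF T, of "{..<n}" "\<lambda>_. t"] assms by simp

lemma lincomb_R:
  assumes "evaluable T" "U \<subseteq> R" shows "lincomb T I U \<subseteq> R"
proof
  fix x assume "x \<in> lincomb T I U"
  then obtain c where c: "\<forall>u\<in>U. c u \<in> T" "x - (\<Sum>u\<in>U. c u * u) \<in> I" unfolding lincomb_def by blast
  have "(\<Sum>u\<in>U. c u * u) \<in> R"
    using c assms evaluable_subset[OF assms(1)] by (intro subring_sum[OF R] subring_mult[OF R]) auto
  from subring_add[OF R ideal_sub[OF I c(2)] this] show "x \<in> R" by simp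
qed

lemmas lc_add = lincomb_add[OF evaluable_subring I]

lemma lc_mult: "evaluable T \<Longrightarrow> x \<in> lincomb T I U \<Longrightarrow> a \<in> T \<Longrightarrow> a * x \<in> lincomb T I U"
  by (rule lincomb_mult[OF evaluable_subring I evaluable_subset])

lemma fracspanI: "b \<in> R \<Longrightarrow> t \<in> T - I \<Longrightarrow> t * b \<in> lincomb T I U \<Longrightarrow> b \<in> fracspan T U"
  unfolding fracspan_def by blast

lemma fracspanE:
  assumes "b \<in> fracspan T U" obtains t where "b \<in> R" "t \<in> T - I" "t * b \<in> lincomb T I U"
  using assms unfolding fracspan_def by blast

lemma fracspan_base:
  assumes "evaluable T" "x \<in> lincomb T I U" "U \<subseteq> R" shows "x \<in> fracspan T U"
  using assms lincomb_R[OF assms(1,3)] subring_1[OF evaluable_subring[OF assms(1)]] proper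
  by (intro fracspanI[where t = 1]) auto

lemma fracspan_add:
  assumes T: "evaluable T" and x: "x \<in> fracspan T U" "y \<in> fracspan T U" shows "x + y \<in> fracspan T U"
proof -
  obtain s t where *: "x \<in> R" "s \<in> T - I" "s * x \<in> lincomb T I U" "y \<in> R" "t \<in> T - I" "t * y \<in> lincomb T I U"
    using x by (auto elim!: fracspanE)
  have "t * (s * x) + s * (t * y) \<in> lincomb T I U"
    by (rule lc_add[OF T lc_mult[OF T *(3)] lc_mult[OF T *(6)]]) (use * in auto)
  then show ?thesis
    using * by (intro fracspanI[OF _ evaluable_mult[OF T *(2,5)]] subring_add[OF R]) (simp_all add: algebra_simps)
qed

lemma fracspan_mult:
  assumes T: "evaluable T" and x: "x \<in> fracspan T U" and a: "a \<in> T" shows "a * x \<in> fracspan T U"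
proof -
  obtain s where *: "x \<in> R" "s \<in> T - I" "s * x \<in> lincomb T I U" using x by (rule fracspanE)
  have "a * (s * x) \<in> lincomb T I U" by (rule lc_mult[OF T *(3) a])
  then show ?thesis using * a evaluable_subset[OF T]
    by (intro fracspanI[OF _ *(2)] subring_mult[OF R]) (auto simp: mult.left_commute)
qed

lemma fracspan_I:
  assumes T: "evaluable T" and "U \<subseteq> R" "x \<in> I" shows "x \<in> fracspan T U"
  by (rule fracspan_base[OF T lincomb_base[OF evaluable_subring[OF T] assms(3)] assms(2)])

lemma fracspan_sum:
  assumes T: "evaluable T" and U: "U \<subseteq> R" and "\<And>i. i \<in> A \<Longrightarrow> f i \<in> fracspan T U" shows "sum f A \<in> fracspan T U"
  using assms(3)
  by (induction A rule: infinite_finite_induct) (simp_all add: fracspan_I[OF T U ideal_0[OF I]] fracspan_add[OF T])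

lemma fracspan_gen:
  assumes T: "evaluable T" and U: "U \<subseteq> R" "finite U" and u: "u \<in> U" shows "u \<in> fracspan T U"
  by (rule fracspan_base[OF T lincomb_gen[OF evaluable_subring[OF T] I U(2) u] U(1)])

lemma fracspan_cancel:
  assumes T: "evaluable T" and t: "t \<in> T - I" "b \<in> R" "t * b \<in> fracspan T U" shows "b \<in> fracspan T U"
proof -
  obtain s where *: "s \<in> T - I" "s * (t * b) \<in> lincomb T I U" using t(3) by (rule fracspanE)
  show ?thesis
    by (rule fracspanI[OF t(2) evaluable_mult[OF T *(1) t(1)]]) (use *(2) in \<open>simp add: mult.assoc\<close>)
qed

lemma fracspan_combination:
  assumes T: "evaluable T" and U: "U \<subseteq> R" and c: "\<And>v. v \<in> V \<Longrightarrow> c v \<in> T" "\<And>v. v \<in> V \<Longrightarrow> f v \<in> fracspan T U"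
    and x: "x - (\<Sum>v\<in>V. c v * f v) \<in> I"
  shows "x \<in> fracspan T U"
proof -
  have "(x - (\<Sum>v\<in>V. c v * f v)) + (\<Sum>v\<in>V. c v * f v) \<in> fracspan T U"
    by (intro fracspan_add[OF T] fracspan_I[OF T U x] fracspan_sum[OF T U] fracspan_mult[OF T] c)
  then show ?thesis by simp
qed

lemma fracspan_trans:
  assumes T: "evaluable T" and V: "V \<subseteq> R" and UV: "U \<subseteq> fracspan T V" shows "fracspan T U \<subseteq> fracspan T V"
proof
  fix b assume "b \<in> fracspan T U"
  then obtain t where t: "b \<in> R" "t \<in> T - I" "t * b \<in> lincomb T I U" by (rule fracspanE)
  then obtain c where c: "\<forall>u\<in>U. c u \<in> T" "t * b - (\<Sum>u\<in>U. c u * u) \<in> I" unfolding lincomb_def by blast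
  have "t * b \<in> fracspan T V"
    using c UV by (intro fracspan_combination[OF T V _ _ c(2)]) auto
  then show "b \<in> fracspan T V" by (rule fracspan_cancel[OF T t(2,1)])
qed

text \<open>If \<open>g\<close> satisfies an equation of degree \<open>m\<close> with leading
  coefficient outside \<open>I\<close>, then the products of the spanning elements with
  \<open>1, g, \<dots>, g ^ (m - 1)\<close> span over the fraction field a space that is
  stable under multiplication by \<open>g\<close>.\<close>

lemma fracspan_adjoin:
  assumes T: "evaluable T" and R': "subring_set R'" "R' \<subseteq> R" and U: "finite U" "U \<subseteq> R" "R' \<subseteq> fracspan T U"
    and g: "alg_over T g" "g \<in> R"
  shows "\<exists>V. finite V \<and> V \<subseteq> R \<and> adjoin R' g \<subseteq> fracspan T V"
proof -
  obtain P where P: "P \<in> polys T" "poly P g \<in> I" "\<exists>i. coeff P i \<notin> I"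
    using g(1) unfolding alg_over_def by blast
  let ?B = "{i. coeff P i \<notin> I}"
  have "?B \<subseteq> {..degree P}"
    using ideal_0[OF I] by (auto intro: le_degree)
  then have B: "finite ?B" "?B \<noteq> {}" using P(3) by (auto intro: finite_subset)
  \<comment> \<open>the degree of the relation after dropping the leading terms with coefficients in
    \<open>I\<close>\<close>
  define m where "m = Max ?B"
  have m: "coeff P m \<notin> I" "\<And>i. i > m \<Longrightarrow> coeff P i \<in> I"
    using Max_in[OF B] Max_ge[OF B(1)] unfolding m_def[symmetric] by force+
  have cT: "coeff P i \<in> T" for i using P(1) by (simp add: polys_def)
  have gi: "g ^ i \<in> R" for i using g(2) by (rule subring_power[OF R])
  have low: "(\<Sum>i\<le>m. coeff P i * g ^ i) \<in> I"
  proof -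
    define n where "n = max m (degree P)"
    have "poly P g = (\<Sum>i\<le>n. coeff P i * g ^ i)"
      unfolding poly_altdef n_def by (intro sum.mono_neutral_left) (auto simp: coeff_eq_0)
    also have "\<dots> = (\<Sum>i\<le>m. coeff P i * g ^ i) + (\<Sum>i\<in>{m<..n}. coeff P i * g ^ i)"
      by (subst sum.union_disjoint[symmetric]) (auto simp: n_def intro!: sum.cong)
    finally have e: "(\<Sum>i\<le>m. coeff P i * g ^ i) = poly P g - (\<Sum>i\<in>{m<..n}. coeff P i * g ^ i)"
      by simp
    show ?thesis unfolding e
      by (intro ideal_diff[OF R I P(2)] ideal_sum[OF I] ideal_mult2[OF I gi] m(2)) auto
  qed
  define V where "V = (\<lambda>(u, i). u * g ^ i) ` (U \<times> {..<m})"
  have V: "finite V" "V \<subseteq> R" unfolding V_def using U gi by (auto intro: subring_mult[OF R])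
  have top: "u * g ^ i \<in> fracspan T V" if u: "u \<in> U" "i \<le> m" for u i
  proof (cases "i < m")
    case True
    then show ?thesis using u by (intro fracspan_gen[OF T V(2,1)]) (auto simp: V_def)
  next
    case False
    then have i: "i = m" using u by simp
    have uR: "u \<in> R" using u U by blast
    have "u * (\<Sum>i\<le>m. coeff P i * g ^ i) \<in> I" by (rule ideal_mult[OF I uR low])
    also have "u * (\<Sum>i\<le>m. coeff P i * g ^ i) =
        coeff P m * (u * g ^ m) - (\<Sum>i<m. - coeff P i * (u * g ^ i))"
      by (simp add: lessThan_Suc_atMost[symmetric] sum_distrib_left sum_negf algebra_simps)
    finally have "coeff P m * (u * g ^ m) \<in> fracspan T V"
    proof (rule fracspan_combination[OF T V(2), rotated 2])
      fix i assume i: "i \<in> {..<m}"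
      show "- coeff P i \<in> T" by (rule subring_uminus[OF evaluable_subring[OF T] cT])
      have "u * g ^ i \<in> V" unfolding V_def using u i by auto
      then show "u * g ^ i \<in> fracspan T V" by (rule fracspan_gen[OF T V(2,1)])
    qed
    then have "u * g ^ m \<in> fracspan T V"
      using m(1) cT by (intro fracspan_cancel[OF T _ subring_mult[OF R uR gi]]) auto
    then show ?thesis using i by simp
  qed
  have mult_g: "g * x \<in> fracspan T V" if x: "x \<in> fracspan T V" for x
  proof -
    obtain t where t: "x \<in> R" "t \<in> T - I" "t * x \<in> lincomb T I V" using x by (rule fracspanE)
    then obtain c where c: "\<forall>v\<in>V. c v \<in> T" "t * x - (\<Sum>v\<in>V. c v * v) \<in> I" unfolding lincomb_def by blast
    have "t * (g * x) - (\<Sum>v\<in>V. c v * (g * v)) = g * (t * x - (\<Sum>v\<in>V. c v * v))"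
      by (simp add: sum_distrib_left right_diff_distrib mult.left_commute)
    also have "\<dots> \<in> I" by (rule ideal_mult[OF I g(2) c(2)])
    finally have "t * (g * x) - (\<Sum>v\<in>V. c v * (g * v)) \<in> I" .
    then have "t * (g * x) \<in> fracspan T V"
    proof (rule fracspan_combination[OF T V(2), rotated 2])
      fix v assume v: "v \<in> V"
      then show "c v \<in> T" using c by blast
      obtain u i where ui: "u \<in> U" "i < m" "v = u * g ^ i" using v unfolding V_def by auto
      have "u * g ^ Suc i \<in> fracspan T V" using ui by (intro top) auto
      then show "g * v \<in> fracspan T V" using ui by (simp add: mult.left_commute)
    qed
    then show ?thesis by (rule fracspan_cancel[OF T t(2) subring_mult[OF R g(2) t(1)]])
  qed
  have "U \<subseteq> fracspan T V" using top[of _ 0] by auto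
  then have R'V: "R' \<subseteq> fracspan T V" using fracspan_trans[OF T V(2), of U] U(3) by blast
  have "Q \<in> polys R' \<longrightarrow> poly Q g \<in> fracspan T V" for Q
  proof (induction Q)
    case 0
    then show ?case using fracspan_I[OF T V(2) ideal_0[OF I]] by simp
  next
    case (pCons a Q)
    then show ?case using R'V mult_g[of "poly Q g"] by (auto simp: polys_pCons_iff intro!: fracspan_add[OF T])
  qed
  then have "adjoin R' g \<subseteq> fracspan T V" unfolding adjoin_def by blast
  then show ?thesis using V by blast
qed

lemma ex_finite_span:
  assumes T: "evaluable T" and B: "subring_set B" "B \<subseteq> R" and U: "finite U" "U \<subseteq> R" "B \<subseteq> fracspan T U"
    and gs: "set gs \<subseteq> R" "\<forall>b\<in>set gs. alg_over T b"
  shows "\<exists>V. finite V \<and> V \<subseteq> R \<and> adjoins B gs \<subseteq> fracspan T V"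
  using B U gs
proof (induction gs arbitrary: B U)
  case Nil
  then show ?case by auto
next
  case (Cons g gs)
  obtain V where V: "finite V" "V \<subseteq> R" "adjoin B g \<subseteq> fracspan T V"
    using fracspan_adjoin[OF T Cons.prems(1-5), of g] Cons.prems(6,7) by auto
  have "adjoin B g \<subseteq> R" using adjoin_subset[OF R Cons.prems(2)] Cons.prems(6) by simp
  then show ?case using Cons.IH[OF subring_adjoin[OF Cons.prems(1)] _ V] Cons.prems(6,7) by simp
qed

definition indep :: "'a set \<Rightarrow> 'a set \<Rightarrow> bool" where
  "indep T U \<longleftrightarrow> (\<forall>c. (\<forall>u\<in>U. c u \<in> T) \<longrightarrow> (\<Sum>u\<in>U. c u * u) \<in> I \<longrightarrow> (\<forall>u\<in>U. c u \<in> I))"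

text \<open>A finite spanning set of least cardinality is independent.\<close>

lemma ex_basis:
  assumes T: "evaluable T" and U: "finite U" "U \<subseteq> R" "R \<subseteq> fracspan T U"
  shows "\<exists>U. finite U \<and> U \<subseteq> R \<and> R \<subseteq> fracspan T U \<and> indep T U"
proof -
  let ?P = "\<lambda>U. finite U \<and> U \<subseteq> R \<and> R \<subseteq> fracspan T U"
  obtain W where W: "?P W" "\<And>V. ?P V \<Longrightarrow> card W \<le> card V"
    using ex_has_least_nat[of ?P U card] U by blast
  have "indep T W" unfolding indep_def
  proof (intro allI impI ballI, rule ccontr)
    fix c w assume c: "\<forall>u\<in>W. c u \<in> T" "(\<Sum>u\<in>W. c u * u) \<in> I" and w: "w \<in> W" "c w \<notin> I"
    let ?V = "W - {w}"
    have V: "?V \<subseteq> R" "finite ?V" using W(1) by auto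
    have "c w * w - (\<Sum>u\<in>?V. - c u * u) \<in> I"
      using c(2) W(1) w(1) by (simp add: sum_negf sum.remove[of W w])
    then have "c w * w \<in> fracspan T ?V"
    proof (rule fracspan_combination[OF T V(1), rotated 2])
      fix v assume "v \<in> ?V"
      then show "- c v \<in> T" "v \<in> fracspan T ?V"
        using c(1) subring_uminus[OF evaluable_subring[OF T]] fracspan_gen[OF T V] by auto
    qed
    moreover have "c w \<in> T - I" using c(1) w by simp
    moreover have "w \<in> R" using W(1) w(1) by auto
    ultimately have "w \<in> fracspan T ?V" using fracspan_cancel[OF T] by simp
    moreover have "?V \<subseteq> fracspan T ?V" by (rule subsetI, rule fracspan_gen[OF T V])
    ultimately have "W \<subseteq> fracspan T ?V" by auto
    then have "fracspan T W \<subseteq> fracspan T ?V" by (rule fracspan_trans[OF T V(1)])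
    then have "?P ?V" using W(1) V by auto
    then have "card W \<le> card ?V" by (rule W(2))
    then show False using w(1) W(1) by (metis card_Diff1_less leD)
  qed
  then show ?thesis using W(1) by (intro exI[of _ W]) simp
qed

text \<open>The product of the denominators of the finitely many elements of \<open>X\<close> is a
  common denominator.\<close>

lemma ex_denominator:
  assumes T: "evaluable T" and U: "finite U" "U \<subseteq> R" "R \<subseteq> fracspan T U" and X: "finite X" "X \<subseteq> R"
  shows "\<exists>g\<in>T - I. \<forall>x\<in>X. g * x \<in> lincomb T I U"
proof -
  have "\<forall>x\<in>X. \<exists>t. t \<in> T - I \<and> t * x \<in> lincomb T I U"
    using X(2) U(3) by (auto elim!: fracspanE dest!: subsetD)
  then obtain t where t: "\<And>x. x \<in> X \<Longrightarrow> t x \<in> T - I" "\<And>x. x \<in> X \<Longrightarrow> t x * x \<in> lincomb T I U"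
    by (auto dest!: bchoice)
  have "prod t X * x \<in> lincomb T I U" if x: "x \<in> X" for x
  proof -
    have "prod t (X - {x}) \<in> T - I" using X(1) t(1) by (intro evaluable_prod[OF T]) auto
    then have "prod t (X - {x}) * (t x * x) \<in> lincomb T I U"
      by (intro lc_mult[OF T t(2)[OF x]]) simp
    then show ?thesis using prod.remove[OF X(1) x, of t] by (simp add: mult_ac)
  qed
  moreover have "prod t X \<in> T - I" by (rule evaluable_prod[OF T X(1) t(1)])
  ultimately show ?thesis by (intro bexI[of _ "prod t X"] ballI)
qed

end

section \<open>Coordinates with values in the rational numbers\<close>

lemma lincomb_sum:
  assumes "subring_set T" "ideal_in B I" "\<And>i. i \<in> A \<Longrightarrow> f i \<in> lincomb T I U"
  shows "sum f A \<in> lincomb T I U"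
  using assms(3)
  by (induction A rule: infinite_finite_induct)
    (simp_all add: lincomb_base[OF assms(1) ideal_0[OF assms(2)]] lincomb_add[OF assms(1,2)])

text \<open>The product of the ideals \<open>A\<close> and \<open>B\<close>, enlarged by
  \<open>N\<close>, since all products of ideals are taken in a quotient by \<open>N\<close>.\<close>

inductive_set idprod :: "'a::comm_ring_1 set \<Rightarrow> 'a set \<Rightarrow> 'a set \<Rightarrow> 'a set" for N A B where
  base: "x \<in> N \<Longrightarrow> x \<in> idprod N A B"
| step: "z \<in> idprod N A B \<Longrightarrow> a \<in> A \<Longrightarrow> b \<in> B \<Longrightarrow> z + a * b \<in> idprod N A B"

fun idpow :: "'a::comm_ring_1 set \<Rightarrow> 'a set \<Rightarrow> 'a set \<Rightarrow> nat \<Rightarrow> 'a set" where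
  "idpow R N q 0 = R"
| "idpow R N q (Suc j) = idprod N q (idpow R N q j)"

declare idpow.simps(2) [simp del]

definition finite_index :: "'a::comm_ring_1 set \<Rightarrow> 'a set \<Rightarrow> bool" where
  "finite_index R q \<longleftrightarrow> (\<exists>V. finite V \<and> V \<subseteq> R \<and> (\<forall>b\<in>R. \<exists>v\<in>V. b - v \<in> q))"

text \<open>The function \<open>l\<close> induces an additive function on the quotient by
  \<open>I\<close> and maps powers of the ideal \<open>q\<close> to multiples of powers of
  \<open>p\<close>. This is what makes the differences of \<open>l\<close> along an orbit of
  an automorphism small.\<close>

definition interpolating :: "'a::comm_ring_1 set \<Rightarrow> 'a set \<Rightarrow> 'a set \<Rightarrow> int \<Rightarrow> 'a set \<Rightarrow> ('a \<Rightarrow> rat) \<Rightarrow> bool" where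
  "interpolating R N I p q l \<longleftrightarrow>
     (\<forall>x\<in>R. \<forall>y\<in>R. l (x + y) = l x + l y) \<and> (\<forall>x\<in>I. l x = 0) \<and>
     (\<forall>j. \<forall>x\<in>idpow R N q j. pdiv p j (l x))"

text \<open>Here \<open>U\<close> is a basis over the fraction field of \<open>T\<close>, and powers of
  the single denominator \<open>g\<close> suffice to write every element of \<open>R\<close>
  in terms of \<open>U\<close>; after localisation at \<open>g\<close>, the quotient of
  \<open>R\<close> by \<open>I\<close> is thus free over the image of \<open>T\<close>, with
  basis \<open>U\<close>.\<close>

locale evaluation_lattice = coprimary R I for R I :: "'a::comm_ring_1 set" +
  fixes T U :: "'a set" and g :: 'a
  assumes T: "evaluable T" and U: "finite U" "U \<subseteq> R" and indep: "indep T U" and g: "g \<in> T - I"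
    and den: "\<And>b. b \<in> R \<Longrightarrow> \<exists>s. g ^ s * b \<in> lincomb T I U"
    and mult_den: "\<And>u v. u \<in> U \<Longrightarrow> v \<in> U \<Longrightarrow> g * (u * v) \<in> lincomb T I U"
begin

lemmas sT = evaluable_subring[OF T] and TR = evaluable_subset[OF T]

lemma gT: "g \<in> T" "g ^ s \<in> T" "g ^ s \<in> T - I"
  using g evaluable_power[OF T g] by auto

lemma TRD: "x \<in> T \<Longrightarrow> x \<in> R" and URD: "x \<in> U \<Longrightarrow> x \<in> R"
  using TR U by auto

text \<open>The family \<open>c\<close> gives the coordinates of \<open>g ^ s * b\<close> with respect
  to \<open>U\<close>.\<close>

definition rep :: "'a \<Rightarrow> nat \<Rightarrow> ('a \<Rightarrow> 'a) \<Rightarrow> bool" where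
  "rep b s c \<longleftrightarrow> (\<forall>u\<in>U. c u \<in> T) \<and> g ^ s * b - (\<Sum>u\<in>U. c u * u) \<in> I"

lemma repI: "(\<And>u. u \<in> U \<Longrightarrow> c u \<in> T) \<Longrightarrow> g ^ s * b - (\<Sum>u\<in>U. c u * u) \<in> I \<Longrightarrow> rep b s c"
  by (simp add: rep_def)

lemma repD: "rep b s c \<Longrightarrow> u \<in> U \<Longrightarrow> c u \<in> T" "rep b s c \<Longrightarrow> g ^ s * b - (\<Sum>u\<in>U. c u * u) \<in> I"
  by (simp_all add: rep_def)

lemma ex_rep: assumes "b \<in> R" shows "\<exists>s c. rep b s c"
proof -
  obtain s where "g ^ s * b \<in> lincomb T I U" using den[OF assms] by (rule exE)
  then show ?thesis unfolding lincomb_def rep_def by (intro exI[of _ s]) simp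
qed

lemma rep_shift:
  assumes "rep b s c" shows "rep b (s + n) (\<lambda>u. g ^ n * c u)"
proof (rule repI)
  have "g ^ n * (g ^ s * b - (\<Sum>u\<in>U. c u * u)) \<in> I"
    by (rule ideal_mult[OF I TRD[OF gT(2)] repD(2)[OF assms]])
  then show "g ^ (s + n) * b - (\<Sum>u\<in>U. g ^ n * c u * u) \<in> I"
    by (simp add: power_add right_diff_distrib sum_distrib_left mult_ac)
qed (rule subring_mult[OF sT gT(2) repD(1)[OF assms]])

lemma rep_diff:
  assumes "rep b s c" "rep b' s c'" shows "rep (b - b') s (\<lambda>u. c u - c' u)"
proof (rule repI)
  have "(g ^ s * b - (\<Sum>u\<in>U. c u * u)) - (g ^ s * b' - (\<Sum>u\<in>U. c' u * u)) \<in> I"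
    by (rule ideal_diff[OF R I repD(2)[OF assms(1)] repD(2)[OF assms(2)]])
  then show "g ^ s * (b - b') - (\<Sum>u\<in>U. (c u - c' u) * u) \<in> I"
    by (simp add: left_diff_distrib right_diff_distrib sum_subtractf algebra_simps)
qed (rule subring_diff[OF sT repD(1)[OF assms(1)] repD(1)[OF assms(2)]])

lemma rep_diff2:
  assumes "rep b s c" "rep b' s' c'" shows "rep (b - b') (s + s') (\<lambda>u. g ^ s' * c u - g ^ s * c' u)"
  using rep_diff[OF rep_shift[OF assms(1), of s'] rep_shift[OF assms(2), of s, unfolded add.commute[of s' s]]] .

lemma rep_I:
  assumes "x \<in> I" shows "rep x 0 (\<lambda>_. 0)"
  by (rule repI) (use assms subring_0[OF sT] in auto)

lemma rep_zero:
  assumes "rep x s c" "x \<in> I" "u \<in> U" shows "c u \<in> I"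
proof -
  have "(\<Sum>u\<in>U. c u * u) \<in> I"
    using ideal_diff[OF R I ideal_mult[OF I TRD[OF gT(2)] assms(2), of s] repD(2)[OF assms(1)]] by simp
  then show ?thesis using indep repD(1)[OF assms(1)] assms(3) unfolding indep_def by simp
qed

lemma rep_in_I:
  assumes "rep x s c" "x \<in> R" "\<And>u. u \<in> U \<Longrightarrow> c u \<in> I" shows "x \<in> I"
proof -
  have "(\<Sum>u\<in>U. c u * u) \<in> I"
    using assms(3) by (intro ideal_sum[OF I] ideal_mult2[OF I URD])
  then have "g ^ s * x \<in> I" using ideal_add[OF I repD(2)[OF assms(1)]] by fastforce
  then show ?thesis by (rule evaluable_regular[OF T gT(3) assms(2)])
qed

definition struct_coeff :: "'a \<Rightarrow> 'a \<Rightarrow> 'a \<Rightarrow> 'a" where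
  "struct_coeff u v = (SOME t. (\<forall>w\<in>U. t w \<in> T) \<and> g * (u * v) - (\<Sum>w\<in>U. t w * w) \<in> I)"

lemma struct_coeff:
  assumes "u \<in> U" "v \<in> U"
  shows "w \<in> U \<Longrightarrow> struct_coeff u v w \<in> T" "g * (u * v) - (\<Sum>w\<in>U. struct_coeff u v w * w) \<in> I"
proof -
  have "\<exists>t. (\<forall>w\<in>U. t w \<in> T) \<and> g * (u * v) - (\<Sum>w\<in>U. t w * w) \<in> I"
    using mult_den[OF assms] by (simp add: lincomb_def)
  then have "(\<forall>w\<in>U. struct_coeff u v w \<in> T) \<and> g * (u * v) - (\<Sum>w\<in>U. struct_coeff u v w * w) \<in> I"
    unfolding struct_coeff_def by (rule someI_ex)
  then show "w \<in> U \<Longrightarrow> struct_coeff u v w \<in> T" "g * (u * v) - (\<Sum>w\<in>U. struct_coeff u v w * w) \<in> I" by auto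
qed

text \<open>Coordinates of a product are bilinear in the coordinates of the factors; the additional
  factor \<open>g\<close> clears the denominators of the structure constants.\<close>

lemma rep_mult:
  assumes b: "rep b s c" "b \<in> R" and b': "rep b' s' c'" "b' \<in> R"
  shows "rep (b * b') (s + s' + 1) (\<lambda>w. \<Sum>u\<in>U. \<Sum>v\<in>U. c u * c' v * struct_coeff u v w)"
proof (rule repI)
  fix w assume "w \<in> U"
  then show "(\<Sum>u\<in>U. \<Sum>v\<in>U. c u * c' v * struct_coeff u v w) \<in> T"
    by (intro subring_sum[OF sT] subring_mult[OF sT] repD(1)[OF b(1)] repD(1)[OF b'(1)] struct_coeff)
next
  let ?S = "\<Sum>u\<in>U. c u * u" and ?S' = "\<Sum>v\<in>U. c' v * v"
  have SR: "?S \<in> R" by (intro subring_sum[OF R] subring_mult[OF R] TRD[OF repD(1)[OF b(1)]] URD)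
  have 1: "g * (g ^ s' * b') * (g ^ s * b - ?S) \<in> I"
    by (intro ideal_mult[OF I _ repD(2)[OF b(1)]] subring_mult[OF R] TRD[OF gT(1)] TRD[OF gT(2)] b'(2))
  have 2: "g * ?S * (g ^ s' * b' - ?S') \<in> I"
    by (intro ideal_mult[OF I _ repD(2)[OF b'(1)]] subring_mult[OF R] TRD[OF gT(1)] SR)
  have 3: "(\<Sum>u\<in>U. \<Sum>v\<in>U. (c u * c' v) * (g * (u * v) - (\<Sum>w\<in>U. struct_coeff u v w * w))) \<in> I"
    by (intro ideal_sum[OF I] ideal_mult[OF I] struct_coeff(2) subring_mult[OF R] TRD[OF repD(1)[OF b(1)]] TRD[OF repD(1)[OF b'(1)]])
  have e1: "(\<Sum>u\<in>U. \<Sum>v\<in>U. (c u * c' v) * (g * (u * v))) = g * ?S * ?S'"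
    by (simp add: sum_product sum_distrib_left mult_ac)
  have e2: "(\<Sum>u\<in>U. \<Sum>v\<in>U. (c u * c' v) * (\<Sum>w\<in>U. struct_coeff u v w * w)) =
      (\<Sum>w\<in>U. (\<Sum>u\<in>U. \<Sum>v\<in>U. c u * c' v * struct_coeff u v w) * w)"
  proof -
    have "(\<Sum>w\<in>U. (\<Sum>u\<in>U. \<Sum>v\<in>U. c u * c' v * struct_coeff u v w) * w) =
        (\<Sum>w\<in>U. \<Sum>u\<in>U. \<Sum>v\<in>U. c u * c' v * struct_coeff u v w * w)"
      by (simp add: sum_distrib_right)
    also have "\<dots> = (\<Sum>u\<in>U. \<Sum>w\<in>U. \<Sum>v\<in>U. c u * c' v * struct_coeff u v w * w)"
      by (rule sum.swap)
    also have "\<dots> = (\<Sum>u\<in>U. \<Sum>v\<in>U. \<Sum>w\<in>U. c u * c' v * struct_coeff u v w * w)"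
      by (intro sum.cong refl sum.swap)
    finally show ?thesis by (simp add: sum_distrib_left mult.assoc)
  qed
  have "g ^ (s + s' + 1) * (b * b') - (\<Sum>w\<in>U. (\<Sum>u\<in>U. \<Sum>v\<in>U. c u * c' v * struct_coeff u v w) * w) =
     g * (g ^ s' * b') * (g ^ s * b - ?S) + (g * ?S * (g ^ s' * b' - ?S') +
     (\<Sum>u\<in>U. \<Sum>v\<in>U. (c u * c' v) * (g * (u * v) - (\<Sum>w\<in>U. struct_coeff u v w * w))))"
    unfolding right_diff_distrib[of "_ * _" "g * (_ * _)"] sum_subtractf e1 e2
    by (simp add: power_add algebra_simps)
  also have "\<dots> \<in> I" by (intro ideal_add[OF I] 1 2 3)
  finally show "g ^ (s + s' + 1) * (b * b') - (\<Sum>w\<in>U. (\<Sum>u\<in>U. \<Sum>v\<in>U. c u * c' v * struct_coeff u v w) * w) \<in> I" .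
qed

text \<open>The coordinate of \<open>b\<close> at \<open>u\<close>, a fraction with a power of
  \<open>g\<close> as denominator, evaluated at the integral point \<open>e\<close>.\<close>

definition coord :: "('a \<Rightarrow> int) \<Rightarrow> 'a \<Rightarrow> 'a \<Rightarrow> rat" where
  "coord e u b = (SOME r. \<exists>s c. rep b s c \<and> r = of_int (e (c u)) / of_int (e g) ^ s)"

lemma coord_eq:
  assumes b: "rep b s c" and e: "eval_hom T e" "e g \<noteq> 0" and u: "u \<in> U"
  shows "coord e u b = of_int (e (c u)) / of_int (e g) ^ s"
proof -
  have "\<exists>s c. rep b s c \<and> coord e u b = of_int (e (c u)) / of_int (e g) ^ s"
    unfolding coord_def by (rule someI_ex) (use b in blast)
  then obtain s' c' where b': "rep b s' c'" and r: "coord e u b = of_int (e (c' u)) / of_int (e g) ^ s'"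
    by blast
  have "g ^ s' * c u - g ^ s * c' u \<in> I"
    using rep_zero[OF rep_diff2[OF b b'] _ u] ideal_0[OF I] by simp
  moreover have cT: "c u \<in> T" "c' u \<in> T" using repD(1)[OF b u] repD(1)[OF b' u] .
  moreover have "g ^ s' * c u \<in> T" "g ^ s * c' u \<in> T" by (intro subring_mult[OF sT] gT cT)+
  ultimately have "e (g ^ s' * c u) = e (g ^ s * c' u)"
    using eval_I[OF e(1) subring_diff[OF sT]] eval_diff[OF e(1)] by fastforce
  then have "e g ^ s' * e (c u) = e g ^ s * e (c' u)"
    by (simp add: eval_mult[OF e(1) gT(2)] cT eval_power[OF sT e(1) gT(1)])
  then have "(of_int (e g) ^ s' * of_int (e (c u)) :: rat) = of_int (e g) ^ s * of_int (e (c' u))"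
    by (metis of_int_mult of_int_power)
  then show ?thesis unfolding r using e(2) by (simp add: field_simps)
qed

lemma coord_diff:
  assumes e: "eval_hom T e" "e g \<noteq> 0" and u: "u \<in> U" and b: "b \<in> R" "b' \<in> R"
  shows "coord e u (b - b') = coord e u b - coord e u b'"
proof -
  obtain s c s' c' where r: "rep b s c" "rep b' s' c'" using ex_rep b by meson
  have cT: "c u \<in> T" "c' u \<in> T" using repD(1)[OF r(1) u] repD(1)[OF r(2) u] .
  have "e (g ^ s' * c u - g ^ s * c' u) = e g ^ s' * e (c u) - e g ^ s * e (c' u)"
    by (simp add: eval_diff[OF e(1)] subring_mult[OF sT] gT cT eval_mult[OF e(1)] eval_power[OF sT e(1)])
  then have *: "(of_int (e (g ^ s' * c u - g ^ s * c' u)) :: rat) =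
      of_int (e g) ^ s' * of_int (e (c u)) - of_int (e g) ^ s * of_int (e (c' u))" by simp
  have nz: "(of_int (e g) :: rat) \<noteq> 0" using e(2) by simp
  show ?thesis
    unfolding coord_eq[OF rep_diff2[OF r] e u] coord_eq[OF r(1) e u] coord_eq[OF r(2) e u] *
    using nz by (simp add: diff_divide_distrib power_add)
qed

lemma coord_I:
  assumes e: "eval_hom T e" "e g \<noteq> 0" and u: "u \<in> U" and x: "x \<in> I" shows "coord e u x = 0"
  using coord_eq[OF rep_I[OF x] e u] eval_0[OF sT e(1)] by simp

text \<open>The elements all of whose coordinates at the integral point \<open>e\<close> are divisible
  by \<open>p\<^sup>j\<close>, provided that \<open>p\<close> does not divide the value of
  \<open>g\<close> at \<open>e\<close>.\<close>

definition level :: "('a \<Rightarrow> int) \<Rightarrow> int \<Rightarrow> nat \<Rightarrow> 'a set" where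
  "level e p j = {b \<in> R. \<exists>s c. rep b s c \<and> (\<forall>u\<in>U. p ^ j dvd e (c u))}"

lemma levelE:
  assumes "b \<in> level e p j"
  obtains s c where "b \<in> R" "rep b s c" "\<And>u. u \<in> U \<Longrightarrow> p ^ j dvd e (c u)"
  using assms unfolding level_def by blast

lemma levelI: "b \<in> R \<Longrightarrow> rep b s c \<Longrightarrow> (\<And>u. u \<in> U \<Longrightarrow> p ^ j dvd e (c u)) \<Longrightarrow> b \<in> level e p j"
  unfolding level_def by blast

lemma level_0: "level e p 0 = R"
  using ex_rep unfolding level_def by auto

lemma level_I:
  assumes "eval_hom T e" "x \<in> I" shows "x \<in> level e p j"
  by (rule levelI[OF ideal_sub[OF I assms(2)] rep_I[OF assms(2)]]) (simp add: eval_0[OF sT assms(1)])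

lemma level_diff:
  assumes e: "eval_hom T e" and x: "x \<in> level e p j" "y \<in> level e p j" shows "x - y \<in> level e p j"
proof -
  obtain s c where c: "x \<in> R" "rep x s c" "\<And>u. u \<in> U \<Longrightarrow> p ^ j dvd e (c u)" using x(1) by (rule levelE) (rule that)
  obtain s' c' where c': "y \<in> R" "rep y s' c'" "\<And>u. u \<in> U \<Longrightarrow> p ^ j dvd e (c' u)" using x(2) by (rule levelE) (rule that)
  show ?thesis
  proof (rule levelI[OF subring_diff[OF R c(1) c'(1)] rep_diff2[OF c(2) c'(2)]])
    fix u assume u: "u \<in> U"
    have "e (g ^ s' * c u - g ^ s * c' u) = e (g ^ s') * e (c u) - e (g ^ s) * e (c' u)"
      using repD(1)[OF c(2) u] repD(1)[OF c'(2) u]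
      by (simp add: eval_diff[OF e] subring_mult[OF sT] gT eval_mult[OF e])
    then show "p ^ j dvd e (g ^ s' * c u - g ^ s * c' u)" using c(3)[OF u] c'(3)[OF u] by simp
  qed
qed

text \<open>The structure constants have denominator \<open>g\<close>, which does not affect the
  divisibility of the numerators.\<close>

lemma level_mult:
  assumes e: "eval_hom T e" and x: "x \<in> level e p i" "y \<in> level e p j" shows "x * y \<in> level e p (i + j)"
proof -
  obtain s c where c: "x \<in> R" "rep x s c" "\<And>u. u \<in> U \<Longrightarrow> p ^ i dvd e (c u)" using x(1) by (rule levelE) (rule that)
  obtain s' c' where c': "y \<in> R" "rep y s' c'" "\<And>u. u \<in> U \<Longrightarrow> p ^ j dvd e (c' u)" using x(2) by (rule levelE) (rule that)
  show ?thesis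
  proof (rule levelI[OF subring_mult[OF R c(1) c'(1)] rep_mult[OF c(2,1) c'(2,1)]])
    fix w assume w: "w \<in> U"
    note cT = repD(1)[OF c(2)] repD(1)[OF c'(2)]
    have "e (\<Sum>u\<in>U. \<Sum>v\<in>U. c u * c' v * struct_coeff u v w) = (\<Sum>u\<in>U. e (\<Sum>v\<in>U. c u * c' v * struct_coeff u v w))"
      by (intro eval_sum[OF sT e] subring_sum[OF sT] subring_mult[OF sT] cT struct_coeff(1) w)
    also have "\<dots> = (\<Sum>u\<in>U. \<Sum>v\<in>U. e (c u * c' v * struct_coeff u v w))"
      by (intro sum.cong refl eval_sum[OF sT e] subring_mult[OF sT] cT struct_coeff(1) w)
    also have "\<dots> = (\<Sum>u\<in>U. \<Sum>v\<in>U. e (c u) * e (c' v) * e (struct_coeff u v w))"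
      using w by (intro sum.cong refl) (simp add: eval_mult[OF e] subring_mult[OF sT] cT struct_coeff(1))
    finally show "p ^ (i + j) dvd e (\<Sum>u\<in>U. \<Sum>v\<in>U. c u * c' v * struct_coeff u v w)"
      using c(3) c'(3) by (simp add: power_add dvd_sum mult_dvd_mono dvd_mult2)
  qed
qed

lemma level_ideal: assumes e: "eval_hom T e" shows "ideal_in R (level e p j)"
  unfolding ideal_in_def
proof (intro conjI ballI)
  show "level e p j \<subseteq> R" unfolding level_def by blast
  show 0: "0 \<in> level e p j" by (rule level_I[OF e ideal_0[OF I]])
  fix x y assume xy: "x \<in> level e p j" "y \<in> level e p j"
  have "x - (0 - y) \<in> level e p j" by (intro level_diff[OF e] xy 0)
  then show "x + y \<in> level e p j" by simp
next
  fix r x assume "r \<in> R" "x \<in> level e p j"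
  then show "r * x \<in> level e p j" using level_mult[OF e, of r p 0 x j] by (simp add: level_0)
qed

lemma level_idpow:
  assumes e: "eval_hom T e" and N: "N \<subseteq> I" shows "idpow R N (level e p 1) j \<subseteq> level e p j"
proof (induction j)
  case (Suc j)
  show ?case
  proof
    fix x assume "x \<in> idpow R N (level e p 1) (Suc j)"
    then have "x \<in> idprod N (level e p 1) (idpow R N (level e p 1) j)" by (simp add: idpow.simps(2))
    then show "x \<in> level e p (Suc j)"
    proof induction
      case (base x)
      then show ?case using level_I[OF e] N by blast
    next
      case (step z a b)
      have "a * b \<in> level e p (1 + j)" using Suc.IH step by (intro level_mult[OF e]) auto
      then show ?case using ideal_add[OF level_ideal[OF e] step.IH] by simp
    qed
  qed
qed (simp add: level_0)

lemma level_pdiv: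
  assumes p: "prime p" and e: "eval_hom T e" "\<not> p dvd e g" and b: "b \<in> level e p j" and u: "u \<in> U"
  shows "pdiv p j (coord e u b)"
proof -
  obtain s c where c: "b \<in> R" "rep b s c" "\<And>u. u \<in> U \<Longrightarrow> p ^ j dvd e (c u)" using b by (rule levelE) (rule that)
  have nz: "e g \<noteq> 0" using e(2) by auto
  obtain a where a: "e (c u) = p ^ j * a" using c(3)[OF u] by (rule dvdE)
  have "of_int (e g ^ s) * coord e u b = of_int (p ^ j * a)"
    unfolding coord_eq[OF c(2) e(1) nz u] a using nz by simp
  then show ?thesis by (rule pdivI[rotated]) (use e(2) p prime_dvd_power in blast)
qed

lemma level_cong:
  assumes e: "eval_hom T e" "eval_hom T e0" and c: "\<And>x. x \<in> T \<Longrightarrow> p dvd e x - e0 x"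
  shows "level e p 1 = level e0 p 1"
proof -
  have "p ^ 1 dvd e (c u) \<longleftrightarrow> p ^ 1 dvd e0 (c u)" if r: "rep b s c" and u: "u \<in> U" for b s c u
    using c[OF repD(1)[OF r u]] by (metis diff_eq_eq dvd_add_right_iff power_one_right add.commute)
  then show ?thesis unfolding level_def by blast
qed

text \<open>The class of \<open>b\<close> is determined by the residues modulo \<open>p\<close> of the
  value of the denominator and of the coordinates in one chosen representation of
  \<open>b\<close>, for which there are finitely many possibilities.\<close>

lemma level_finite_index:
  assumes p: "prime p" and e: "eval_hom T e" "\<not> p dvd e g"
  shows "finite_index R (level e p 1)"
proof -
  have p0: "p > 0" using p prime_gt_0_int by blast
  define s where "s b = (SOME s. \<exists>c. rep b s c)" for b
  define c where "c b = (SOME c. rep b (s b) c)" for b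
  have r: "rep b (s b) (c b)" if "b \<in> R" for b
  proof -
    have "\<exists>c. rep b (s b) c" unfolding s_def by (rule someI_ex[OF ex_rep[OF that]])
    then show ?thesis unfolding c_def by (rule someI_ex)
  qed
  define f where "f b = (e g ^ s b mod p, \<lambda>u\<in>U. e (c b u) mod p)" for b
  have "f ` R \<subseteq> {0..<p} \<times> (U \<rightarrow>\<^sub>E {0..<p})"
    using p0 unfolding f_def by auto
  then have fin: "finite (f ` R)"
    by (rule finite_subset) (intro finite_cartesian_product finite_PiE U finite_atLeastLessThan_int)
  define V where "V = (\<lambda>y. SOME b. b \<in> R \<and> f b = y) ` f ` R"
  have V: "(SOME b'. b' \<in> R \<and> f b' = f b) \<in> R \<and> f (SOME b'. b' \<in> R \<and> f b' = f b) = f b" if "b \<in> R" for b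
    by (rule someI[of "\<lambda>b'. b' \<in> R \<and> f b' = f b" b]) (use that in simp)
  have same: "b - b' \<in> level e p 1" if bR: "b \<in> R" "b' \<in> R" and fb: "f b' = f b" for b b'
  proof (rule levelI[OF subring_diff[OF R bR] rep_diff2[OF r[OF bR(1)] r[OF bR(2)]]])
    fix u assume u: "u \<in> U"
    have cT: "c b u \<in> T" "c b' u \<in> T" using repD(1)[OF r[OF bR(1)] u] repD(1)[OF r[OF bR(2)] u] .
    have 1: "e g ^ s b' mod p = e g ^ s b mod p" using fb by (simp add: f_def)
    have 2: "e (c b' u) mod p = e (c b u) mod p" using fun_cong[OF arg_cong[OF fb, of snd], of u] u by (simp add: f_def)
    have "(e g ^ s b' * e (c b u)) mod p = (e g ^ s b * e (c b' u)) mod p"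
      by (rule mod_mult_cong[OF 1 2[symmetric]])
    then have "p dvd e g ^ s b' * e (c b u) - e g ^ s b * e (c b' u)" by (rule mod_eq_dvd_iff[THEN iffD1])
    then show "p ^ 1 dvd e (g ^ s b' * c b u - g ^ s b * c b' u)"
      by (simp add: eval_diff[OF e(1)] subring_mult[OF sT] gT cT eval_mult[OF e(1)] eval_power[OF sT e(1)])
  qed
  have "finite V" unfolding V_def using fin by (rule finite_imageI)
  moreover have "V \<subseteq> R" unfolding V_def using V by auto
  moreover have "\<exists>v\<in>V. b - v \<in> level e p 1" if b: "b \<in> R" for b
  proof (rule bexI)
    show "b - (SOME b'. b' \<in> R \<and> f b' = f b) \<in> level e p 1" using same[OF b] V[OF b] by simp
  qed (use b in \<open>auto simp: V_def\<close>)
  ultimately show ?thesis unfolding finite_index_def by (intro exI[of _ V]) simp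
qed

text \<open>All integral points congruent to one of them modulo \<open>p\<close> share the ideal of
  elements with coordinates divisible by \<open>p\<close>, and together they detect every
  element outside \<open>I\<close>.\<close>

lemma interpolation:
  assumes N: "N \<subseteq> I"
  shows "\<exists>p q L. prime p \<and> ideal_in R q \<and> N \<subseteq> q \<and> finite_index R q \<and>
    (\<forall>l\<in>L. interpolating R N I p q l) \<and> (\<forall>x\<in>R. (\<forall>l\<in>L. l x = 0) \<longrightarrow> x \<in> I)"
proof -
  obtain e' where "eval_hom T e'" using T unfolding evaluable_def by (elim conjE exE)
  then obtain e0 where e0: "eval_hom T e0" "e0 g \<noteq> 0" using evaluable_separates[OF T _ _ g, of e' 1] by auto
  \<comment> \<open>a prime larger than the nonzero value of \<open>g\<close> does not divide it\<close>
  obtain p' :: nat where p': "prime p'" "p' > nat \<bar>e0 g\<bar>" using bigger_prime by blast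
  define p where "p = int p'"
  have p: "prime p" "p > 0" using p' prime_gt_0_int unfolding p_def by auto
  have pe0: "\<not> p dvd e0 g"
    using p' e0(2) zdvd_imp_le[of p "\<bar>e0 g\<bar>"] unfolding p_def by auto
  define E where "E = {e. eval_hom T e \<and> (\<forall>x\<in>T. p dvd e x - e0 x)}"
  define q where "q = level e0 p 1"
  define L where "L = (\<lambda>(e, u). coord e u) ` (E \<times> U)"
  have E: "eval_hom T e" "\<not> p dvd e g" "e g \<noteq> 0" "level e p 1 = q" if "e \<in> E" for e
  proof -
    show e: "eval_hom T e" using that by (simp add: E_def)
    have c: "p dvd e x - e0 x" if "x \<in> T" for x using that \<open>e \<in> E\<close> by (simp add: E_def)
    show "\<not> p dvd e g" using c[OF gT(1)] pe0 by (metis diff_diff_eq2 diff_add_cancel add_diff_cancel_left' dvd_diff)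
    then show "e g \<noteq> 0" by auto
    show "level e p 1 = q" unfolding q_def by (rule level_cong[OF e e0(1) c])
  qed
  have "interpolating R N I p q (coord e u)" if e: "e \<in> E" and u: "u \<in> U" for e u
    unfolding interpolating_def
  proof (intro conjI ballI allI)
    fix x y assume xy: "x \<in> R" "y \<in> R"
    have "coord e u (x - (0 - y)) = coord e u x - (coord e u 0 - coord e u y)"
      using coord_diff[OF E(1,3)[OF e] u xy(1) subring_diff[OF R subring_0[OF R] xy(2)]]
        coord_diff[OF E(1,3)[OF e] u subring_0[OF R] xy(2)] by simp
    then show "coord e u (x + y) = coord e u x + coord e u y"
      using coord_I[OF E(1,3)[OF e] u ideal_0[OF I]] by simp
  next
    fix x assume "x \<in> I" then show "coord e u x = 0" by (rule coord_I[OF E(1,3)[OF e] u])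
  next
    fix j x assume "x \<in> idpow R N q j"
    then have "x \<in> level e p j" using level_idpow[OF E(1)[OF e] N, of p j] E(4)[OF e] by auto
    then show "pdiv p j (coord e u x)" by (rule level_pdiv[OF p(1) E(1,2)[OF e] _ u])
  qed
  moreover have "x \<in> I" if x: "x \<in> R" "\<forall>l\<in>L. l x = 0" for x
  proof (rule ccontr)
    assume "x \<notin> I"
    obtain s c where r: "rep x s c" using ex_rep[OF x(1)] by (elim exE)
    obtain u where u: "u \<in> U" "c u \<notin> I" using rep_in_I[OF r x(1)] \<open>x \<notin> I\<close> by blast
    then have "c u \<in> T - I" using repD(1)[OF r] by simp
    then obtain e where e: "eval_hom T e" "\<forall>x\<in>T. p dvd e x - e0 x" "e (c u) \<noteq> 0"
      using evaluable_separates[OF T e0(1) p(2)] by blast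
    then have eE: "e \<in> E" by (simp add: E_def)
    have "coord e u x = 0" using x(2) eE u(1) by (force simp: L_def)
    then show False using coord_eq[OF r E(1,3)[OF eE] u(1)] E(3)[OF eE] e(3) by simp
  qed
  moreover have "N \<subseteq> q" unfolding q_def using level_I[OF e0(1)] N by blast
  ultimately show ?thesis
    using p(1) level_ideal[OF e0(1), of p 1] level_finite_index[OF p(1) e0(1) pe0]
    unfolding q_def[symmetric] by (intro exI[of _ p] exI[of _ q] exI[of _ L]) (simp add: L_def split_beta)
qed

end

text \<open>Take for \<open>g\<close> a common denominator of \<open>1\<close>, of the generators of
  \<open>R\<close> and of the pairwise products of elements of \<open>U\<close>. The elements
  that can be written with a power of \<open>g\<close> as denominator then form a subring that
  contains all generators.\<close>

lemma (in coprimary) ex_evaluation_lattice: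
  assumes N: "ideal_in UNIV N" "N \<subseteq> I" and R_gen: "R = adjoins (int_ring N) gs"
  shows "\<exists>T U g. evaluation_lattice R I T U g"
proof -
  note sZ = subring_int_ring[OF N(1)]
  have gs: "set gs \<subseteq> R" and ZR: "int_ring N \<subseteq> R"
    unfolding R_gen using adjoins_gen[OF sZ] adjoins_base[OF sZ] by auto
  obtain T where T: "evaluable T" "\<forall>b\<in>set gs. alg_over T b" using ex_evaluable_subring[OF gs] by (elim exE conjE)
  note sT = evaluable_subring[OF T(1)]
  have 1: "{1} \<subseteq> R" using subring_1[OF R] by simp
  have base: "int_ring N \<subseteq> fracspan T {1}"
  proof
    fix x assume "x \<in> int_ring N"
    then obtain z where z: "x - of_int z \<in> N" unfolding int_ring_def by blast
    show "x \<in> fracspan T {1}"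
      by (rule fracspan_base[OF T(1) _ 1], rule lincombI[where r = "\<lambda>_. of_int z"])
        (use z N(2) subring_of_int[OF sT] in auto)
  qed
  obtain V where V: "finite V" "V \<subseteq> R" "R \<subseteq> fracspan T V"
    using ex_finite_span[OF T(1) sZ ZR _ 1 base gs T(2)] unfolding R_gen[symmetric] by auto
  obtain U where U: "finite U" "U \<subseteq> R" "R \<subseteq> fracspan T U" "indep T U"
    using ex_basis[OF T(1) V] by (elim exE conjE)
  define X where "X = {1} \<union> set gs \<union> (\<lambda>(u, v). u * v) ` (U \<times> U)"
  have X: "finite X" "X \<subseteq> R" unfolding X_def using U(1) 1 gs
    by (auto intro: subring_mult[OF R subsetD[OF U(2)] subsetD[OF U(2)]])
  obtain g where g: "g \<in> T - I" "\<forall>x\<in>X. g * x \<in> lincomb T I U"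
    using ex_denominator[OF T(1) U(1-3) X] by (elim bexE)
  note gp = evaluable_power[OF T(1) g(1)]
  have uv: "g * (u * v) \<in> lincomb T I U" if "u \<in> U" "v \<in> U" for u v using g(2) that by (auto simp: X_def)
  let ?L = "lincomb T I U"
  have LR: "?L \<subseteq> R" by (rule lincomb_R[OF T(1) U(2)])
  have IL: "x \<in> ?L" if "x \<in> I" for x by (rule lincomb_base[OF sT that])
  have prod: "g * (x * y) \<in> ?L" if xy: "x \<in> ?L" "y \<in> ?L" for x y
  proof -
    obtain c c' where c: "\<forall>u\<in>U. c u \<in> T" "x - (\<Sum>u\<in>U. c u * u) \<in> I"
      "\<forall>u\<in>U. c' u \<in> T" "y - (\<Sum>u\<in>U. c' u * u) \<in> I" using xy unfolding lincomb_def by blast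
    have sR: "(\<Sum>u\<in>U. c u * u) \<in> R"
      using c(1) U(2) evaluable_subset[OF T(1)] by (intro subring_sum[OF R] subring_mult[OF R]) auto
    have gR: "g \<in> R" and yR: "y \<in> R" using g(1) evaluable_subset[OF T(1)] xy LR by auto
    have "g * (x * y) = (g * y) * (x - (\<Sum>u\<in>U. c u * u)) + ((g * (\<Sum>u\<in>U. c u * u)) * (y - (\<Sum>u\<in>U. c' u * u))
       + (\<Sum>u\<in>U. \<Sum>v\<in>U. (c u * c' v) * (g * (u * v))))"
    proof -
      have "(\<Sum>u\<in>U. \<Sum>v\<in>U. (c u * c' v) * (g * (u * v))) = g * (\<Sum>u\<in>U. c u * u) * (\<Sum>v\<in>U. c' v * v)"
        by (simp add: sum_product sum_distrib_left mult_ac)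
      then show ?thesis by (simp add: algebra_simps)
    qed
    also have "\<dots> \<in> ?L"
    proof (intro lincomb_add[OF sT I])
      show "(g * y) * (x - (\<Sum>u\<in>U. c u * u)) \<in> ?L"
        by (intro IL ideal_mult[OF I _ c(2)] subring_mult[OF R] gR yR)
      show "(g * (\<Sum>u\<in>U. c u * u)) * (y - (\<Sum>u\<in>U. c' u * u)) \<in> ?L"
        by (intro IL ideal_mult[OF I _ c(4)] subring_mult[OF R] gR sR)
      show "(\<Sum>u\<in>U. \<Sum>v\<in>U. (c u * c' v) * (g * (u * v))) \<in> ?L"
      proof (intro lincomb_sum[OF sT I])
        fix u v assume "u \<in> U" "v \<in> U"
        then show "(c u * c' v) * (g * (u * v)) \<in> ?L"
          using c(1,3) by (intro lc_mult[OF T(1) uv] subring_mult[OF sT]) auto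
      qed
    qed
    finally show ?thesis .
  qed
  define B where "B = {b \<in> R. \<exists>s. g ^ s * b \<in> ?L}"
  have "subring_set B" unfolding subring_set_def
  proof (intro conjI ballI)
    have "g ^ 1 * 1 \<in> ?L" using g(2) by (simp add: X_def)
    then show "1 \<in> B" unfolding B_def using 1 by blast
  next
    fix x y assume "x \<in> B" "y \<in> B"
    then obtain s t where st: "x \<in> R" "g ^ s * x \<in> ?L" "y \<in> R" "g ^ t * y \<in> ?L" unfolding B_def by blast
    have gT: "g ^ n \<in> T" for n using gp by simp
    have "g ^ t * (g ^ s * x) + (- (g ^ s)) * (g ^ t * y) \<in> ?L"
      by (rule lincomb_add[OF sT I lc_mult[OF T(1) st(2) gT] lc_mult[OF T(1) st(4) subring_uminus[OF sT gT]]])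
    then have "g ^ (s + t) * (x - y) \<in> ?L" by (simp add: power_add algebra_simps)
    then show "x - y \<in> B" unfolding B_def using subring_diff[OF R st(1,3)] by blast
    have "g ^ (s + t + 1) * (x * y) \<in> ?L" using prod[OF st(2,4)] by (simp add: power_add mult_ac)
    then show "x * y \<in> B" unfolding B_def using subring_mult[OF R st(1,3)] by blast
  qed
  moreover have "int_ring N \<subseteq> B"
  proof
    fix x assume x: "x \<in> int_ring N"
    then obtain z where z: "x - of_int z \<in> N" unfolding int_ring_def by blast
    have gR: "g \<in> R" and zI: "x - of_int z \<in> I" and g1: "g * 1 \<in> ?L"
      using g evaluable_subset[OF T(1)] z N(2) by (auto simp: X_def)
    have "g * (x - of_int z) + of_int z * (g * 1) \<in> ?L"
      by (rule lincomb_add[OF sT I IL[OF ideal_mult[OF I gR zI]] lc_mult[OF T(1) g1 subring_of_int[OF sT]]])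
    then have "g ^ 1 * x \<in> ?L" by (simp add: algebra_simps)
    then show "x \<in> B" unfolding B_def using x ZR by blast
  qed
  moreover have "set gs \<subseteq> B"
  proof
    fix x assume x: "x \<in> set gs"
    then have "g ^ 1 * x \<in> ?L" using g(2) by (simp add: X_def)
    then show "x \<in> B" unfolding B_def using x gs by blast
  qed
  ultimately have "R \<subseteq> B" unfolding R_gen by (rule adjoins_subset)
  then have "\<exists>s. g ^ s * b \<in> ?L" if "b \<in> R" for b using that unfolding B_def by blast
  then have "evaluation_lattice R I T U g"
    by unfold_locales (use T(1) U g(1) uv in auto)
  then show ?thesis by (intro exI)
qed

theorem (in coprimary) ex_interpolation:
  assumes N: "ideal_in UNIV N" "N \<subseteq> I" and R_gen: "R = adjoins (int_ring N) gs"
  shows "\<exists>p q L. prime p \<and> ideal_in R q \<and> N \<subseteq> q \<and> finite_index R q \<and>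
    (\<forall>l\<in>L. interpolating R N I p q l) \<and> (\<forall>x\<in>R. (\<forall>l\<in>L. l x = 0) \<longrightarrow> x \<in> I)"
proof -
  obtain T U g where "evaluation_lattice R I T U g" using ex_evaluation_lattice[OF assms] by (elim exE)
  then show ?thesis by (rule evaluation_lattice.interpolation[OF _ N(2)])
qed

section \<open>Automorphisms and powers of an ideal of finite index\<close>

lemma idprod_least:
  assumes "ideal_in R J" "N \<subseteq> J" "\<And>a b. a \<in> A \<Longrightarrow> b \<in> B \<Longrightarrow> a * b \<in> J"
  shows "idprod N A B \<subseteq> J"
proof
  fix x assume "x \<in> idprod N A B"
  then show "x \<in> J" by induction (use assms(2,3) ideal_add[OF assms(1)] in auto)
qed

lemma idprod_mem: "0 \<in> N \<Longrightarrow> a \<in> A \<Longrightarrow> b \<in> B \<Longrightarrow> a * b \<in> idprod N A B"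
  using idprod.step[OF idprod.base[of 0 N A B], of a b] by simp

lemma idprod_ideal:
  assumes R: "subring_set R" and N: "ideal_in R N" and A: "ideal_in R A" and B: "ideal_in R B"
  shows "ideal_in R (idprod N A B)"
proof -
  have RR: "ideal_in R R" using R by (auto simp: ideal_in_def subring_set_closed)
  show ?thesis unfolding ideal_in_def
  proof (intro conjI ballI)
    show "idprod N A B \<subseteq> R"
      by (rule idprod_least[OF RR]) (auto intro: ideal_sub[OF N] subring_mult[OF R] ideal_sub[OF A] ideal_sub[OF B])
    show "0 \<in> idprod N A B" by (rule idprod.base[OF ideal_0[OF N]])
  next
    fix x y assume x: "x \<in> idprod N A B" and "y \<in> idprod N A B"
    from this(2) show "x + y \<in> idprod N A B"
    proof induction
      case (base y)
      from x show ?case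
      proof induction
        case (base x)
        then show ?case using ideal_add[OF N] \<open>y \<in> N\<close> by (intro idprod.base)
      next
        case (step z a b)
        have "(z + y) + a * b \<in> idprod N A B" by (rule idprod.step[OF step.IH step.hyps(2,3)])
        then show ?case by (simp add: add_ac)
      qed
    next
      case (step z a b)
      have "(x + z) + a * b \<in> idprod N A B" by (rule idprod.step[OF step.IH step.hyps(2,3)])
      then show ?case by (simp add: add_ac)
    qed
  next
    fix r x assume r: "r \<in> R" and "x \<in> idprod N A B"
    from this(2) show "r * x \<in> idprod N A B"
    proof induction
      case (base x)
      then show ?case using ideal_mult[OF N r] by (intro idprod.base)
    next
      case (step z a b)
      have "r * z + (r * a) * b \<in> idprod N A B"
        by (rule idprod.step[OF step.IH ideal_mult[OF A r step.hyps(2)] step.hyps(3)])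
      then show ?case by (simp add: algebra_simps)
    qed
  qed
qed

text \<open>With generators \<open>s\<close> of \<open>J\<close>, any \<open>b\<close> is \<open>v +
  \<Sum>s. r s * s\<close> with \<open>v\<close> among finitely many representatives modulo
  \<open>J\<close>, and modulo the product each \<open>r s\<close> may be replaced by a
  representative modulo \<open>A\<close>.\<close>

lemma finite_index_idprod:
  assumes R: "subring_set R" and N: "ideal_in R N" and noeth: "noeth R N"
    and A: "ideal_in R A" "finite_index R A" and J: "ideal_in R J" "N \<subseteq> J" "finite_index R J"
  shows "finite_index R (idprod N A J)"
proof -
  obtain V where V: "finite V" "V \<subseteq> R" "\<forall>b\<in>R. \<exists>v\<in>V. b - v \<in> A" using A(2) unfolding finite_index_def by (elim exE conjE)
  obtain W where W: "finite W" "W \<subseteq> R" "\<forall>b\<in>R. \<exists>v\<in>W. b - v \<in> J" using J(3) unfolding finite_index_def by (elim exE conjE)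
  obtain S where S: "finite S" "S \<subseteq> J" "J \<subseteq> lincomb R N S" by (rule noethE[OF noeth J(1,2)])
  note K = idprod_ideal[OF R N A(1) J(1)]
  have SR: "S \<subseteq> R" using S(2) ideal_sub[OF J(1)] by blast
  define X where "X = (\<lambda>(v, w). v + (\<Sum>s\<in>S. w s * s)) ` (W \<times> (S \<rightarrow>\<^sub>E V))"
  have "finite X" unfolding X_def
    by (intro finite_imageI finite_cartesian_product W(1) finite_PiE S(1) V(1))
  moreover have "X \<subseteq> R"
  proof -
    have "v + (\<Sum>s\<in>S. w s * s) \<in> R" if "v \<in> W" "w \<in> S \<rightarrow>\<^sub>E V" for v w
    proof (intro subring_add[OF R] subring_sum[OF R] subring_mult[OF R])
      show "v \<in> R" using that W(2) by blast
      fix s assume "s \<in> S"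
      then show "w s \<in> R" "s \<in> R" using that V(2) SR by auto
    qed
    then show ?thesis unfolding X_def by auto
  qed
  moreover have "\<exists>v\<in>X. b - v \<in> idprod N A J" if b: "b \<in> R" for b
  proof -
    obtain v where v: "v \<in> W" "b - v \<in> J" using W(3) b by blast
    then have "b - v \<in> lincomb R N S" using S(3) by blast
    then obtain r where r: "\<forall>s\<in>S. r s \<in> R" "(b - v) - (\<Sum>s\<in>S. r s * s) \<in> N" unfolding lincomb_def by blast
    have "\<forall>s\<in>S. \<exists>w. w \<in> V \<and> r s - w \<in> A" using r(1) V(3) by blast
    then obtain w where w: "\<forall>s\<in>S. w s \<in> V \<and> r s - w s \<in> A" by (rule bchoice[THEN exE])
    define w' where "w' = restrict w S"
    have w': "w' \<in> S \<rightarrow>\<^sub>E V" "\<And>s. s \<in> S \<Longrightarrow> r s - w' s \<in> A" using w by (auto simp: w'_def)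
    have "(b - v) - (\<Sum>s\<in>S. r s * s) + (\<Sum>s\<in>S. (r s - w' s) * s) \<in> idprod N A J"
      using S(2) by (intro ideal_add[OF K] ideal_sum[OF K] idprod.base r(2) idprod_mem[OF ideal_0[OF N]] w'(2)) auto
    then have "b - (v + (\<Sum>s\<in>S. w' s * s)) \<in> idprod N A J"
      by (simp add: left_diff_distrib sum_subtractf algebra_simps)
    moreover have "v + (\<Sum>s\<in>S. w' s * s) \<in> X" unfolding X_def using v(1) w'(1) by auto
    ultimately show ?thesis by (intro bexI)
  qed
  ultimately show ?thesis unfolding finite_index_def by (intro exI[of _ X]) simp
qed

lemma sum_binomial_Suc:
  fixes a :: "nat \<Rightarrow> rat"
  shows "(\<Sum>j\<le>Suc n. of_nat (Suc n choose j) * a j) =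
    (\<Sum>j\<le>n. of_nat (n choose j) * a j) + (\<Sum>j\<le>n. of_nat (n choose j) * a (Suc j))"
proof -
  have "(\<Sum>j\<le>n. of_nat (n choose j) * a j) = (\<Sum>j\<le>Suc n. of_nat (n choose j) * a j)" by simp
  also have "\<dots> = a 0 + (\<Sum>j\<le>n. of_nat (n choose Suc j) * a (Suc j))"
    by (subst sum.atMost_Suc_shift) simp
  finally show ?thesis
    by (subst sum.atMost_Suc_shift) (simp add: sum.distrib algebra_simps)
qed

text \<open>On every residue class modulo \<open>k\<close> the set is finite or full.\<close>

definition eventually_periodic :: "int set \<Rightarrow> bool" where
  "eventually_periodic S \<longleftrightarrow>
     (\<exists>k>0. \<forall>m. infinite {n. m + k * n \<in> S} \<longrightarrow> (\<forall>n. m + k * n \<in> S))"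

lemma eventually_periodic_UNIV: "eventually_periodic UNIV"
  unfolding eventually_periodic_def by (intro exI[of _ 1]) simp

lemma eventually_periodic_Int:
  assumes "eventually_periodic S" "eventually_periodic S'" shows "eventually_periodic (S \<inter> S')"
proof -
  obtain k where k: "k > 0" "\<And>m. infinite {n. m + k * n \<in> S} \<Longrightarrow> \<forall>n. m + k * n \<in> S"
    using assms(1) unfolding eventually_periodic_def by blast
  obtain l where l: "l > 0" "\<And>m. infinite {n. m + l * n \<in> S'} \<Longrightarrow> \<forall>n. m + l * n \<in> S'"
    using assms(2) unfolding eventually_periodic_def by blast
  have *: "m + k * l * n \<in> S \<inter> S'" if inf: "infinite {n. m + k * l * n \<in> S \<inter> S'}" for m n
  proof -
    have "(\<lambda>n. l * n) ` {n. m + k * l * n \<in> S \<inter> S'} \<subseteq> {n. m + k * n \<in> S}" by (auto simp: mult.assoc)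
    moreover have "infinite ((\<lambda>n. l * n) ` {n. m + k * l * n \<in> S \<inter> S'})"
      using inf l(1) by (subst finite_image_iff) (auto simp: inj_on_def)
    ultimately have "infinite {n. m + k * n \<in> S}" using infinite_super by blast
    then have 1: "m + k * (l * n) \<in> S" using k(2) by blast
    have "(\<lambda>n. k * n) ` {n. m + k * l * n \<in> S \<inter> S'} \<subseteq> {n. m + l * n \<in> S'}" by (auto simp: mult_ac)
    moreover have "infinite ((\<lambda>n. k * n) ` {n. m + k * l * n \<in> S \<inter> S'})"
      using inf k(1) by (subst finite_image_iff) (auto simp: inj_on_def)
    ultimately have "infinite {n. m + l * n \<in> S'}" using infinite_super by blast
    then have 2: "m + l * (k * n) \<in> S'" using l(2) by blast
    show ?thesis using 1 2 by (simp add: mult_ac)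
  qed
  show ?thesis unfolding eventually_periodic_def
  proof (intro exI conjI allI impI)
    show "k * l > 0" using k(1) l(1) by simp
    show "m + k * l * n \<in> S \<inter> S'" if "infinite {n. m + k * l * n \<in> S \<inter> S'}" for m n
      using that by (rule *)
  qed
qed

lemma eventually_periodic_INT:
  assumes "finite A" "\<And>a. a \<in> A \<Longrightarrow> eventually_periodic (S a)" shows "eventually_periodic (\<Inter>a\<in>A. S a)"
  using assms by (induction A rule: finite_induct) (simp_all add: eventually_periodic_UNIV eventually_periodic_Int)

text \<open>The maps \<open>L n\<close> are the powers of an automorphism of the quotient of
  \<open>R\<close> by \<open>N\<close>, lifted to \<open>R\<close> as mere maps; all algebraic
  laws hold modulo \<open>N\<close>.\<close>

locale dynamics =
  fixes R N :: "'a::comm_ring_1 set" and gs :: "'a list" and L :: "int \<Rightarrow> 'a \<Rightarrow> 'a"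
  assumes N: "ideal_in UNIV N" and R_gen: "R = adjoins (int_ring N) gs"
    and L_R: "\<And>n x. x \<in> R \<Longrightarrow> L n x \<in> R"
    and L_1: "\<And>n. L n 1 - 1 \<in> N"
    and L_diff: "\<And>n x y. x \<in> R \<Longrightarrow> y \<in> R \<Longrightarrow> L n (x - y) - (L n x - L n y) \<in> N"
    and L_mult: "\<And>n x y. x \<in> R \<Longrightarrow> y \<in> R \<Longrightarrow> L n (x * y) - L n x * L n y \<in> N"
    and L_N: "\<And>n x. x \<in> N \<Longrightarrow> L n x \<in> N"
    and L_0: "\<And>x. x \<in> R \<Longrightarrow> L 0 x - x \<in> N"
    and L_add: "\<And>m n x. x \<in> R \<Longrightarrow> L (m + n) x - L m (L n x) \<in> N"
begin

lemma R: "subring_set R"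
  unfolding R_gen by (rule subring_adjoins[OF subring_int_ring[OF N]])

lemma ZR: "int_ring N \<subseteq> R" and gsR: "set gs \<subseteq> R"
  unfolding R_gen
  by (rule adjoins_base[OF subring_int_ring[OF N]], rule adjoins_gen[OF subring_int_ring[OF N]])

lemma NR: "N \<subseteq> R"
  using int_ring_sub[OF N] ZR by blast

lemma N': "ideal_in R N"
  by (rule ideal_in_subring[OF N NR])

lemma noeth: "noeth R N"
  unfolding R_gen by (rule noeth_adjoins[OF subring_int_ring[OF N] N int_ring_sub[OF N] noeth_int_ring[OF N]])

lemmas N_diff = ideal_diff[OF subring_UNIV N] and N_add = ideal_add[OF N] and N_mult = ideal_mult[OF N UNIV_I]

lemma L_cong:
  assumes "x \<in> R" "y \<in> R" "x - y \<in> N" shows "L n x - L n y \<in> N"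
  using N_diff[OF L_N[OF assms(3), of n] L_diff[OF assms(1,2), of n]] by simp

text \<open>A homomorphism from \<open>R\<close> to the finite ring of residues modulo \<open>M\<close>
  is determined by its values on the finitely many generators. So two of the homomorphisms
  induced by \<open>L 0\<close>, \<open>L 1\<close>, \<open>L 2\<close>, and so on, coincide.\<close>

lemma ex_period:
  assumes M: "ideal_in R M" "N \<subseteq> M" "finite_index R M"
  shows "\<exists>k>0. \<forall>y\<in>R. L k y - y \<in> M"
proof -
  obtain V where V: "finite V" "\<forall>b\<in>R. \<exists>v\<in>V. b - v \<in> M"
    using M(3) unfolding finite_index_def by (elim exE conjE)
  define r where "r b = (SOME v. v \<in> V \<and> b - v \<in> M)" for b
  have r: "r b \<in> V \<and> b - r b \<in> M" if "b \<in> R" for b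
    unfolding r_def by (rule someI_ex) (use V(2) that in blast)
  define f where "f n = map (\<lambda>g. r (L (int n) g)) gs" for n :: nat
  have "range f \<subseteq> {xs. set xs \<subseteq> V \<and> length xs = length gs}"
  proof -
    have "r (L n g) \<in> V" if "g \<in> set gs" for n g using r[OF L_R[OF subsetD[OF gsR that]]] by simp
    then show ?thesis by (auto simp: f_def)
  qed
  then have "finite (range f)" by (rule finite_subset[OF _ finite_lists_length_eq[OF V(1)]])
  then have "\<not> inj f" using finite_imageD[of f UNIV] by auto
  then obtain a b where ab: "f a = f b" "a \<noteq> b" unfolding inj_def by blast
  define m n where "m = int (min a b)" and "n = int (max a b)"
  have mn: "m < n" using ab(2) by (simp add: m_def n_def)
  have fmn: "f (nat m) = f (nat n)" using ab(1) by (auto simp: m_def n_def min_def max_def)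
  have dM: "x - y \<in> M" if "x \<in> M" "y \<in> M" for x y by (rule ideal_diff[OF R M(1) that])
  have aM: "x + y \<in> M" if "x \<in> M" "y \<in> M" for x y by (rule ideal_add[OF M(1) that])
  define B where "B = {x \<in> R. L m x - L n x \<in> M}"
  have B: "subring_set B"
    unfolding subring_set_def
  proof (intro conjI ballI)
    have "(L m 1 - 1) - (L n 1 - 1) \<in> M" by (rule dM[OF subsetD[OF M(2) L_1] subsetD[OF M(2) L_1]])
    then show "1 \<in> B" unfolding B_def using subring_1[OF R] by simp
  next
    fix x y assume "x \<in> B" "y \<in> B"
    then have xy: "x \<in> R" "L m x - L n x \<in> M" "y \<in> R" "L m y - L n y \<in> M" by (auto simp: B_def)
    have "((L m x - L n x) - (L m y - L n y)) + ((L m (x - y) - (L m x - L m y)) - (L n (x - y) - (L n x - L n y))) \<in> M"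
      by (rule aM[OF dM[OF xy(2,4)] dM[OF subsetD[OF M(2) L_diff[OF xy(1,3)]] subsetD[OF M(2) L_diff[OF xy(1,3)]]]])
    then show "x - y \<in> B" unfolding B_def using subring_diff[OF R xy(1,3)] by (simp add: algebra_simps)
    have "L m x * (L m y - L n y) + L n y * (L m x - L n x) \<in> M"
      by (intro aM ideal_mult[OF M(1)] L_R xy)
    then have "(L m x * (L m y - L n y) + L n y * (L m x - L n x)) + ((L m (x * y) - L m x * L m y) - (L n (x * y) - L n x * L n y)) \<in> M"
      by (rule aM[OF _ dM[OF subsetD[OF M(2) L_mult[OF xy(1,3)]] subsetD[OF M(2) L_mult[OF xy(1,3)]]]])
    then show "x * y \<in> B" unfolding B_def using subring_mult[OF R xy(1,3)] by (simp add: algebra_simps)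
  qed
  have "int_ring N \<subseteq> B"
  proof
    fix x assume x: "x \<in> int_ring N"
    then obtain z where z: "x - of_int z \<in> N" unfolding int_ring_def by blast
    have xR: "x \<in> R" and zR: "of_int z \<in> R" using x ZR subring_of_int[OF R] by auto
    have "L m (of_int z) - L n (of_int z) \<in> M" using subring_of_int[OF B, of z] by (simp add: B_def)
    then have "(L m (of_int z) - L n (of_int z)) + ((L m x - L m (of_int z)) - (L n x - L n (of_int z))) \<in> M"
      by (rule aM[OF _ dM[OF subsetD[OF M(2) L_cong[OF xR zR z]] subsetD[OF M(2) L_cong[OF xR zR z]]]])
    then show "x \<in> B" using xR by (simp add: B_def algebra_simps)
  qed
  moreover have "set gs \<subseteq> B"
  proof
    fix g assume g: "g \<in> set gs"
    then have gR: "g \<in> R" using gsR by blast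
    have "r (L m g) = r (L n g)" using fmn g by (auto simp: f_def m_def n_def)
    then have "L m g - r (L m g) \<in> M" "L n g - r (L m g) \<in> M"
      using r[OF L_R[OF gR, of m]] r[OF L_R[OF gR, of n]] by simp_all
    then have "(L m g - r (L m g)) - (L n g - r (L m g)) \<in> M" by (rule dM)
    then show "g \<in> B" using gR by (simp add: B_def)
  qed
  ultimately have RB: "R \<subseteq> B" unfolding R_gen by (rule adjoins_subset[OF B])
  have "L (n - m) y - y \<in> M" if y: "y \<in> R" for y
  proof -
    \<comment> \<open>applying the coincidence of \<open>L m\<close> and \<open>L n\<close> to this
      element shifts the exponents by \<open>- m\<close>\<close>
    define x where "x = L (- m) y"
    have "x \<in> R" unfolding x_def by (rule L_R[OF y])
    then have 1: "L m x - L n x \<in> M" using RB by (auto simp: B_def)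
    have 2: "L (n - m) y - L n x \<in> M" using L_add[OF y, of n "- m"] M(2) by (auto simp: x_def)
    have 3: "L 0 y - L m x \<in> M" using L_add[OF y, of m "- m"] M(2) by (auto simp: x_def)
    have 4: "L 0 y - y \<in> M" using L_0[OF y] M(2) by auto
    have "(L (n - m) y - L n x) - (L m x - L n x) + (L 0 y - y) - (L 0 y - L m x) \<in> M"
      by (rule dM[OF aM[OF dM[OF 2 1] 4] 3])
    then show ?thesis by (simp add: algebra_simps)
  qed
  then show ?thesis using mn by (intro exI[of _ "n - m"]) simp
qed

context
  fixes q assumes q: "ideal_in R q" "N \<subseteq> q"
begin

abbreviation "Q \<equiv> idpow R N q"

lemma Q_ideal: "ideal_in R (Q j)" and Q_N: "N \<subseteq> Q j"
proof -
  have "ideal_in R (Q j) \<and> N \<subseteq> Q j"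
  proof (induction j)
    case 0
    then show ?case using R NR by (auto simp: ideal_in_def subring_set_closed)
  next
    case (Suc j)
    then show ?case using idprod_ideal[OF R N' q(1), of "Q j"] by (auto simp: idpow.simps(2) intro: idprod.base)
  qed
  then show "ideal_in R (Q j)" "N \<subseteq> Q j" by auto
qed

lemma Q_Suc: "Q (Suc j) \<subseteq> Q j"
  unfolding idpow.simps
  by (rule idprod_least[OF Q_ideal Q_N]) (auto intro: ideal_mult[OF Q_ideal] ideal_sub[OF q(1)])

lemma Q_q_mult: "a \<in> q \<Longrightarrow> b \<in> Q j \<Longrightarrow> a * b \<in> Q (Suc j)"
  by (simp add: idpow.simps(2) idprod_mem ideal_0[OF N])

lemma Q_mult:
  assumes y: "y \<in> Q j" shows "x \<in> Q i \<Longrightarrow> x * y \<in> Q (i + j)"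
proof (induction i arbitrary: x)
  case 0
  then show ?case using ideal_mult[OF Q_ideal _ y] by simp
next
  case (Suc i)
  from Suc.prems have "x \<in> idprod N q (Q i)" by (simp add: idpow.simps(2))
  then show ?case
  proof induction
    case (base x)
    then have "x * y \<in> N" by (rule ideal_mult2[OF N UNIV_I])
    then show ?case using Q_N by blast
  next
    case (step z a b)
    have "z * y + a * (b * y) \<in> Q (Suc (i + j))"
      using step.IH Q_q_mult[OF step.hyps(2) Suc.IH[OF step.hyps(3)]] by (intro ideal_add[OF Q_ideal]) simp_all
    then show ?case by (simp add: algebra_simps)
  qed
qed

lemma Q_finite_index:
  assumes "finite_index R q" shows "finite_index R (Q j)"
proof (induction j)
  case 0
  show ?case unfolding finite_index_def
    by (rule exI[of _ "{0}"]) (simp add: subring_0[OF R])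
next
  case (Suc j)
  show ?case unfolding idpow.simps
    by (rule finite_index_idprod[OF R N' noeth q(1) assms Q_ideal Q_N Suc.IH])
qed

context
  fixes k assumes k: "\<And>y. y \<in> R \<Longrightarrow> L k y - y \<in> Q 3"
begin

text \<open>The difference \<open>\<Delta> = L k - 1\<close> obeys \<open>\<Delta> (a b) = \<Delta> a
  \<sqdot> L k b + a \<sqdot> \<Delta> b\<close> modulo \<open>N\<close>. For \<open>a\<close>
  in \<open>q\<close> the first summand gains two powers of \<open>q\<close> because
  \<open>\<Delta> a\<close> lies in \<open>q\<^sup>3\<close>, and the second one gains them by
  induction.\<close>

lemma difference_Q: "x \<in> Q j \<Longrightarrow> L k x - x \<in> Q (j + 2)"
proof (induction j arbitrary: x)
  case 0
  then have "L k x - x \<in> Q (Suc (Suc (Suc 0)))" using k by (simp add: numeral_3_eq_3)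
  then show ?case using Q_Suc[of "Suc (Suc 0)"] by auto
next
  case (Suc j)
  let ?Q = "Q (Suc j + 2)"
  note Qa = ideal_add[OF Q_ideal[of "Suc j + 2"]]
  from Suc.prems have "x \<in> idprod N q (Q j)" by (simp add: idpow.simps(2))
  then show ?case
  proof induction
    case (base x)
    then have "L k x - x \<in> N" by (intro N_diff L_N)
    then show ?case using Q_N by blast
  next
    case (step z a b)
    have aR: "a \<in> R" by (rule ideal_sub[OF q(1) step.hyps(2)])
    have bR: "b \<in> R" by (rule ideal_sub[OF Q_ideal step.hyps(3)])
    have abR: "a * b \<in> R" by (rule subring_mult[OF R aR bR])
    have zR: "z \<in> R" using step.hyps(1) idprod_ideal[OF R N' q(1) Q_ideal[of j]] ideal_sub by blast
    have db: "L k b - b \<in> Q (j + 2)" by (rule Suc.IH[OF step.hyps(3)])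
    have "Q (j + 2) \<subseteq> Q j" using Q_Suc[of j] Q_Suc[of "Suc j"] by auto
    then have "(L k b - b) + b \<in> Q j" using db step.hyps(3) by (intro ideal_add[OF Q_ideal]) auto
    then have "(L k a - a) * L k b \<in> Q (3 + j)" by (intro Q_mult k aR) simp
    moreover have "3 + j = Suc j + 2" by simp
    ultimately have 1: "(L k a - a) * L k b \<in> ?Q" by metis
    have 2: "a * (L k b - b) \<in> ?Q" using Q_q_mult[OF step.hyps(2) db] by simp
    have 3: "L k (a * b) - L k a * L k b \<in> ?Q" using L_mult[OF aR bR] Q_N by blast
    have "(L k (z + a * b - a * b) - (L k (z + a * b) - L k (a * b))) \<in> N"
      by (rule L_diff[OF subring_add[OF R zR abR] abR])
    then have "L k z - (L k (z + a * b) - L k (a * b)) \<in> N" by simp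
    then have "- (L k z - (L k (z + a * b) - L k (a * b))) \<in> N" by (rule ideal_uminus[OF subring_UNIV N])
    then have 4: "- (L k z - (L k (z + a * b) - L k (a * b))) \<in> ?Q" using Q_N by blast
    have "(- (L k z - (L k (z + a * b) - L k (a * b)))) + (L k z - z) + (L k (a * b) - L k a * L k b)
       + (L k a - a) * L k b + a * (L k b - b) \<in> ?Q"
      by (intro Qa 1 2 3 4 step.IH)
    then show ?case by (simp add: algebra_simps)
  qed
qed

context
  fixes I p l
  assumes I: "N \<subseteq> I" and p: "prime p" and l: "interpolating R N I p q l"
begin

definition diff_op where "diff_op x = L k x - x"

lemma diff_op_R: "x \<in> R \<Longrightarrow> diff_op x \<in> R"
  unfolding diff_op_def by (intro subring_diff[OF R] L_R)

lemma diff_op_Q: "x \<in> R \<Longrightarrow> (diff_op ^^ j) x \<in> Q (2 * j)"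
proof (induction j)
  case (Suc j)
  show ?case using difference_Q[OF Suc.IH[OF Suc.prems]] by (simp add: diff_op_def)
qed simp

lemma l_add: "x \<in> R \<Longrightarrow> y \<in> R \<Longrightarrow> l (x + y) = l x + l y"
  and l_N: "x \<in> N \<Longrightarrow> l x = 0"
  and l_Q: "x \<in> Q j \<Longrightarrow> pdiv p j (l x)"
  using l I unfolding interpolating_def by auto

lemma l_cong: "x \<in> R \<Longrightarrow> y \<in> R \<Longrightarrow> x - y \<in> N \<Longrightarrow> l x = l y"
  using l_add[of "x - y" y] l_N[of "x - y"] NR by auto

text \<open>Newton's forward difference formula, obtained from the congruence of \<open>L (k * (n + 1))
  x\<close> and \<open>L (k * n) x + L (k * n) (\<Delta> x)\<close> modulo \<open>N\<close>.\<close>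

lemma Newton_expansion:
  "x \<in> R \<Longrightarrow> l (L (k * int n) x) = (\<Sum>j\<le>n. of_nat (n choose j) * l ((diff_op ^^ j) x))"
proof (induction n arbitrary: x)
  case 0
  then have x: "x \<in> R" .
  show ?case using l_cong[OF L_R[OF x] x L_0[OF x]] by simp
next
  case (Suc n)
  let ?m = "k * int n"
  note dR = diff_op_R[OF Suc.prems]
  have LkR: "L k x \<in> R" by (rule L_R[OF Suc.prems])
  have "l (L (k * int (Suc n)) x) = l (L (?m + k) x)" by (simp add: algebra_simps)
  also have "\<dots> = l (L ?m (L k x))" by (rule l_cong[OF L_R[OF Suc.prems] L_R[OF LkR] L_add[OF Suc.prems]])
  also have "\<dots> = l (L ?m x + L ?m (diff_op x))"
  proof (rule l_cong[OF L_R[OF LkR] subring_add[OF R L_R[OF Suc.prems] L_R[OF dR]]])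
    have "L ?m (L k x - x) - (L ?m (L k x) - L ?m x) \<in> N" by (rule L_diff[OF LkR Suc.prems])
    from ideal_uminus[OF subring_UNIV N this]
    show "L ?m (L k x) - (L ?m x + L ?m (diff_op x)) \<in> N" by (simp add: diff_op_def algebra_simps)
  qed
  also have "\<dots> = l (L ?m x) + l (L ?m (diff_op x))" by (rule l_add[OF L_R[OF Suc.prems] L_R[OF dR]])
  also have "\<dots> = (\<Sum>j\<le>n. of_nat (n choose j) * l ((diff_op ^^ j) x)) +
      (\<Sum>j\<le>n. of_nat (n choose j) * l ((diff_op ^^ Suc j) x))"
    unfolding Suc.IH[OF Suc.prems] Suc.IH[OF dR] by (simp add: funpow_swap1)
  also have "\<dots> = (\<Sum>j\<le>Suc n. of_nat (Suc n choose j) * l ((diff_op ^^ j) x))"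
    by (rule sum_binomial_Suc[symmetric])
  finally show ?case .
qed

lemma vanishing:
  assumes x: "x \<in> R" and inf: "infinite {n::nat. l (L (k * int n) x) = 0}"
  shows "l x = 0"
proof -
  have "l (L (k * int 0) x) = 0"
    by (rule Skolem_Hansel[OF p _ _ inf, where d = "\<lambda>j. l ((diff_op ^^ j) x)"])
      (use Newton_expansion[OF x] l_Q[OF diff_op_Q[OF x]] in auto)
  then show ?thesis using l_cong[OF L_R[OF x] x L_0[OF x]] by simp
qed

end

end

end

text \<open>An infinite subset of a residue class modulo \<open>k\<close> is infinite to the right or to
  the left of each of its members. As \<open>L k\<close> and \<open>L (- k)\<close> are both
  the identity modulo \<open>q\<^sup>3\<close>, the vanishing criterion applies in both
  directions from every starting point of the class.\<close>

lemma eventually_periodic_coprimary: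
  assumes "coprimary R I" "N \<subseteq> I" and f: "f \<in> R"
  shows "eventually_periodic {n. L n f \<in> I}"
proof -
  have I: "ideal_in R I" using assms(1) by (rule coprimary.I)
  obtain p q Lam where q: "prime p" "ideal_in R q" "N \<subseteq> q" "finite_index R q"
    and l: "\<forall>l\<in>Lam. interpolating R N I p q l" "\<forall>x\<in>R. (\<forall>l\<in>Lam. l x = 0) \<longrightarrow> x \<in> I"
    using coprimary.ex_interpolation[OF assms(1) N assms(2) R_gen] by (elim exE conjE)
  note Qi = Q_ideal[OF q(2,3)] and QN = Q_N[OF q(2,3)]
  obtain k where k: "k > 0" "\<forall>y\<in>R. L k y - y \<in> idpow R N q 3"
    using ex_period[OF Qi QN Q_finite_index[OF q(2-4)], of 3] by (elim exE conjE)
  have k': "L (- k) y - y \<in> idpow R N q 3" if y: "y \<in> R" for y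
  proof -
    note z = L_R[OF y, of "- k"]
    have "(L 0 y - y) - (L 0 y - L k (L (- k) y)) - (L k (L (- k) y) - L (- k) y) \<in> idpow R N q 3"
    proof (rule ideal_diff[OF R Qi ideal_diff[OF R Qi]])
      show "L 0 y - y \<in> idpow R N q 3" using L_0[OF y] QN by blast
      show "L 0 y - L k (L (- k) y) \<in> idpow R N q 3" using L_add[OF y, of k "- k"] QN by auto
      show "L k (L (- k) y) - L (- k) y \<in> idpow R N q 3" using k(2) z by blast
    qed
    then show ?thesis by (simp)
  qed
  have van: "x \<in> I" if x: "x \<in> R" and inf: "infinite {n::nat. L (c * int n) x \<in> I}" and c: "c \<in> {k, - k}" for x c
  proof -
    have c3: "\<And>y. y \<in> R \<Longrightarrow> L c y - y \<in> idpow R N q 3" using c k(2) k' by blast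
    have "l x = 0" if lL: "l \<in> Lam" for l
    proof (rule vanishing[OF q(2,3) c3 assms(2) q(1) _ x])
      show li: "interpolating R N I p q l" using l(1) lL by blast
      have "{n::nat. L (c * int n) x \<in> I} \<subseteq> {n::nat. l (L (c * int n) x) = 0}"
        using li by (auto simp: interpolating_def)
      then show "infinite {n::nat. l (L (c * int n) x) = 0}" using inf infinite_super by blast
    qed
    then show ?thesis using l(2) x by blast
  qed
  have *: "L (m + k * n0) f \<in> I" if inf: "infinite {n. m + k * n \<in> {n. L n f \<in> I}}" for m n0
  proof -
    define A where "A = {n. L (m + k * n) f \<in> I}"
    have "A \<subseteq> (\<lambda>n. n0 + int n) ` {n. n0 + int n \<in> A} \<union> (\<lambda>n. n0 - int n) ` {n. n0 - int n \<in> A}"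
    proof
      fix a assume a: "a \<in> A"
      show "a \<in> (\<lambda>n. n0 + int n) ` {n. n0 + int n \<in> A} \<union> (\<lambda>n. n0 - int n) ` {n. n0 - int n \<in> A}"
      proof (cases "a \<ge> n0")
        case True
        then show ?thesis using a by (intro UnI1 image_eqI[of _ _ "nat (a - n0)"]) auto
      next
        case False
        then show ?thesis using a by (intro UnI2 image_eqI[of _ _ "nat (n0 - a)"]) auto
      qed
    qed
    moreover have "infinite A" using inf by (simp add: A_def)
    ultimately have "infinite {n. n0 + int n \<in> A} \<or> infinite {n. n0 - int n \<in> A}"
      by (meson finite_UnI finite_imageI finite_subset)
    moreover have tr: "L (c * int n) (L (m + k * n0) f) \<in> I" if "L (c * int n + (m + k * n0)) f \<in> I" for c n
      using that ideal_cong[OF R I, of "L (c * int n + (m + k * n0)) f" "L (c * int n) (L (m + k * n0) f)"] L_add[OF f] assms(2) by blast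
    ultimately show ?thesis
    proof (elim disjE)
      assume inf: "infinite {n. n0 + int n \<in> A}"
      have "{n. n0 + int n \<in> A} \<subseteq> {n. L (k * int n) (L (m + k * n0) f) \<in> I}"
        by (auto simp: A_def intro!: tr) (simp add: algebra_simps)
      then show ?thesis using inf infinite_super by (intro van[OF L_R[OF f], of k]) auto
    next
      assume inf: "infinite {n. n0 - int n \<in> A}"
      have "{n. n0 - int n \<in> A} \<subseteq> {n. L (- k * int n) (L (m + k * n0) f) \<in> I}"
        by (auto simp: A_def simp del: mult_minus_left intro!: tr) (simp add: algebra_simps)
      then show ?thesis using inf infinite_super by (intro van[OF L_R[OF f], of "- k"]) auto
    qed
  qed
  show ?thesis unfolding eventually_periodic_def
  proof (intro exI conjI allI impI CollectI)
    show "k > 0" by (rule k(1))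
    show "L (m + k * n) f \<in> I" if "infinite {n. m + k * n \<in> {n. L n f \<in> I}}" for m n
      using that by (rule *)
  qed
qed

definition saturated :: "'a set \<Rightarrow> bool" where
  "saturated I \<longleftrightarrow> ideal_in R I \<and> N \<subseteq> I \<and> (\<forall>m x. m > 0 \<longrightarrow> x \<in> R \<longrightarrow> of_nat m * x \<in> I \<longrightarrow> x \<in> I)"

lemma ex_maximal:
  assumes "P I0" and P: "\<And>I. P I \<Longrightarrow> ideal_in R I \<and> N \<subseteq> I"
  shows "\<exists>I. P I \<and> (\<forall>J. P J \<longrightarrow> I \<subseteq> J \<longrightarrow> J = I)"
proof (rule ccontr)
  assume "\<not> ?thesis"
  then have step: "\<exists>J. P J \<and> I \<subset> J" if "P I" for I using that by blast
  obtain J where J: "\<And>n. P (J n)" "\<And>n. J n \<subset> J (Suc n)"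
    using dependent_nat_choice[of "\<lambda>_. P" "\<lambda>_ I J. I \<subset> J"] assms(1) step by metis
  have "\<exists>m. \<forall>n\<ge>m. J n = J m"
    by (rule noeth_ACC[OF noeth R]) (use P[OF J(1)] J(2) in auto)
  then obtain m where m: "\<And>n. n \<ge> m \<Longrightarrow> J n = J m" by blast
  have "J (Suc m) = J m" by (rule m) simp
  then show False using J(2)[of m] by simp
qed

text \<open>Noetherian induction. A maximal counterexample \<open>I\<close> is not the intersection of
  two larger saturated ideals. If the annihilators of the powers of \<open>b\<close> modulo
  \<open>I\<close> are stationary from the exponent \<open>m\<close> on, then the annihilator
  of \<open>b ^ m\<close> and the saturation of the ideal generated by \<open>I\<close> and
  \<open>b ^ m\<close> intersect in \<open>I\<close>; hence one of them is \<open>I\<close>,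
  which says that \<open>b\<close> is a non-zero-divisor or nilpotent modulo \<open>I\<close>.\<close>

theorem eventually_periodic_saturated:
  assumes "saturated I0" and "f0 \<in> R"
  shows "eventually_periodic {n. L n f0 \<in> I0}"
proof (rule ccontr)
  assume not: "\<not> ?thesis"
  define P where "P I \<longleftrightarrow> saturated I \<and> (\<exists>f\<in>R. \<not> eventually_periodic {n. L n f \<in> I})" for I
  have "P I0" unfolding P_def using assms not by blast
  moreover have "ideal_in R I \<and> N \<subseteq> I" if "P I" for I
    using that by (simp add: P_def saturated_def)
  ultimately have "\<exists>I. P I \<and> (\<forall>J. P J \<longrightarrow> I \<subseteq> J \<longrightarrow> J = I)" by (rule ex_maximal)
  then obtain I where PI: "P I" and max: "\<And>J. P J \<Longrightarrow> I \<subseteq> J \<Longrightarrow> J = I" by blast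
  have sat: "saturated I" using PI by (simp add: P_def)
  obtain f where f: "f \<in> R" "\<not> eventually_periodic {n. L n f \<in> I}" using PI by (auto simp: P_def)
  have I: "ideal_in R I" and NI: "N \<subseteq> I" and tf: "\<And>m x. m > 0 \<Longrightarrow> x \<in> R \<Longrightarrow> of_nat m * x \<in> I \<Longrightarrow> x \<in> I"
    using sat unfolding saturated_def by simp_all
  have irr: "J1 = I \<or> J2 = I" if J: "saturated J1" "saturated J2" "I \<subseteq> J1" "I \<subseteq> J2" "J1 \<inter> J2 \<subseteq> I" for J1 J2
  proof (rule ccontr)
    assume "\<not> ?thesis"
    then have "\<not> P J1" "\<not> P J2" using max J by blast+
    then have "eventually_periodic {n. L n f \<in> J1}" "eventually_periodic {n. L n f \<in> J2}"
      using J f(1) unfolding P_def by auto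
    then have "eventually_periodic ({n. L n f \<in> J1} \<inter> {n. L n f \<in> J2})" by (rule eventually_periodic_Int)
    moreover have "{n. L n f \<in> J1} \<inter> {n. L n f \<in> J2} = {n. L n f \<in> I}" using J by auto
    ultimately show False using f by simp
  qed
  have "coprimary R I"
  proof
    show "subring_set R" "ideal_in R I" by (rule R, rule I)
    show "1 \<notin> I"
    proof
      assume "1 \<in> I"
      then have "x \<in> I" if "x \<in> R" for x using ideal_mult[OF I that, of 1] by simp
      then have "{n. L n f \<in> I} = UNIV" using L_R[OF f(1)] by auto
      then show False using f(2) eventually_periodic_UNIV by simp
    qed
    show "x \<in> I" if "of_nat m * x \<in> I" "m > 0" "x \<in> R" for m x using tf that by blast
  next
    fix b assume b: "b \<in> R"
    have bn: "b ^ n \<in> R" for n by (rule subring_power[OF R b])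
    define C where "C n = {x \<in> R. b ^ n * x \<in> I}" for n
    have IC: "I \<subseteq> C n" for n unfolding C_def using ideal_mult[OF I bn] ideal_sub[OF I] by blast
    have C: "ideal_in R (C n)" for n
      unfolding ideal_in_def
    proof (intro conjI ballI)
      fix x y assume "x \<in> C n" "y \<in> C n"
      then show "x + y \<in> C n" using subring_add[OF R, of x y] ideal_add[OF I, of "b ^ n * x" "b ^ n * y"]
        by (simp add: C_def distrib_left)
    next
      fix r x assume "r \<in> R" "x \<in> C n"
      then show "r * x \<in> C n" using subring_mult[OF R, of r x] ideal_mult[OF I, of r "b ^ n * x"]
        by (simp add: C_def mult.left_commute)
    qed (use IC ideal_0[OF I] in \<open>auto simp: C_def\<close>)
    have "\<exists>m. \<forall>n\<ge>m. C n = C m"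
    proof (rule noeth_ACC[OF noeth R C])
      show "N \<subseteq> C n" for n using NI IC by blast
      show "C n \<subseteq> C (Suc n)" for n
        unfolding C_def using ideal_mult[OF I b] by (auto simp: mult.assoc)
    qed
    then obtain m0 where m0: "\<And>n. n \<ge> m0 \<Longrightarrow> C n = C m0" by blast
    \<comment> \<open>a positive exponent, so that the annihilator of \<open>b ^ m\<close> contains the
      one of \<open>b\<close>\<close>
    define m where "m = Suc m0"
    have m: "C (m + m) = C m" using m0[of m] m0[of "m + m"] by (simp add: m_def)
    define D where "D = {x \<in> R. \<exists>t r. t > 0 \<and> r \<in> R \<and> of_nat t * x - b ^ m * r \<in> I}"
    have DI: "x \<in> D" if "x \<in> R" "t > 0" "r \<in> R" "of_nat t * x - b ^ m * r \<in> I" for x t r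
      unfolding D_def using that by blast
    have ID: "I \<subseteq> D"
    proof
      fix x assume "x \<in> I"
      then show "x \<in> D" using ideal_sub[OF I] subring_0[OF R] by (intro DI[of x 1 0]) auto
    qed
    have nat: "of_nat t \<in> R" for t by (rule subring_of_nat[OF R])
    have D: "ideal_in R D"
      unfolding ideal_in_def
    proof (intro conjI ballI)
      fix x y assume "x \<in> D" "y \<in> D"
      then obtain t r t' r' where *: "x \<in> R" "t > 0" "r \<in> R" "of_nat t * x - b ^ m * r \<in> I"
        "y \<in> R" "t' > 0" "r' \<in> R" "of_nat t' * y - b ^ m * r' \<in> I" unfolding D_def by blast
      have "of_nat t' * (of_nat t * x - b ^ m * r) + of_nat t * (of_nat t' * y - b ^ m * r') \<in> I"
        by (intro ideal_add[OF I] ideal_mult[OF I] nat *)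
      then have sum: "of_nat (t * t') * (x + y) - b ^ m * (of_nat t' * r + of_nat t * r') \<in> I"
        by (simp add: algebra_simps)
      have "t * t' > 0" using * by simp
      then show "x + y \<in> D"
        by (rule DI[OF subring_add[OF R *(1,5)] _
            subring_add[OF R subring_mult[OF R nat *(3)] subring_mult[OF R nat *(7)]] sum])
    next
      fix s x assume s: "s \<in> R" and "x \<in> D"
      then obtain t r where *: "x \<in> R" "t > 0" "r \<in> R" "of_nat t * x - b ^ m * r \<in> I" unfolding D_def by blast
      have "s * (of_nat t * x - b ^ m * r) \<in> I" by (rule ideal_mult[OF I s *(4)])
      then have "of_nat t * (s * x) - b ^ m * (s * r) \<in> I" by (simp add: algebra_simps)
      then show "s * x \<in> D" by (rule DI[OF subring_mult[OF R s *(1)] *(2) subring_mult[OF R s *(3)]])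
    qed (use ID ideal_0[OF I] in \<open>auto simp: D_def\<close>)
    have "saturated (C m)" unfolding saturated_def
    proof (intro conjI allI impI)
      fix t x assume "t > 0" "x \<in> R" "of_nat t * x \<in> C m"
      then show "x \<in> C m" using tf[of t "b ^ m * x"] subring_mult[OF R bn]
        by (simp add: C_def mult.left_commute)
    qed (use C IC NI in auto)
    moreover have "saturated D" unfolding saturated_def
    proof (intro conjI allI impI)
      fix t x assume tx: "t > 0" "x \<in> R" "of_nat t * x \<in> D"
      then obtain t' r where *: "t' > 0" "r \<in> R" "of_nat t' * (of_nat t * x) - b ^ m * r \<in> I" unfolding D_def by blast
      then show "x \<in> D" using tx by (intro DI[of x "t' * t" r]) (auto simp: mult.assoc)
    qed (use D ID NI in auto)
    moreover have "C m \<inter> D \<subseteq> I"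
    proof
      fix x assume "x \<in> C m \<inter> D"
      then obtain t r where x: "x \<in> R" "b ^ m * x \<in> I" and *: "t > 0" "r \<in> R" "of_nat t * x - b ^ m * r \<in> I"
        unfolding D_def C_def by blast
      have "of_nat t * (b ^ m * x) - b ^ m * (of_nat t * x - b ^ m * r) \<in> I"
        by (intro ideal_diff[OF R I] ideal_mult[OF I] nat x bn *)
      then have "b ^ (m + m) * r \<in> I" by (simp add: power_add algebra_simps)
      then have "r \<in> C m" using *(2) m by (auto simp: C_def)
      then have "of_nat t * x - b ^ m * r + b ^ m * r \<in> I" using *(3) by (intro ideal_add[OF I]) (simp_all add: C_def)
      then show "x \<in> I" using tf[OF *(1) x(1)] by simp
    qed
    ultimately have "C m = I \<or> D = I" by (intro irr IC ID)
    then show "(\<exists>n. b ^ n \<in> I) \<or> (\<forall>x\<in>R. b * x \<in> I \<longrightarrow> x \<in> I)"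
    proof
      assume Cm: "C m = I"
      have "x \<in> I" if x: "x \<in> R" "b * x \<in> I" for x
      proof -
        have "b ^ m0 * (b * x) \<in> I" by (rule ideal_mult[OF I bn x(2)])
        then have "x \<in> C m" using x(1) by (simp add: C_def m_def mult_ac)
        then show ?thesis using Cm by simp
      qed
      then show ?thesis by blast
    next
      assume "D = I"
      moreover have "b ^ m \<in> D"
        by (rule DI[of _ 1 1]) (use bn subring_1[OF R] ideal_0[OF I] in auto)
      ultimately show ?thesis by blast
    qed
  qed
  then show False using eventually_periodic_coprimary[OF _ NI f(1)] f(2) by blast
qed

end

section \<open>Commutative rings as images of polynomial rings\<close>

text \<open>Polynomials with integer coefficients in one variable for each element of \<open>'a\<close>.\<close>

type_synonym 'a free_ring = "('a \<Rightarrow>\<^sub>0 nat) \<Rightarrow>\<^sub>0 int"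

lemma poly_mapping_additive_induct [case_names zero single add]:
  assumes "P 0" "\<And>k v. P (Poly_Mapping.single k v)" "\<And>p q. P p \<Longrightarrow> P q \<Longrightarrow> P (p + q)"
  shows "P (p :: 'k \<Rightarrow>\<^sub>0 'v::monoid_add)"
proof (induction p rule: update_induct)
  case (update f a b)
  have "Poly_Mapping.update a b f = f + Poly_Mapping.single a b"
    using update(1) by (intro poly_mapping_eqI)
      (auto simp: lookup_add lookup_update lookup_single in_keys_iff when_def)
  then show ?case using assms(2,3) update by simp
qed (rule assms(1))

context cring
begin

text \<open>Variables that do not stand for an element of the ring get the value one, so that the
  evaluation map is total.\<close>

definition var_value :: "'a \<Rightarrow> 'a" where
  "var_value a = (if a \<in> carrier R then a else \<one>)"

definition monomial_value :: "('a \<Rightarrow>\<^sub>0 nat) \<Rightarrow> 'a" where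
  "monomial_value m = (\<Otimes>a\<in>Poly_Mapping.keys m. var_value a [^] Poly_Mapping.lookup m a)"

definition free_value :: "'a free_ring \<Rightarrow> 'a" where
  "free_value p = (\<Oplus>m\<in>Poly_Mapping.keys p. [Poly_Mapping.lookup p m] \<cdot> monomial_value m)"

lemma var_value_closed [simp]: "var_value a \<in> carrier R"
  by (simp add: var_value_def)

lemma monomial_value_closed [simp]: "monomial_value m \<in> carrier R"
  unfolding monomial_value_def by (rule finprod_closed) auto

lemma int_mult_closed [simp]: "x \<in> carrier R \<Longrightarrow> [(k::int)] \<cdot> x \<in> carrier R"
  by (rule add.int_pow_closed)

lemma int_mult_0 [simp]: "[(0::int)] \<cdot> x = \<zero>"
  unfolding add_pow_def int_pow_0 by simp

lemma free_value_closed [simp]: "free_value p \<in> carrier R"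
  unfolding free_value_def by (rule finsum_closed) auto

lemma monomial_value_superset:
  assumes "finite S" "Poly_Mapping.keys m \<subseteq> S"
  shows "monomial_value m = (\<Otimes>a\<in>S. var_value a [^] Poly_Mapping.lookup m a)"
  unfolding monomial_value_def
  by (rule finprod_mono_neutral_cong_left[OF assms]) (auto simp: in_keys_iff)

lemma monomial_value_add: "monomial_value (m + n) = monomial_value m \<otimes> monomial_value n"
proof -
  let ?S = "Poly_Mapping.keys m \<union> Poly_Mapping.keys n"
  have "monomial_value (m + n) = (\<Otimes>a\<in>?S. var_value a [^] Poly_Mapping.lookup (m + n) a)"
    by (rule monomial_value_superset) (auto simp: in_keys_iff lookup_add)
  also have "\<dots> = (\<Otimes>a\<in>?S. var_value a [^] Poly_Mapping.lookup m a \<otimes> var_value a [^] Poly_Mapping.lookup n a)"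
    by (rule finprod_cong') (auto simp: lookup_add nat_pow_mult)
  also have "\<dots> = monomial_value m \<otimes> monomial_value n"
    by (subst finprod_multf) (auto simp: monomial_value_superset[of ?S])
  finally show ?thesis .
qed

lemma free_value_superset:
  assumes "finite S" "Poly_Mapping.keys p \<subseteq> S"
  shows "free_value p = (\<Oplus>m\<in>S. [Poly_Mapping.lookup p m] \<cdot> monomial_value m)"
  unfolding free_value_def
  by (rule add.finprod_mono_neutral_cong_left[OF assms]) (auto simp: in_keys_iff)

lemma free_value_add: "free_value (p + q) = free_value p \<oplus> free_value q"
proof -
  let ?S = "Poly_Mapping.keys p \<union> Poly_Mapping.keys q"
  have "free_value (p + q) = (\<Oplus>m\<in>?S. [Poly_Mapping.lookup (p + q) m] \<cdot> monomial_value m)"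
    by (rule free_value_superset) (auto simp: in_keys_iff lookup_add)
  also have "\<dots> = (\<Oplus>m\<in>?S. [Poly_Mapping.lookup p m] \<cdot> monomial_value m \<oplus> [Poly_Mapping.lookup q m] \<cdot> monomial_value m)"
    by (rule finsum_cong') (auto simp: lookup_add add.int_pow_mult)
  also have "\<dots> = free_value p \<oplus> free_value q"
    by (subst finsum_addf) (auto simp: free_value_superset[of ?S])
  finally show ?thesis .
qed

lemma free_value_0: "free_value 0 = \<zero>"
  by (simp add: free_value_def)

lemma free_value_single: "free_value (Poly_Mapping.single m c) = [c] \<cdot> monomial_value m"
proof -
  have "free_value (Poly_Mapping.single m c) = (\<Oplus>n\<in>{m}. [Poly_Mapping.lookup (Poly_Mapping.single m c) n] \<cdot> monomial_value n)"
    by (rule free_value_superset) auto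
  then show ?thesis by simp
qed

lemma free_value_mult: "free_value (p * q) = free_value p \<otimes> free_value q"
proof (induction p rule: poly_mapping_additive_induct)
  case zero
  then show ?case by (simp add: free_value_0)
next
  case (add p p')
  then show ?case by (simp add: distrib_right free_value_add l_distr)
next
  case (single m c)
  show ?case
  proof (induction q rule: poly_mapping_additive_induct)
    case zero
    then show ?case by (simp add: free_value_0)
  next
    case (add q q')
    then show ?case by (simp add: distrib_left free_value_add r_distr)
  next
    case (single n d)
    have "([c] \<cdot> monomial_value m) \<otimes> ([d] \<cdot> monomial_value n) = [(c * d)] \<cdot> (monomial_value (m + n))"
      by (simp add: add_pow_ldistr_int add_pow_rdistr_int add.int_pow_pow mult.commute monomial_value_add)
    then show ?case by (simp add: mult_single free_value_single)
  qed
qed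

lemma free_value_var:
  assumes "a \<in> carrier R" shows "free_value (Poly_Mapping.single (Poly_Mapping.single a 1) 1) = a"
proof -
  have "monomial_value (Poly_Mapping.single a 1) = (\<Otimes>b\<in>{a}. var_value b [^] Poly_Mapping.lookup (Poly_Mapping.single a (1::nat)) b)"
    by (rule monomial_value_superset) auto
  also have "\<dots> = a" using assms by (simp add: var_value_def)
  finally show ?thesis using assms by (simp add: free_value_single)
qed

lemma free_value_1: "free_value 1 = \<one>"
proof -
  have "free_value (Poly_Mapping.single 0 1) = [(1::int)] \<cdot> (monomial_value 0)" by (rule free_value_single)
  then show ?thesis by (simp add: monomial_value_def)
qed

end

section \<open>Automorphisms of finitely generated algebras\<close>

text \<open>The evaluation map \<open>ev\<close> presents \<open>A\<close> as a quotient of a ring whose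
  type belongs to the class \<open>comm_ring_1\<close>, with set-theoretic section
  \<open>X\<close>; the maps \<open>\<phi>\<close> are an action of the integers on
  \<open>A\<close>.\<close>

locale algebra_flow =
  fixes K :: "('k, 'm) ring_scheme" and A :: "('k, 'a) module" (structure)
    and ev :: "'f::comm_ring_1 \<Rightarrow> 'a" and X :: "'a \<Rightarrow> 'f" and \<phi> :: "int \<Rightarrow> 'a \<Rightarrow> 'a"
  assumes field: "field K" and char_0: "char_zero K" and fin_gen: "fin_gen_algebra K A"
    and ev_closed [simp]: "\<And>x. ev x \<in> carrier A" and ev_1: "ev 1 = \<one>"
    and ev_add: "\<And>x y. ev (x + y) = ev x \<oplus> ev y" and ev_mult: "\<And>x y. ev (x * y) = ev x \<otimes> ev y"
    and ev_X: "\<And>a. a \<in> carrier A \<Longrightarrow> ev (X a) = a"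
    and hom: "\<And>n. \<phi> n \<in> alg_hom K A A"
    and \<phi>_0: "\<And>a. a \<in> carrier A \<Longrightarrow> \<phi> 0 a = a"
    and \<phi>_add: "\<And>m n a. a \<in> carrier A \<Longrightarrow> \<phi> (m + n) a = \<phi> m (\<phi> n a)"

sublocale algebra_flow \<subseteq> K: field K
  by (rule field)

sublocale algebra_flow \<subseteq> A: cring A
  using fin_gen unfolding fin_gen_algebra_def by (elim conjE algebra.axioms(2))

sublocale algebra_flow \<subseteq> algebra K A
  using fin_gen unfolding fin_gen_algebra_def by (rule conjunct1)

context algebra_flow
begin

lemma eq_minusI:
  assumes "a \<in> carrier A" "b \<in> carrier A" "a \<oplus> b = c" shows "a = c \<ominus> b"
  unfolding assms(3)[symmetric] using assms(1,2) by (simp add: a_minus_def A.a_assoc A.r_neg)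

lemma ev_0: "ev 0 = \<zero>"
  using ev_add[of 0 0] by simp

lemma ev_diff: "ev (x - y) = ev x \<ominus> ev y"
  by (rule eq_minusI) (simp_all flip: ev_add)

definition N :: "'f set" where "N = {x. ev x = \<zero>}"

lemma N_iff: "x - y \<in> N \<longleftrightarrow> ev x = ev y"
  unfolding N_def by (simp add: ev_diff)

lemma preimage_ideal:
  assumes "ideal J A" shows "ideal_in UNIV {x. ev x \<in> J}"
  using ideal.Icarr[OF assms] additive_subgroup.zero_closed[OF ideal.axioms(1)[OF assms]]
    additive_subgroup.a_closed[OF ideal.axioms(1)[OF assms]] ideal.I_l_closed[OF assms]
  by (simp add: ideal_in_def ev_0 ev_add ev_mult)

lemma N_ideal: "ideal_in UNIV N"
  using preimage_ideal[OF A.zeroideal] by (simp add: N_def)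

definition scalars :: "'f set" where
  "scalars = {x. \<exists>c\<in>carrier K. ev x = c \<odot> \<one>}"

lemma subring_scalars: "subring_set scalars"
  unfolding subring_set_def
proof (intro conjI ballI)
  show "1 \<in> scalars" unfolding scalars_def using K.one_closed by (auto simp: ev_1 intro!: bexI[of _ "\<one>\<^bsub>K\<^esub>"])
next
  fix x y assume "x \<in> scalars" "y \<in> scalars"
  then obtain c d where *: "c \<in> carrier K" "d \<in> carrier K" "ev x = c \<odot> \<one>" "ev y = d \<odot> \<one>"
    unfolding scalars_def by blast
  have "ev (x - y) = (c \<ominus>\<^bsub>K\<^esub> d) \<odot> \<one>"
    using * by (simp add: ev_diff a_minus_def a_minus_def smult_l_distr smult_l_minus)
  then show "x - y \<in> scalars" unfolding scalars_def using * by blast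
  have "ev (x * y) = (c \<otimes>\<^bsub>K\<^esub> d) \<odot> \<one>"
    using * by (simp add: ev_mult smult_assoc1 smult_assoc2)
  then show "x * y \<in> scalars" unfolding scalars_def using * by blast
qed

lemma N_scalars: "N \<subseteq> scalars"
  unfolding N_def scalars_def by (auto intro!: bexI[of _ "\<zero>\<^bsub>K\<^esub>"])

lemma scalar_inverse:
  assumes "c \<in> carrier K" "c \<noteq> \<zero>\<^bsub>K\<^esub>" shows "\<exists>d\<in>carrier K. d \<otimes>\<^bsub>K\<^esub> c = \<one>\<^bsub>K\<^esub>"
  using assms K.field_Units by (intro bexI[of _ "inv\<^bsub>K\<^esub> c"]) auto

lemma noeth_scalars: "noeth scalars N"
proof (rule noeth_field[OF subring_scalars ideal_in_subring[OF N_ideal N_scalars]])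
  fix x assume x: "x \<in> scalars - N"
  then obtain c where c: "c \<in> carrier K" "ev x = c \<odot> \<one>" unfolding scalars_def by blast
  have "c \<noteq> \<zero>\<^bsub>K\<^esub>" using x c by (auto simp: N_def)
  then obtain d where d: "d \<in> carrier K" "d \<otimes>\<^bsub>K\<^esub> c = \<one>\<^bsub>K\<^esub>" using scalar_inverse[OF c(1)] by blast
  have "ev (x * X (d \<odot> \<one>)) = ev 1"
    using c d smult_assoc1[of d c "\<one>"] by (simp add: ev_mult ev_X ev_1 A.m_comm[of _ "d \<odot> \<one>"] smult_assoc2)
  then have "x * X (d \<odot> \<one>) - 1 \<in> N" by (simp add: N_iff)
  moreover have "X (d \<odot> \<one>) \<in> scalars" unfolding scalars_def using d by (auto simp: ev_X)
  ultimately show "\<exists>y\<in>scalars. x * y - 1 \<in> N" by blast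
qed

lemma ex_generators: "\<exists>xs. adjoins scalars xs = UNIV"
proof -
  obtain S where S: "finite S" "S \<subseteq> carrier A"
    "generate_ring A ((\<lambda>c. c \<odot> \<one>) ` carrier K \<union> S) = carrier A"
    using fin_gen unfolding fin_gen_algebra_def by blast
  obtain ys where ys: "set ys = S" using finite_list[OF S(1)] by blast
  let ?B = "adjoins scalars (map X ys)"
  note B = subring_adjoins[OF subring_scalars, of "map X ys"]
  have NB: "N \<subseteq> ?B" using N_scalars adjoins_base[OF subring_scalars] by blast
  have cong: "x \<in> ?B" if "y \<in> ?B" "ev x = ev y" for x y
    using subring_add[OF B _ that(1), of "x - y"] NB N_iff that(2) by auto
  have "a \<in> generate_ring A ((\<lambda>c. c \<odot> \<one>) ` carrier K \<union> S) \<Longrightarrow> X a \<in> ?B" for a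
  proof (induction rule: generate_ring.induct)
    case one
    show ?case by (rule cong[OF subring_1[OF B]]) (simp add: ev_X ev_1)
  next
    case (incl h)
    then show ?case
    proof
      assume "h \<in> (\<lambda>c. c \<odot> \<one>) ` carrier K"
      then have "X h \<in> scalars" unfolding scalars_def by (auto simp: ev_X)
      then show ?thesis using adjoins_base[OF subring_scalars] by blast
    next
      assume "h \<in> S"
      then show ?thesis using adjoins_gen[OF subring_scalars, of "map X ys"] ys by auto
    qed
  next
    case (a_inv h)
    then have h: "h \<in> carrier A" using S(3) by simp
    have "ev (0 - X h) = \<ominus> h" using h by (simp only: ev_diff ev_0 ev_X) (simp add: a_minus_def)
    then show ?case using h by (intro cong[OF subring_diff[OF B subring_0[OF B] a_inv.IH]]) (simp add: ev_X)
  next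
    case (eng_add h1 h2)
    then have h: "h1 \<in> carrier A" "h2 \<in> carrier A" using S(3) by simp_all
    then show ?case by (intro cong[OF subring_add[OF B eng_add.IH]]) (simp add: ev_X ev_add)
  next
    case (eng_mult h1 h2)
    then have h: "h1 \<in> carrier A" "h2 \<in> carrier A" using S(3) by simp_all
    then show ?case by (intro cong[OF subring_mult[OF B eng_mult.IH]]) (simp add: ev_X ev_mult)
  qed
  then have "X (ev x) \<in> ?B" for x using S(3) by simp
  then have "x \<in> ?B" for x using cong[of "X (ev x)" x] by (simp add: ev_X)
  then show ?thesis by blast
qed

lemma ex_ideal_generators:
  assumes "ideal_in UNIV J" "N \<subseteq> J"
  shows "\<exists>S. finite S \<and> S \<subseteq> J \<and> J \<subseteq> lincomb UNIV N S"
proof -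
  obtain xs where "adjoins scalars xs = UNIV" using ex_generators by blast
  then have "noeth UNIV N" using noeth_adjoins[OF subring_scalars N_ideal N_scalars noeth_scalars, of xs] by simp
  then obtain S where "finite S" "S \<subseteq> J" "J \<subseteq> lincomb UNIV N S"
    using assms by (rule noethE)
  then show ?thesis by (intro exI conjI)
qed

lemma \<phi>_closed [simp]: "a \<in> carrier A \<Longrightarrow> \<phi> n a \<in> carrier A"
  and \<phi>_one: "\<phi> n \<one> = \<one>"
  and \<phi>_a: "a \<in> carrier A \<Longrightarrow> b \<in> carrier A \<Longrightarrow> \<phi> n (a \<oplus> b) = \<phi> n a \<oplus> \<phi> n b"
  and \<phi>_m: "a \<in> carrier A \<Longrightarrow> b \<in> carrier A \<Longrightarrow> \<phi> n (a \<otimes> b) = \<phi> n a \<otimes> \<phi> n b"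
  and \<phi>_smult: "c \<in> carrier K \<Longrightarrow> a \<in> carrier A \<Longrightarrow> \<phi> n (c \<odot> a) = c \<odot> \<phi> n a"
  using hom[of n] unfolding alg_hom_def ring_hom_def by auto

lemma \<phi>_zero: "\<phi> n \<zero> = \<zero>"
  using \<phi>_a[of "\<zero>" "\<zero>" n] by simp

text \<open>A lift of the action to the ambient ring; it is multiplicative and additive only modulo the
  kernel.\<close>

definition L :: "int \<Rightarrow> 'f \<Rightarrow> 'f" where "L n x = X (\<phi> n (ev x))"

lemma ev_L: "ev (L n x) = \<phi> n (ev x)"
  unfolding L_def by (rule ev_X) simp

lemma L_props:
  shows "L n 1 - 1 \<in> N" and "L n (x - y) - (L n x - L n y) \<in> N" and "L n (x * y) - L n x * L n y \<in> N"
    and "x \<in> N \<Longrightarrow> L n x \<in> N" and "L 0 x - x \<in> N" and "L (m + n) x - L m (L n x) \<in> N"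
proof -
  show "L n (x - y) - (L n x - L n y) \<in> N"
    unfolding N_iff ev_diff ev_L by (rule eq_minusI) (simp_all flip: \<phi>_a ev_diff ev_add)
  show "x \<in> N \<Longrightarrow> L n x \<in> N"
    by (simp add: N_def ev_L \<phi>_zero)
qed (simp_all add: N_iff ev_L ev_1 \<phi>_one ev_mult \<phi>_m \<phi>_0 \<phi>_add)

text \<open>A polynomial expression involves only finitely many scalars.\<close>

lemma ex_coefficients:
  assumes xs: "adjoins scalars xs = UNIV" and "finite E"
  shows "\<exists>cs. set cs \<subseteq> scalars \<and> E \<subseteq> adjoins (int_ring N) (xs @ cs)"
proof -
  note Z = subring_int_ring[OF N_ideal]
  have mono: "adjoins (int_ring N) ys \<subseteq> adjoins (int_ring N) zs" if "set ys \<subseteq> set zs" for ys zs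
    using that adjoins_gen[OF Z, of zs] by (intro adjoins_subset subring_adjoins Z adjoins_base) auto
  define B where "B = {y. \<exists>cs. set cs \<subseteq> scalars \<and> y \<in> adjoins (int_ring N) (xs @ cs)}"
  have "subring_set B" unfolding subring_set_def
  proof (intro conjI ballI)
    have "1 \<in> adjoins (int_ring N) (xs @ [])" by (rule subring_1[OF subring_adjoins[OF Z]])
    then show "1 \<in> B" unfolding B_def by (intro CollectI exI[of _ "[]"]) simp
  next
    fix x y assume "x \<in> B" "y \<in> B"
    then obtain cs ds where *: "set cs \<subseteq> scalars" "x \<in> adjoins (int_ring N) (xs @ cs)"
      "set ds \<subseteq> scalars" "y \<in> adjoins (int_ring N) (xs @ ds)" unfolding B_def by blast
    have xy: "x \<in> adjoins (int_ring N) (xs @ cs @ ds)" "y \<in> adjoins (int_ring N) (xs @ cs @ ds)"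
      using *(2,4) mono[of "xs @ cs" "xs @ cs @ ds"] mono[of "xs @ ds" "xs @ cs @ ds"] by auto
    have s: "set (cs @ ds) \<subseteq> scalars" using * by simp
    show "x - y \<in> B" unfolding B_def
      using s subring_diff[OF subring_adjoins[OF Z] xy] by (intro CollectI exI[of _ "cs @ ds"]) simp
    show "x * y \<in> B" unfolding B_def
      using s subring_mult[OF subring_adjoins[OF Z] xy] by (intro CollectI exI[of _ "cs @ ds"]) simp
  qed
  moreover have "scalars \<subseteq> B"
  proof
    fix c assume "c \<in> scalars"
    then show "c \<in> B" unfolding B_def using adjoins_gen[OF Z, of "xs @ [c]"]
      by (intro CollectI exI[of _ "[c]"]) auto
  qed
  moreover have "set xs \<subseteq> B"
    unfolding B_def using adjoins_gen[OF Z, of "xs @ []"] by (auto intro!: exI[of _ "[]"])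
  ultimately have B: "B = UNIV" using adjoins_subset[of B scalars xs] xs by auto
  show ?thesis using \<open>finite E\<close>
  proof (induction E rule: finite_induct)
    case empty
    then show ?case by (intro exI[of _ "[]"]) simp
  next
    case (insert e E)
    obtain cs where cs: "set cs \<subseteq> scalars" "E \<subseteq> adjoins (int_ring N) (xs @ cs)" using insert by blast
    have "e \<in> B" using B by simp
    then obtain ds where ds: "set ds \<subseteq> scalars" "e \<in> adjoins (int_ring N) (xs @ ds)" unfolding B_def by blast
    have "insert e E \<subseteq> adjoins (int_ring N) (xs @ cs @ ds)"
      using cs ds mono[of "xs @ cs" "xs @ cs @ ds"] mono[of "xs @ ds" "xs @ cs @ ds"] by auto
    then show ?case using cs ds by (intro exI[of _ "cs @ ds"]) simp
  qed
qed

text \<open>The subring is generated by integers, by algebra generators, whose images lie in it by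
  assumption, and by scalars, which are fixed by the action.\<close>

lemma stable_step:
  assumes Rd: "R = adjoins (int_ring N) (xs @ cs)" and cs: "set cs \<subseteq> scalars" and E: "L e ` set xs \<subseteq> R"
    and x: "x \<in> R"
  shows "L e x \<in> R"
proof -
  note Z = subring_int_ring[OF N_ideal]
  have R: "subring_set R" unfolding Rd by (rule subring_adjoins[OF Z])
  have ZR: "int_ring N \<subseteq> R" unfolding Rd by (rule adjoins_base[OF Z])
  have NR: "N \<subseteq> R" using ZR int_ring_sub[OF N_ideal] by blast
  have gR: "set (xs @ cs) \<subseteq> R" unfolding Rd by (rule adjoins_gen[OF Z])
  have cong: "a \<in> R" if "a - b \<in> N" "b \<in> R" for a b
    using subring_add[OF R _ that(2), of "a - b"] that(1) NR by auto
  define B where "B = {x \<in> R. L e x \<in> R}"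
  have B: "subring_set B" unfolding subring_set_def
  proof (intro conjI ballI)
    show "1 \<in> B" unfolding B_def using cong[OF L_props(1)] subring_1[OF R] by simp
  next
    fix x y assume "x \<in> B" "y \<in> B"
    then have *: "x \<in> R" "L e x \<in> R" "y \<in> R" "L e y \<in> R" by (auto simp: B_def)
    show "x - y \<in> B" unfolding B_def
      using cong[OF L_props(2) subring_diff[OF R *(2,4)]] subring_diff[OF R *(1,3)] by simp
    show "x * y \<in> B" unfolding B_def
      using cong[OF L_props(3) subring_mult[OF R *(2,4)]] subring_mult[OF R *(1,3)] by simp
  qed
  have "int_ring N \<subseteq> B"
  proof
    fix x assume x: "x \<in> int_ring N"
    then obtain z where z: "x - of_int z \<in> N" unfolding int_ring_def by blast
    have "ev x = ev (of_int z)" using z by (simp add: N_iff)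
    then have "L e x - L e (of_int z) \<in> N" by (simp add: N_iff ev_L)
    moreover have "L e (of_int z) \<in> R" using subring_of_int[OF B, of z] by (simp add: B_def)
    ultimately show "x \<in> B" unfolding B_def using x ZR cong by blast
  qed
  moreover have "set (xs @ cs) \<subseteq> B"
  proof
    fix x assume x: "x \<in> set (xs @ cs)"
    have "L e x \<in> R"
    proof (cases "x \<in> set xs")
      case True
      then show ?thesis using E by blast
    next
      case False
      then have "x \<in> scalars" using x cs by auto
      then obtain c where "c \<in> carrier K" "ev x = c \<odot> \<one>" unfolding scalars_def by blast
      then have "L e x - x \<in> N" by (simp add: N_iff ev_L \<phi>_smult \<phi>_one)
      then show ?thesis using x gR cong by blast
    qed
    then show "x \<in> B" using x gR by (auto simp: B_def)
  qed
  ultimately have "R \<subseteq> B" unfolding Rd by (rule adjoins_subset[OF B])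
  then show ?thesis using x by (auto simp: B_def)
qed

text \<open>In characteristic zero a positive integer is invertible in the field of scalars.\<close>

lemma torsion_free:
  assumes I: "ideal I A" and m: "m > 0" and x: "ev (of_nat m * x) \<in> I" shows "ev x \<in> I"
proof -
  have "add_pow K n \<one>\<^bsub>K\<^esub> \<in> carrier K \<and> ev (of_nat n) = add_pow K n \<one>\<^bsub>K\<^esub> \<odot> \<one>" for n :: nat
  proof (induction n)
    case 0
    then show ?case by (simp add: ev_0)
  next
    case (Suc n)
    then show ?case by (simp add: ev_add ev_1 smult_l_distr K.add.nat_pow_Suc A.a_comm)
  qed
  then have *: "add_pow K m \<one>\<^bsub>K\<^esub> \<in> carrier K" "ev (of_nat m) = add_pow K m \<one>\<^bsub>K\<^esub> \<odot> \<one>" by auto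
  have "add_pow K m \<one>\<^bsub>K\<^esub> \<noteq> \<zero>\<^bsub>K\<^esub>" using char_0 m unfolding char_zero_def by blast
  then obtain d where d: "d \<in> carrier K" "d \<otimes>\<^bsub>K\<^esub> add_pow K m \<one>\<^bsub>K\<^esub> = \<one>\<^bsub>K\<^esub>"
    using scalar_inverse[OF *(1)] by blast
  have "(d \<odot> \<one>) \<otimes> ev (of_nat m * x) = ev x"
    using d * smult_assoc1[OF d(1) *(1), of "ev x"] by (simp add: ev_mult smult_assoc2)
  then show ?thesis using ideal.I_l_closed[OF I x, of "d \<odot> \<one>"] d(1) by simp
qed

text \<open>A subring that is generated by the algebra generators and by sufficiently many scalars
  contains \<open>t\<close> and is stable under the action; it is finitely generated as a
  ring.\<close>

lemma eventually_periodic_element: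
  assumes I: "ideal I A" shows "eventually_periodic {n. \<phi> n (ev t) \<in> I}"
proof -
  obtain xs where xs: "adjoins scalars xs = UNIV" using ex_generators by blast
  define E where "E = insert t (L 1 ` set xs \<union> L (- 1) ` set xs)"
  obtain cs where cs: "set cs \<subseteq> scalars" "E \<subseteq> adjoins (int_ring N) (xs @ cs)"
    using ex_coefficients[OF xs, of E] by (auto simp: E_def)
  define R where "R = adjoins (int_ring N) (xs @ cs)"
  note Z = subring_int_ring[OF N_ideal]
  have R: "subring_set R" unfolding R_def by (rule subring_adjoins[OF Z])
  have NR: "N \<subseteq> R" using adjoins_base[OF Z, of "xs @ cs"] int_ring_sub[OF N_ideal] by (auto simp: R_def)
  have cong: "a \<in> R" if "a - b \<in> N" "b \<in> R" for a b
    using subring_add[OF R _ that(2), of "a - b"] that(1) NR by auto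
  have step: "L 1 x \<in> R" "L (- 1) x \<in> R" if "x \<in> R" for x
    using stable_step[OF R_def cs(1) _ that] cs(2) unfolding E_def R_def[symmetric] by auto
  have L_R: "L n x \<in> R" if x: "x \<in> R" for n x
  proof (induction n rule: int_induct[where k = 0])
    case base
    show ?case by (rule cong[OF L_props(5) x])
  next
    case (step1 n)
    show ?case using cong[OF L_props(6)[of 1 n x]] step(1)[OF step1(2)] by (simp add: add.commute)
  next
    case (step2 n)
    show ?case using cong[OF L_props(6)[of "- 1" n x]] step(2)[OF step2(2)] by simp
  qed
  interpret D: dynamics R N "xs @ cs" L
    by unfold_locales (use N_ideal R_def L_R L_props in auto)
  have "D.saturated {x \<in> R. ev x \<in> I}"
    unfolding D.saturated_def
  proof (intro conjI allI impI)
    show "ideal_in R {x \<in> R. ev x \<in> I}"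
      using preimage_ideal[OF I] R unfolding ideal_in_def by (auto simp: subring_set_closed)
    show "N \<subseteq> {x \<in> R. ev x \<in> I}"
      using NR additive_subgroup.zero_closed[OF ideal.axioms(1)[OF I]] by (auto simp: N_def)
  qed (use torsion_free[OF I] in auto)
  moreover have t: "t \<in> R" using cs(2) by (simp add: E_def R_def)
  ultimately have "eventually_periodic {n. L n t \<in> {x \<in> R. ev x \<in> I}}"
    by (rule D.eventually_periodic_saturated)
  then show ?thesis using L_R[OF t] by (simp add: ev_L)
qed

text \<open>As the algebra is noetherian, the condition has to be tested only on finitely many elements
  of \<open>J\<close>.\<close>

theorem eventually_periodic_ideals:
  assumes I: "ideal I A" and J: "ideal J A"
  shows "eventually_periodic {n. \<forall>a\<in>J. \<phi> n a \<in> I}"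
proof -
  note J' = preimage_ideal[OF J]
  have NJ: "N \<subseteq> {x. ev x \<in> J}"
    using additive_subgroup.zero_closed[OF ideal.axioms(1)[OF J]] by (auto simp: N_def)
  obtain S where S: "finite S" "S \<subseteq> {x. ev x \<in> J}" "{x. ev x \<in> J} \<subseteq> lincomb UNIV N S"
    using ex_ideal_generators[OF J' NJ] by (elim exE conjE)
  have "(\<forall>a\<in>J. \<phi> n a \<in> I) \<longleftrightarrow> (\<forall>s\<in>S. \<phi> n (ev s) \<in> I)" for n
  proof
    assume "\<forall>a\<in>J. \<phi> n a \<in> I" then show "\<forall>s\<in>S. \<phi> n (ev s) \<in> I" using S(2) by auto
  next
    assume *: "\<forall>s\<in>S. \<phi> n (ev s) \<in> I"
    have zero: "\<zero> \<in> I" by (rule additive_subgroup.zero_closed[OF ideal.axioms(1)[OF I]])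
    have "ideal_in UNIV {x. \<phi> n (ev x) \<in> I}"
      using additive_subgroup.a_closed[OF ideal.axioms(1)[OF I]] ideal.I_l_closed[OF I] zero
      by (simp add: ideal_in_def ev_0 \<phi>_zero ev_add ev_mult \<phi>_a \<phi>_m)
    moreover have "N \<subseteq> {x. \<phi> n (ev x) \<in> I}" using zero by (auto simp: N_def \<phi>_zero)
    ultimately have "lincomb UNIV N S \<subseteq> {x. \<phi> n (ev x) \<in> I}"
      using * by (intro lincomb_subset[OF subring_UNIV]) auto
    then have sub: "{x. ev x \<in> J} \<subseteq> {x. \<phi> n (ev x) \<in> I}" using S(3) by blast
    show "\<forall>a\<in>J. \<phi> n a \<in> I"
    proof
      fix a assume a: "a \<in> J"
      then have aA: "a \<in> carrier A" by (rule ideal.Icarr[OF J])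
      then have "X a \<in> {x. ev x \<in> J}" using a by (simp add: ev_X)
      then have "X a \<in> {x. \<phi> n (ev x) \<in> I}" by (rule subsetD[OF sub])
      then show "\<phi> n a \<in> I" using aA by (simp add: ev_X)
    qed
  qed
  then have "{n. \<forall>a\<in>J. \<phi> n a \<in> I} = (\<Inter>s\<in>S. {n. \<phi> n (ev s) \<in> I})" by auto
  then show ?thesis using eventually_periodic_INT[OF S(1) eventually_periodic_element[OF I]] by simp
qed

end

theorem eventually_periodic_flow:
  assumes "field K" "char_zero K" "fin_gen_algebra K A"
    and "\<And>n::int. \<phi> n \<in> alg_hom K A A" "\<And>a. a \<in> carrier A \<Longrightarrow> \<phi> 0 a = a"
    and "\<And>m n a. a \<in> carrier A \<Longrightarrow> \<phi> (m + n) a = \<phi> m (\<phi> n a)"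
    and "ideal I A" "ideal J A"
  shows "eventually_periodic {n. \<forall>a\<in>J. \<phi> n a \<in> I}"
proof -
  have "algebra K A" using assms(3) by (simp add: fin_gen_algebra_def)
  then interpret A: cring A by (rule algebra.axioms(2))
  have "algebra_flow K A A.free_value (\<lambda>a. Poly_Mapping.single (Poly_Mapping.single a 1) 1) \<phi>"
  proof (rule algebra_flow.intro)
    show "field K" "char_zero K" "fin_gen_algebra K A" by fact+
  qed (use A.free_value_1 A.free_value_add A.free_value_mult A.free_value_var assms(4-6) in simp_all)
  then show ?thesis by (rule algebra_flow.eventually_periodic_ideals[OF _ assms(7,8)])
qed

section \<open>Automorphisms of affine schemes\<close>

lemma eventually_periodic_imp_two_sided_SML:
  assumes "eventually_periodic S" shows "two_sided_SML S"
proof -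
  obtain k where k: "k > 0" "\<And>m. infinite {n. m + k * n \<in> S} \<Longrightarrow> \<forall>n. m + k * n \<in> S"
    using assms unfolding eventually_periodic_def by blast
  define M where "M = {m \<in> {0..<k}. infinite {n. m + k * n \<in> S}}"
  define F where "F = (\<Union>m\<in>{0..<k} - M. (\<lambda>n. m + k * n) ` {n. m + k * n \<in> S})"
  have "M \<subseteq> {0..<k}" by (auto simp: M_def)
  then have fin: "finite M" "finite F"
    using finite_subset[of M "{0..<k}"] by (auto simp: F_def M_def)
  have "S = (\<Union>(a, b)\<in>(\<lambda>m. (k, m)) ` M. {a * n + b | n. True}) \<union> F"
  proof (intro equalityI subsetI)
    fix s assume s: "s \<in> S"
    have m: "s mod k \<in> {0..<k}" using k(1) by simp
    show "s \<in> (\<Union>(a, b)\<in>(\<lambda>m. (k, m)) ` M. {a * n + b | n. True}) \<union> F"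
    proof (cases "s mod k \<in> M")
      case True
      moreover have "s = k * (s div k) + s mod k" by simp
      ultimately show ?thesis by blast
    next
      case False
      have "s \<in> (\<lambda>n. s mod k + k * n) ` {n. s mod k + k * n \<in> S}"
        using s by (intro image_eqI[of _ _ "s div k"]) simp_all
      then show ?thesis using False m unfolding F_def by blast
    qed
  next
    fix s assume "s \<in> (\<Union>(a, b)\<in>(\<lambda>m. (k, m)) ` M. {a * n + b | n. True}) \<union> F"
    then show "s \<in> S"
    proof
      assume "s \<in> (\<Union>(a, b)\<in>(\<lambda>m. (k, m)) ` M. {a * n + b | n. True})"
      then obtain m n where mn: "m \<in> M" "s = k * n + m" by auto
      then have "m + k * n \<in> S" using k(2) by (simp add: M_def)
      then show ?thesis using mn(2) by (simp add: add.commute)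
    qed (auto simp: F_def)
  qed
  then show ?thesis unfolding two_sided_SML_def using fin
    by (intro exI[of _ "(\<lambda>m. (k, m)) ` M"] exI[of _ F]) simp
qed

lemma morsD:
  assumes "f \<in> mors K X Y"
  shows "base_map f \<in> extensional (points X)"
    and "comorph f \<in> extensional {V. open_of Y V}"
    and "open_of Y V \<Longrightarrow> comorph f V \<in> extensional (carrier (sections Y V))"
    and "continuous_map (top_of X) (top_of Y) (base_map f)"
    and "open_of Y V \<Longrightarrow> comorph f V \<in> alg_hom K (sections Y V) (sections X (inv_img X f V))"
    and "open_of Y V \<Longrightarrow> open_of Y W \<Longrightarrow> W \<subseteq> V \<Longrightarrow> t \<in> carrier (sections Y V) \<Longrightarrow>
      restr X (inv_img X f V) (inv_img X f W) (comorph f V t) = comorph f W (restr Y V W t)"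
    and "open_of Y V \<Longrightarrow> t \<in> carrier (sections Y V) \<Longrightarrow> x \<in> inv_img X f V \<Longrightarrow>
      germ_unit X (inv_img X f V) (comorph f V t) x \<Longrightarrow> germ_unit Y V t (base_map f x)"
  using assms unfolding mors_def by simp_all

lemma alg_hom_closed: "h \<in> alg_hom K A B \<Longrightarrow> a \<in> carrier A \<Longrightarrow> h a \<in> carrier B"
  unfolding alg_hom_def by (auto dest: ring_hom_closed)

lemma alg_hom_compose:
  assumes A: "algebra K A" and g: "g \<in> alg_hom K A B" and h: "h \<in> alg_hom K B C"
  shows "compose (carrier A) h g \<in> alg_hom K A C"
proof -
  interpret algebra K A by fact
  have "cring A" by unfold_locales
  then interpret A: cring A .
  show ?thesis
    using g h unfolding alg_hom_def ring_hom_def by (auto simp: compose_def Pi_iff)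
qed

lemma presheafD:
  assumes "is_presheaf K X"
  shows algebra_sections: "open_of X U \<Longrightarrow> algebra K (sections X U)"
    and restr_alg_hom: "open_of X U \<Longrightarrow> open_of X V \<Longrightarrow> V \<subseteq> U \<Longrightarrow>
      restr X U V \<in> alg_hom K (sections X U) (sections X V)"
  using assms unfolding is_presheaf_def by simp_all

lemma restr_closed:
  "is_presheaf K X \<Longrightarrow> open_of X U \<Longrightarrow> open_of X V \<Longrightarrow> V \<subseteq> U \<Longrightarrow> s \<in> carrier (sections X U) \<Longrightarrow>
    restr X U V s \<in> carrier (sections X V)"
  by (rule alg_hom_closed[OF restr_alg_hom])

lemma open_inv_img: "f \<in> mors K X Y \<Longrightarrow> open_of Y V \<Longrightarrow> open_of X (inv_img X f V)"
  unfolding inv_img_def by (rule openin_continuous_map_preimage[OF morsD(4)])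

lemma base_map_closed: "f \<in> mors K X Y \<Longrightarrow> x \<in> points X \<Longrightarrow> base_map f x \<in> points Y"
  using continuous_map_funspace[OF morsD(4)] by blast

lemma inv_img_points: "f \<in> mors K X Y \<Longrightarrow> inv_img X f (points Y) = points X"
  unfolding inv_img_def by (auto dest: base_map_closed)

lemma inv_img_comp: "f \<in> mors K X Y \<Longrightarrow> inv_img X (comp_mor X Y Z g f) V = inv_img X f (inv_img Y g V)"
  unfolding inv_img_def comp_mor_def by (auto simp: compose_eq base_map_closed)

lemma comorph_closed:
  "f \<in> mors K X Y \<Longrightarrow> open_of Y V \<Longrightarrow> t \<in> carrier (sections Y V) \<Longrightarrow>
    comorph f V t \<in> carrier (sections X (inv_img X f V))"
  by (rule alg_hom_closed[OF morsD(5)])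

lemma comorph_comp:
  "open_of Z W \<Longrightarrow> comorph (comp_mor X Y Z g f) W =
    compose (carrier (sections Z W)) (comorph f (inv_img Y g W)) (comorph g W)"
  by (simp add: comp_mor_def)

lemma comp_mor_closed:
  assumes f: "f \<in> mors K X Y" and g: "g \<in> mors K Y Z" and Z: "is_presheaf K Z"
  shows "comp_mor X Y Z g f \<in> mors K X Z"
  unfolding mors_def
proof (intro CollectI conjI allI impI ballI)
  let ?h = "comp_mor X Y Z g f"
  show "base_map ?h \<in> extensional (points X)" "comorph ?h \<in> extensional {V. open_of Z V}"
    by (simp_all add: comp_mor_def)
  show "continuous_map (top_of X) (top_of Z) (base_map ?h)"
    by (rule continuous_map_eq[OF continuous_map_compose[OF morsD(4)[OF f] morsD(4)[OF g]]])
      (simp add: comp_mor_def compose_eq)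
  fix V assume V: "open_of Z V"
  note gV = open_inv_img[OF g V]
  show "comorph ?h V \<in> extensional (carrier (sections Z V))"
    by (simp add: comorph_comp[OF V])
  show "comorph ?h V \<in> alg_hom K (sections Z V) (sections X (inv_img X ?h V))"
    unfolding comorph_comp[OF V] inv_img_comp[OF f]
    by (rule alg_hom_compose[OF algebra_sections[OF Z V] morsD(5)[OF g V] morsD(5)[OF f gV]])
  fix t assume t: "t \<in> carrier (sections Z V)"
  note gt = comorph_closed[OF g V t]
  show "restr X (inv_img X ?h V) (inv_img X ?h W) (comorph ?h V t) = comorph ?h W (restr Z V W t)"
    if W: "open_of Z W" "W \<subseteq> V" for W
  proof -
    have "inv_img Y g W \<subseteq> inv_img Y g V" using W(2) by (auto simp: inv_img_def)
    then have "restr X (inv_img X f (inv_img Y g V)) (inv_img X f (inv_img Y g W)) (comorph f (inv_img Y g V) (comorph g V t))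
      = comorph f (inv_img Y g W) (restr Y (inv_img Y g V) (inv_img Y g W) (comorph g V t))"
      by (intro morsD(6)[OF f gV open_inv_img[OF g W(1)] _ gt])
    also have "\<dots> = comorph f (inv_img Y g W) (comorph g W (restr Z V W t))"
      by (simp only: morsD(6)[OF g V W t])
    finally show ?thesis
      by (simp add: comorph_comp V W(1) inv_img_comp[OF f] compose_eq t restr_closed[OF Z V W t])
  qed
  fix x assume x: "x \<in> inv_img X ?h V" and u: "germ_unit X (inv_img X ?h V) (comorph ?h V t) x"
  have xX: "x \<in> points X" using x by (simp add: inv_img_def)
  have x': "x \<in> inv_img X f (inv_img Y g V)" using x by (simp add: inv_img_comp[OF f])
  then have fx: "base_map f x \<in> inv_img Y g V" by (simp add: inv_img_def)
  have "germ_unit Y (inv_img Y g V) (comorph g V t) (base_map f x)"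
    using u by (intro morsD(7)[OF f gV gt x']) (simp add: comorph_comp[OF V] inv_img_comp[OF f] compose_eq t)
  then have "germ_unit Z V t (base_map g (base_map f x))" by (rule morsD(7)[OF g V t fx])
  then show "germ_unit Z V t (base_map ?h x)" using xX by (simp add: comp_mor_def compose_eq)
qed

lemma inv_img_id: "open_of X V \<Longrightarrow> inv_img X (id_mor X) V = V"
  using openin_subset[of "top_of X" V] by (auto simp: inv_img_def id_mor_def)

lemma id_mor_closed:
  assumes X: "is_presheaf K X" shows "id_mor X \<in> mors K X X"
  unfolding mors_def
proof (intro CollectI conjI allI impI ballI)
  show "base_map (id_mor X) \<in> extensional (points X)" "comorph (id_mor X) \<in> extensional {V. open_of X V}"
    by (simp_all add: id_mor_def)
  show "continuous_map (top_of X) (top_of X) (base_map (id_mor X))"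
    by (rule continuous_map_eq[OF continuous_map_id]) (simp add: id_mor_def)
  fix V assume V: "open_of X V"
  have c: "comorph (id_mor X) V = (\<lambda>s\<in>carrier (sections X V). s)" using V by (simp add: id_mor_def)
  show "comorph (id_mor X) V \<in> extensional (carrier (sections X V))" by (simp add: c)
  show "comorph (id_mor X) V \<in> alg_hom K (sections X V) (sections X (inv_img X (id_mor X) V))"
  proof -
    interpret algebra K "sections X V" by (rule algebra_sections[OF X V])
    have "cring (sections X V)" by unfold_locales
    then interpret A: cring "sections X V" .
    show ?thesis unfolding c inv_img_id[OF V] alg_hom_def ring_hom_def by auto
  qed
  fix t assume t: "t \<in> carrier (sections X V)"
  show "restr X (inv_img X (id_mor X) V) (inv_img X (id_mor X) W) (comorph (id_mor X) V t) =
      comorph (id_mor X) W (restr X V W t)" if W: "open_of X W" "W \<subseteq> V" for W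
    using W restr_closed[OF X V W t] by (simp add: inv_img_id V c t) (simp add: id_mor_def)
  fix x assume "x \<in> inv_img X (id_mor X) V" "germ_unit X (inv_img X (id_mor X) V) (comorph (id_mor X) V t) x"
  then show "germ_unit X V t (base_map (id_mor X) x)"
    using openin_subset[OF V] by (simp add: inv_img_id[OF V] c t) (auto simp: id_mor_def)
qed

lemma space_map_eqI:
  fixes f g :: "('p, 's, 'q, 't) space_map"
  assumes "base_map f = base_map g" "comorph f = comorph g" shows "f = g"
  using assms by (cases f; cases g) simp

text \<open>The powers of an automorphism with negative exponents refer to inverses in the group of
  units of the endomorphism monoid, so that the monoid laws are needed in full.\<close>

lemma monoid_End:
  assumes X: "is_presheaf K X" shows "monoid (End_monoid K X)"
proof (rule monoidI; unfold End_monoid_def monoid.simps partial_object.simps)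
  fix f g assume "f \<in> mors K X X" "g \<in> mors K X X"
  then show "comp_mor X X X f g \<in> mors K X X" using comp_mor_closed X by blast
next
  show "id_mor X \<in> mors K X X" by (rule id_mor_closed[OF X])
next
  fix h g f assume h: "h \<in> mors K X X" and g: "g \<in> mors K X X" and f: "f \<in> mors K X X"
  show "comp_mor X X X (comp_mor X X X h g) f = comp_mor X X X h (comp_mor X X X g f)"
  proof (rule space_map_eqI)
    show "base_map (comp_mor X X X (comp_mor X X X h g) f) = base_map (comp_mor X X X h (comp_mor X X X g f))"
      by (auto simp: comp_mor_def compose_def base_map_closed[OF f] fun_eq_iff)
    show "comorph (comp_mor X X X (comp_mor X X X h g) f) = comorph (comp_mor X X X h (comp_mor X X X g f))"
    proof
      fix W
      show "comorph (comp_mor X X X (comp_mor X X X h g) f) W = comorph (comp_mor X X X h (comp_mor X X X g f)) W"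
      proof (cases "open_of X W")
        case True
        then show ?thesis
          by (auto simp: comorph_comp open_inv_img[OF h] inv_img_comp[OF g] compose_def fun_eq_iff comorph_closed[OF h])
      qed (simp add: comp_mor_def)
    qed
  qed
next
  fix f assume f: "f \<in> mors K X X"
  show "comp_mor X X X (id_mor X) f = f"
  proof (rule space_map_eqI)
    show "base_map (comp_mor X X X (id_mor X) f) = base_map f"
      using extensional_arb[OF morsD(1)[OF f]] base_map_closed[OF f]
      by (auto simp: comp_mor_def id_mor_def compose_def fun_eq_iff)
    show "comorph (comp_mor X X X (id_mor X) f) = comorph f"
    proof
      fix W
      show "comorph (comp_mor X X X (id_mor X) f) W = comorph f W"
      proof (cases "open_of X W")
        case True
        then show ?thesis using extensional_arb[OF morsD(3)[OF f True]]
          by (auto simp: comorph_comp inv_img_id compose_def fun_eq_iff) (auto simp: id_mor_def)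
      next
        case False
        then show ?thesis using extensional_arb[OF morsD(2)[OF f], of W] by (simp add: comp_mor_def)
      qed
    qed
  qed
  show "comp_mor X X X f (id_mor X) = f"
  proof (rule space_map_eqI)
    show "base_map (comp_mor X X X f (id_mor X)) = base_map f"
      using extensional_arb[OF morsD(1)[OF f]]
      by (auto simp: comp_mor_def id_mor_def compose_def fun_eq_iff)
    show "comorph (comp_mor X X X f (id_mor X)) = comorph f"
    proof
      fix W
      show "comorph (comp_mor X X X f (id_mor X)) W = comorph f W"
      proof (cases "open_of X W")
        case True
        have "comorph (id_mor X) (inv_img X f W) s = s" if "s \<in> carrier (sections X (inv_img X f W))" for s
          using that open_inv_img[OF f True] by (simp add: id_mor_def)
        then show ?thesis using extensional_arb[OF morsD(3)[OF f True]] comorph_closed[OF f True]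
          by (auto simp: comorph_comp[OF True] compose_def fun_eq_iff)
      next
        case False
        then show ?thesis using extensional_arb[OF morsD(2)[OF f], of W] by (simp add: comp_mor_def)
      qed
    qed
  qed
qed

lemma Aut_group_simps:
  "carrier (Aut_group K X) \<subseteq> mors K X X"
  "f \<otimes>\<^bsub>Aut_group K X\<^esub> g = comp_mor X X X f g" "\<one>\<^bsub>Aut_group K X\<^esub> = id_mor X"
  unfolding Aut_group_def by (auto simp: units_of_carrier units_of_mult units_of_one Units_def End_monoid_def)

text \<open>Passing to global sections reverses composition; since the powers of \<open>\<sigma>\<close>
  commute, one still obtains an action of the integers.\<close>

lemma eventually_periodic_Aut:
  assumes K: "field K" "char_zero K" and X: "is_presheaf K X" "fin_gen_algebra K (global_sections X)"
    and \<sigma>: "\<sigma> \<in> carrier (Aut_group K X)"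
    and I: "ideal I (global_sections X)" and J: "ideal J (global_sections X)"
  shows "eventually_periodic {n::int. \<forall>a\<in>J. comorph (\<sigma> [^]\<^bsub>Aut_group K X\<^esub> n) (points X) a \<in> I}"
proof (rule eventually_periodic_flow[OF K X(2) _ _ _ I J])
  let ?G = "Aut_group K X"
  have "group ?G" unfolding Aut_group_def by (rule monoid.units_group[OF monoid_End[OF X(1)]])
  then interpret G: group ?G .
  have pow: "\<sigma> [^]\<^bsub>?G\<^esub> n \<in> mors K X X" for n :: int
    using G.int_pow_closed[OF \<sigma>, of n] Aut_group_simps(1) by blast
  have op: "open_of X (points X)" by (rule openin_topspace)
  show "comorph (\<sigma> [^]\<^bsub>?G\<^esub> n) (points X) \<in> alg_hom K (global_sections X) (global_sections X)" for n :: int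
    using morsD(5)[OF pow op] by (simp add: inv_img_points[OF pow])
  fix a assume a: "a \<in> carrier (global_sections X)"
  show "comorph (\<sigma> [^]\<^bsub>?G\<^esub> (0::int)) (points X) a = a"
    using a by (simp add: Aut_group_simps id_mor_def)
  show "comorph (\<sigma> [^]\<^bsub>?G\<^esub> (m + n)) (points X) a =
      comorph (\<sigma> [^]\<^bsub>?G\<^esub> m) (points X) (comorph (\<sigma> [^]\<^bsub>?G\<^esub> n) (points X) a)" for m n :: int
  proof -
    have "\<sigma> [^]\<^bsub>?G\<^esub> (m + n) = comp_mor X X X (\<sigma> [^]\<^bsub>?G\<^esub> n) (\<sigma> [^]\<^bsub>?G\<^esub> m)"
      using G.int_pow_mult[OF \<sigma>, of n m] by (simp add: Aut_group_simps add.commute)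
    then show ?thesis using a by (simp add: comorph_comp[OF op] inv_img_points[OF pow] compose_eq)
  qed
qed

lemma ideal_of_ideal:
  assumes X: "is_presheaf K X" and Z: "closed_subscheme K X Z i"
  shows "ideal (ideal_of X Z i) (global_sections X)"
proof -
  have i: "i \<in> mors K Z X" and "is_presheaf K Z"
    using Z by (simp_all add: closed_subscheme_def is_scheme_def locally_ringed_space_def is_sheaf_def)
  then have "algebra K (global_sections Z)" "algebra K (global_sections X)"
    using X by (auto intro!: algebra_sections)
  then have "cring (global_sections Z)" "cring (global_sections X)" by (auto dest: algebra.axioms(2))
  then have r: "ring (global_sections Z)" "ring (global_sections X)" by (auto dest: cring.axioms(1))
  have "comorph i (points X) \<in> ring_hom (global_sections X) (global_sections Z)"
    using morsD(5)[OF i openin_topspace] by (simp add: inv_img_points[OF i] alg_hom_def)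
  then have "ring_hom_ring (global_sections X) (global_sections Z) (comorph i (points X))"
    using r by (intro ring_hom_ringI2)
  then show ?thesis unfolding ideal_of_def by (rule ring_hom_ring.kernel_is_ideal)
qed

lemma ideal_of_image:
  assumes f: "f \<in> mors K X X"
  shows "ideal_of X Z (image_subscheme X Z f i) =
    {a \<in> carrier (global_sections X). comorph f (points X) a \<in> ideal_of X Z i}"
proof -
  have op: "open_of X (points X)" by (rule openin_topspace)
  have cl: "comorph f (points X) a \<in> carrier (global_sections X)" if "a \<in> carrier (global_sections X)" for a
    using comorph_closed[OF f op that] by (simp add: inv_img_points[OF f])
  show ?thesis
  proof (rule Set.set_eqI)
    fix a
    show "a \<in> ideal_of X Z (image_subscheme X Z f i) \<longleftrightarrow>
      a \<in> {a \<in> carrier (global_sections X). comorph f (points X) a \<in> ideal_of X Z i}"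
      unfolding ideal_of_def image_subscheme_def a_kernel_def' comorph_comp[OF op] inv_img_points[OF f]
      using cl[of a] by (cases "a \<in> carrier (global_sections X)") (simp_all add: compose_eq)
  qed
qed

theorem theorem1p8:
  fixes K :: "'k ring"
    and \<XX> :: "('k, 'p, 's) algebraic_space"
    and \<YY> :: "('k, 'q, 't) algebraic_space" and j :: "('q, 't, 'p, 's) space_map"
    and \<ZZ> :: "('k, 'r, 'u) algebraic_space" and i :: "('r, 'u, 'p, 's) space_map"
    and \<sigma> :: "('p, 's, 'p, 's) space_map"
  assumes "field K" and "char_zero K"
    and "affine_scheme_of_finite_type K \<XX>"
    and "\<sigma> \<in> carrier (Aut_group K \<XX>)"
    and "closed_subscheme K \<XX> \<YY> j"
    and "closed_subscheme K \<XX> \<ZZ> i"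
  shows "two_sided_SML
    {n :: int. subscheme_le \<XX> \<ZZ> (image_subscheme \<XX> \<ZZ> (\<sigma> [^]\<^bsub>Aut_group K \<XX>\<^esub> n) i) \<YY> j}"
proof -
  let ?G = "Aut_group K \<XX>"
  have X: "is_presheaf K \<XX>" "fin_gen_algebra K (global_sections \<XX>)"
    using assms(3) by (simp_all add: affine_scheme_of_finite_type_def affine_scheme_def
        locally_ringed_space_def is_sheaf_def)
  note I = ideal_of_ideal[OF X(1) assms(6)] and J = ideal_of_ideal[OF X(1) assms(5)]
  have "group ?G" unfolding Aut_group_def by (rule monoid.units_group[OF monoid_End[OF X(1)]])
  then have pow: "\<sigma> [^]\<^bsub>?G\<^esub> n \<in> mors K \<XX> \<XX>" for n :: int
    using group.int_pow_closed[OF _ assms(4), of n] Aut_group_simps(1) by blast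
  have "{n :: int. subscheme_le \<XX> \<ZZ> (image_subscheme \<XX> \<ZZ> (\<sigma> [^]\<^bsub>?G\<^esub> n) i) \<YY> j} =
      {n. \<forall>a\<in>ideal_of \<XX> \<YY> j. comorph (\<sigma> [^]\<^bsub>?G\<^esub> n) (points \<XX>) a \<in> ideal_of \<XX> \<ZZ> i}"
    unfolding subscheme_le_def ideal_of_image[OF pow] using ideal.Icarr[OF J] by auto
  then show ?thesis
    using eventually_periodic_imp_two_sided_SML[OF eventually_periodic_Aut[OF assms(1,2) X assms(4) I J]] by simp
qed

end
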